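(* Let $G$ be a compact, connected, simple Lie group and $K$ a compact subgroup such that $G/K$ is an irreducible Hermitian symmetric space of compact type, with Lie algebra decomposition $\mathfrak{g}=\mathfrak{k}+\mathfrak{p}$, and let $\phi:G\to G/K$ be the homogeneous projection. Let $m=\dim G$, $n=\dim G/K$ (real dimensions), and choose an orthonormal basis $\{e_k\}_{k=1}^m$ for $\mathfrak{g}$ such that $e_1,\dots,e_{m-n}$ is a basis for $\mathfrak{k}$ and $e_{m-n+1},\dots,e_m$ a basis for $\mathfrak{p}$. Then the second variation operator $\mathscr{L}_\phi$ takes the form, for $Y\in C^\infty(G,\mathfrak{p})$, $$\mathscr{L}_\phi Y=-J\Big(-\frac{\lambda}{2}J(Y)-J\sum_{k=1}^m e_ke_k(Y)+\frac32J\sum_{a=1}^{m-n}[e_a(Y),e_a]+\sum_{r,s=m-n+1}^m\omega\big(e_re_s(Y)-\tfrac12[e_r,e_s](Y),e_r\big)e_s\Big).$$ Here $\lambda$ is the eigenvalue of the Casimir operator associated to the adjoint representation of $\mathfrak{g}$: $-\sum_{k=1}^m[e_k,[e_k,X]]=\lambda X$ for $X\in\mathfrak{g}$.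
   Context: Setting: $\mathfrak{k}$ is the Lie algebra of $K$ and $\mathfrak{p}$ its orthogonal complement, an $\mathrm{Ad}_K$-invariant subspace with $[\mathfrak{p},\mathfrak{p}]\subseteq\mathfrak{k}$. The inner product $\langle\cdot,\cdot\rangle$ on $\mathfrak{g}$ is the negative of the Killing form (or a suitable positive multiple of it); $G$ carries the induced bi-invariant metric and $G/K$ the metric making $\phi:G\to G/K$, $g\mapsto g\cdot o$ ($o$ the identity coset), a Riemannian submersion. The Hermitian (Kähler) structure on $G/K$ is induced by the adjoint action on $\mathfrak{p}$ of an element, denoted $J$, of the centre of $\mathfrak{k}$; so for $v\in\mathfrak{p}$, $Jv=[J,v]$, and $\omega(v,w)=\langle Jv,w\rangle$ is the Kähler form on $\mathfrak{p}$. Identifications: $TG\cong G\times\mathfrak{g}$ by left translation, and $\phi^{-1}T(G/K)\cong G\times\mathfrak{p}$ via $(g,X)\mapsto\frac{d}{dt}|_{t=0}\,g\exp(tX)\cdot o$, so that $\Gamma(\phi^{-1}T(G/K))\cong C^\infty(G,\mathfrak{p})$ and $d\phi$ becomes the orthogonal projection $\mathfrak{g}\to\mathfrak{p}$. An element $X\in\mathfrak{g}$ acts as a derivation (left-invariant vector field) on functions $f:G\to V$, $V$ a vector space, by $X(f)(g)=\frac{d}{dt}|_{t=0}f(g\exp(tX))$; thus $e_k(Y)$, $e_re_s(Y)$, $[e_r,e_s](Y)$ and $J(Y)$ (with parentheses, $J$ being the central element of $\mathfrak{k}$) denote derivatives of the $\mathfrak{p}$-valued function $Y$, whereas $J$ applied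 as a linear map (the outer $-J$, and the $J$ preceding sums) is the complex structure $[J,\cdot]$ on $\mathfrak{p}$. Second variation: $\phi$ is a critical point of $E(\phi)=\frac12\int_G|\phi^*\omega|^2\,{\ast 1}$ (for maps $G\to G/K$, with $\ast 1$ the volume form and $|\cdot|$ the norm on $2$-forms given by $|\alpha|^2=\frac12\sum_{i,j}\alpha(e_i,e_j)^2$), and $\mathscr{L}_\phi$ is the operator on $\Gamma(\phi^{-1}T(G/K))$ representing the Hessian of $E$ at $\phi$: $\frac{\partial^2}{\partial s\,\partial t}|_{s=t=0}E(\phi_{s,t})=\int_G h(X,\mathscr{L}_\phi Y)\,{\ast 1}$ for every smooth 2-parameter variation $\phi_{s,t}$ of $\phi=\phi_{0,0}$ with $X=\partial_t\phi_{s,t}|_{s=t=0}$, $Y=\partial_s\phi_{s,t}|_{s=t=0}$, where $h$ is the metric of $G/K$. *)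

theory Defs
  imports "HOL-Analysis.Analysis" "HOL-Algebra.Coset"
begin

section \<open>Smooth maps and atlases\<close>

text \<open>Intended for open \<open>S\<close>: all iterated directional derivatives up to the given order exist,
  every one below the top order is totally differentiable, and all are continuous.\<close>

fun Ck_on :: "nat \<Rightarrow> ('a::euclidean_space \<Rightarrow> 'b::euclidean_space) \<Rightarrow> 'a set \<Rightarrow> bool" where
  "Ck_on 0 f S = continuous_on S f"
| "Ck_on (Suc k) f S =
    (\<exists>D. (\<forall>x\<in>S. (f has_derivative D x) (at x)) \<and> (\<forall>v. Ck_on k (\<lambda>x. D x v) S))"

definition smooth_on :: "'a set \<Rightarrow> ('a::euclidean_space \<Rightarrow> 'b::euclidean_space) \<Rightarrow> bool" where
  "smooth_on S f \<longleftrightarrow> (\<forall>k. Ck_on k f S)"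

type_synonym ('p, 'e) chart = "'p set \<times> ('p \<Rightarrow> 'e)"

definition smooth_atlas :: "('p::topological_space, 'e::euclidean_space) chart set \<Rightarrow> bool" where
  "smooth_atlas A \<longleftrightarrow>
    (\<Union>(U, c)\<in>A. U) = UNIV \<and>
    (\<forall>(U, c)\<in>A. open U \<and> open (c ` U) \<and> homeomorphism U (c ` U) c (inv_into U c)) \<and>
    (\<forall>(U, c)\<in>A. \<forall>(V, d)\<in>A. smooth_on (c ` (U \<inter> V)) (d \<circ> inv_into U c))"

definition euclid_atlas :: "('e, 'e) chart set" where
  "euclid_atlas = {(UNIV, id)}"

definition prod_atlas :: "('p, 'e) chart set \<Rightarrow> ('q, 'f) chart set \<Rightarrow> ('p \<times> 'q, 'e \<times> 'f) chart set" where
  "prod_atlas A B = {(U \<times> V, map_prod c d) | U c V d. (U, c) \<in> A \<and> (V, d) \<in> B}"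

text \<open>Smoothness on an open subset \<open>W\<close> of a manifold with atlas \<open>A\<close>, into one with atlas \<open>B\<close>.\<close>

definition smooth_map_on ::
  "('p::topological_space, 'e::euclidean_space) chart set \<Rightarrow>
   ('q::topological_space, 'f::euclidean_space) chart set \<Rightarrow> 'p set \<Rightarrow> ('p \<Rightarrow> 'q) \<Rightarrow> bool" where
  "smooth_map_on A B W f \<longleftrightarrow>
    continuous_on W f \<and>
    (\<forall>(U, c)\<in>A. \<forall>(V, d)\<in>B. smooth_on (c ` (U \<inter> W \<inter> f -` V)) (d \<circ> f \<circ> inv_into U c))"


section \<open>Lie groups and their Lie algebras\<close>

text \<open>The Lie algebra is presented as a Euclidean space \<open>'a\<close> (whose inner product will be the
  multiple of the Killing form) together with the exponential map \<open>'a \<Rightarrow> 'g\<close>. The conditions in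
  \<open>lie_group\<close> say that the differential of \<open>lie_exp\<close> at \<open>0\<close> is a linear isomorphism onto the
  tangent space at the identity and that \<open>lie_exp\<close> is the exponential map of the group under this
  identification. The bracket is not data; it is the commutator of left-invariant vector fields.\<close>

record ('g, 'a, 'e) lie_data = "'g monoid" +
  atlas :: "('g, 'e) chart set"
  lie_exp :: "'a \<Rightarrow> 'g"

locale lie_group = group G
  for G :: "('g::{t2_space, second_countable_topology}, 'a::euclidean_space, real^'m) lie_data"
      (structure) +
  assumes carrier_UNIV: "carrier G = UNIV"
    and atlas: "smooth_atlas (atlas G)"
    and mult_smooth: "smooth_map_on (prod_atlas (atlas G) (atlas G)) (atlas G) UNIV (\<lambda>(x, y). x \<otimes> y)"
    and inv_smooth: "smooth_map_on (atlas G) (atlas G) UNIV (\<lambda>x. inv x)"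
    and exp_smooth: "smooth_map_on euclid_atlas (atlas G) UNIV (lie_exp G)"
    and exp_add: "\<And>s t X. lie_exp G ((s + t) *\<^sub>R X) = lie_exp G (s *\<^sub>R X) \<otimes> lie_exp G (t *\<^sub>R X)"
    and exp_deriv: "\<And>U c. (U, c) \<in> atlas G \<Longrightarrow> \<one> \<in> U \<Longrightarrow>
          \<exists>D. ((c \<circ> lie_exp G) has_derivative D) (at 0) \<and> bij D"

definition smooth_fun ::
  "('g::{t2_space, second_countable_topology}, 'a::euclidean_space, real^'m) lie_data \<Rightarrow>
   ('g \<Rightarrow> 'v::euclidean_space) \<Rightarrow> bool" where
  "smooth_fun G f \<longleftrightarrow> smooth_map_on (atlas G) euclid_atlas UNIV f"

text \<open>The derivation \<open>X(f)\<close>.\<close>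

definition lder ::
  "('g, 'a::euclidean_space, 'e) lie_data \<Rightarrow> 'a \<Rightarrow> ('g \<Rightarrow> 'v::real_normed_vector) \<Rightarrow> 'g \<Rightarrow> 'v" where
  "lder G X f g = vector_derivative (\<lambda>t. f (g \<otimes>\<^bsub>G\<^esub> lie_exp G (t *\<^sub>R X))) (at 0)"

definition bracket ::
  "('g::{t2_space, second_countable_topology}, 'a::euclidean_space, real^'m) lie_data \<Rightarrow>
   'a \<Rightarrow> 'a \<Rightarrow> 'a" where
  "bracket G X Y = (THE Z. \<forall>f :: 'g \<Rightarrow> real. smooth_fun G f \<longrightarrow>
     (\<forall>g. lder G Z f g = lder G X (lder G Y f) g - lder G Y (lder G X f) g))"

definition Ad :: "('g, 'a::euclidean_space, 'e) lie_data \<Rightarrow> 'g \<Rightarrow> 'a \<Rightarrow> 'a" where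
  "Ad G g X = (THE Z. \<forall>t. lie_exp G (t *\<^sub>R Z) =
     g \<otimes>\<^bsub>G\<^esub> lie_exp G (t *\<^sub>R X) \<otimes>\<^bsub>G\<^esub> inv\<^bsub>G\<^esub> g)"

text \<open>The trace of \<open>ad X \<circ> ad Y\<close>.\<close>

definition killing ::
  "('g::{t2_space, second_countable_topology}, 'a::euclidean_space, real^'m) lie_data \<Rightarrow>
   'a \<Rightarrow> 'a \<Rightarrow> real" where
  "killing G X Y = (\<Sum>b\<in>Basis. bracket G X (bracket G Y b) \<bullet> b)"

definition lie_simple ::
  "('g::{t2_space, second_countable_topology}, 'a::euclidean_space, real^'m) lie_data \<Rightarrow> bool" where
  "lie_simple G \<longleftrightarrow>
    (\<exists>X Y. bracket G X Y \<noteq> 0) \<and>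
    (\<forall>I. subspace I \<and> (\<forall>X. \<forall>Y\<in>I. bracket G X Y \<in> I) \<longrightarrow> I = {0} \<or> I = UNIV)"

definition killing_metric ::
  "('g::{t2_space, second_countable_topology}, 'a::euclidean_space, real^'m) lie_data \<Rightarrow> bool" where
  "killing_metric G \<longleftrightarrow> (\<exists>c>0. \<forall>X Y. X \<bullet> Y = - c * killing G X Y)"

text \<open>Left-trivialisation of the tangent vector at \<open>g\<close> with coordinate vector \<open>w\<close> in the chart \<open>c\<close>.\<close>

definition left_triv :: "('g, 'a::euclidean_space, real^'m) lie_data \<Rightarrow>
    ('g \<Rightarrow> real^'m) \<Rightarrow> 'g \<Rightarrow> real^'m \<Rightarrow> 'a" where
  "left_triv G c g w =
    (THE X. ((\<lambda>t. c (g \<otimes>\<^bsub>G\<^esub> lie_exp G (t *\<^sub>R X))) has_vector_derivative w) (at 0))"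

text \<open>Coordinate matrix \<open>(g\<^sub>i\<^sub>j)\<close> of the left-invariant Riemannian metric (bi-invariant under
  \<open>killing_metric\<close>).\<close>

definition metric_matrix :: "('g, 'a::euclidean_space, real^'m) lie_data \<Rightarrow>
    ('g \<Rightarrow> real^'m) \<Rightarrow> 'g \<Rightarrow> real^'m^'m" where
  "metric_matrix G c g = (\<chi> i j. left_triv G c g (axis i 1) \<bullet> left_triv G c g (axis j 1))"

definition riemannian_volume ::
  "('g::{t2_space, second_countable_topology}, 'a::euclidean_space, real^'m) lie_data \<Rightarrow>
   'g measure \<Rightarrow> bool" where
  "riemannian_volume G \<mu> \<longleftrightarrow>
    sets \<mu> = sets borel \<and>
    (\<forall>(U, c)\<in>atlas G. \<forall>B\<in>sets borel. B \<subseteq> U \<longrightarrow>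
      emeasure \<mu> B =
        (\<integral>\<^sup>+ x. ennreal (sqrt (det (metric_matrix G c (inv_into U c x)))) * indicator (c ` B) x \<partial>lborel))"


section \<open>Hermitian symmetric pairs\<close>

definition lie_sub :: "('g, 'a::euclidean_space, 'e) lie_data \<Rightarrow> 'g set \<Rightarrow> 'a set" where
  "lie_sub G K = {X. \<forall>t. lie_exp G (t *\<^sub>R X) \<in> K}"

abbreviation lie_compl :: "('g, 'a::euclidean_space, 'e) lie_data \<Rightarrow> 'g set \<Rightarrow> 'a set" where
  "lie_compl G K \<equiv> orthogonal_comp (lie_sub G K)"

text \<open>\<open>G/K\<close> is a symmetric space: \<open>K\<close> lies between the fixed-point group of a smooth involution
  and its identity component.\<close>

definition symmetric_pair ::
  "('g::{t2_space, second_countable_topology}, 'a::euclidean_space, real^'m) lie_data \<Rightarrow>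
   'g set \<Rightarrow> bool" where
  "symmetric_pair G K \<longleftrightarrow>
    (\<exists>\<sigma>. \<sigma> \<in> hom G G \<and> smooth_map_on (atlas G) (atlas G) UNIV \<sigma> \<and> \<sigma> \<circ> \<sigma> = id \<and>
         K \<subseteq> {g. \<sigma> g = g} \<and> connected_component_set {g. \<sigma> g = g} \<one>\<^bsub>G\<^esub> \<subseteq> K)"

text \<open>Irreducibility of the isotropy representation of \<open>K\<close> on \<open>\<pp>\<close>.\<close>

definition isotropy_irreducible ::
  "('g, 'a::euclidean_space, 'e) lie_data \<Rightarrow> 'g set \<Rightarrow> bool" where
  "isotropy_irreducible G K \<longleftrightarrow>
    lie_compl G K \<noteq> {0} \<and>
    (\<forall>V. subspace V \<and> V \<subseteq> lie_compl G K \<and> (\<forall>k\<in>K. \<forall>v\<in>V. Ad G k v \<in> V) \<longrightarrow>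
         V = {0} \<or> V = lie_compl G K)"

text \<open>\<open>J\<close> is central in \<open>\<kk>\<close> and \<open>ad J\<close> is an \<open>Ad\<^sub>K\<close>-invariant complex structure on \<open>\<pp>\<close>, hence
  induces a \<open>G\<close>-invariant almost complex structure on \<open>G/K\<close>; that it is orthogonal, integrable and
  Kaehler is then automatic.\<close>

definition hermitian_element ::
  "('g::{t2_space, second_countable_topology}, 'a::euclidean_space, real^'m) lie_data \<Rightarrow>
   'g set \<Rightarrow> 'a \<Rightarrow> bool" where
  "hermitian_element G K J \<longleftrightarrow>
    J \<in> lie_sub G K \<and> (\<forall>X\<in>lie_sub G K. bracket G J X = 0) \<and>
    (\<forall>v\<in>lie_compl G K. bracket G J (bracket G J v) = - v) \<and>
    (\<forall>k\<in>K. \<forall>v\<in>lie_compl G K. Ad G k (bracket G J v) = bracket G J (Ad G k v))"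

definition kahler ::
  "('g::{t2_space, second_countable_topology}, 'a::euclidean_space, real^'m) lie_data \<Rightarrow>
   'a \<Rightarrow> 'a \<Rightarrow> 'a \<Rightarrow> real" where
  "kahler G J v w = bracket G J v \<bullet> w"


section \<open>The homogeneous space \<open>G/K\<close>\<close>

text \<open>Points of \<open>G/K\<close> are the left cosets. The manifold structure of \<open>G/K\<close>, the one making the
  projection a submersion, is given through its smooth functions: those whose pull-back to \<open>G\<close> is
  smooth. A map into \<open>G/K\<close> is smooth iff its composites with these functions are, and tangent
  vectors of \<open>G/K\<close> are derivations on them.\<close>

definition proj :: "('g, 'a, 'e) lie_data \<Rightarrow> 'g set \<Rightarrow> 'g \<Rightarrow> 'g set" where
  "proj G K g = g <#\<^bsub>G\<^esub> K"

definition quot_smooth ::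
  "('g::{t2_space, second_countable_topology}, 'a::euclidean_space, real^'m) lie_data \<Rightarrow>
   'g set \<Rightarrow> ('g set \<Rightarrow> real) set" where
  "quot_smooth G K = {f. smooth_fun G (f \<circ> proj G K)}"

text \<open>The inverse of the identification \<open>\<pp> \<cong> T\<^bsub>gK\<^esub>(G/K)\<close>, \<open>v \<mapsto> d/dt|\<^sub>0 g exp(tv)\<cdot>o\<close>.\<close>

definition frame_coord ::
  "('g::{t2_space, second_countable_topology}, 'a::euclidean_space, real^'m) lie_data \<Rightarrow>
   'g set \<Rightarrow> 'g \<Rightarrow> (('g set \<Rightarrow> real) \<Rightarrow> real) \<Rightarrow> 'a" where
  "frame_coord G K g D =
    (THE v. v \<in> lie_compl G K \<and> (\<forall>f\<in>quot_smooth G K. D f = lder G v (f \<circ> proj G K) g))"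

text \<open>The Kaehler form at a point \<open>x\<close> of \<open>G/K\<close>; by \<open>Ad\<^sub>K\<close>-invariance the choice of the
  representative \<open>g\<close> is immaterial.\<close>

definition kahler_form ::
  "('g::{t2_space, second_countable_topology}, 'a::euclidean_space, real^'m) lie_data \<Rightarrow>
   'g set \<Rightarrow> 'a \<Rightarrow> 'g set \<Rightarrow>
   (('g set \<Rightarrow> real) \<Rightarrow> real) \<Rightarrow> (('g set \<Rightarrow> real) \<Rightarrow> real) \<Rightarrow> real" where
  "kahler_form G K J x D\<^sub>1 D\<^sub>2 =
    (let g = (SOME g. proj G K g = x)
     in kahler G J (frame_coord G K g D\<^sub>1) (frame_coord G K g D\<^sub>2))"

definition differential ::
  "('g, 'a::euclidean_space, 'e) lie_data \<Rightarrow> ('g \<Rightarrow> 'g set) \<Rightarrow> 'g \<Rightarrow> 'a \<Rightarrow>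
   ('g set \<Rightarrow> real) \<Rightarrow> real" where
  "differential G \<psi> g X f = lder G X (f \<circ> \<psi>) g"

definition pullback_kahler ::
  "('g::{t2_space, second_countable_topology}, 'a::euclidean_space, real^'m) lie_data \<Rightarrow>
   'g set \<Rightarrow> 'a \<Rightarrow> ('g \<Rightarrow> 'g set) \<Rightarrow> 'g \<Rightarrow> 'a \<Rightarrow> 'a \<Rightarrow> real" where
  "pullback_kahler G K J \<psi> g X Y =
    kahler_form G K J (\<psi> g) (differential G \<psi> g X) (differential G \<psi> g Y)"

definition form_norm_sq :: "('a::euclidean_space \<Rightarrow> 'a \<Rightarrow> real) \<Rightarrow> real" where
  "form_norm_sq \<alpha> = (1/2) * (\<Sum>X\<in>Basis. \<Sum>Y\<in>Basis. (\<alpha> X Y)\<^sup>2)"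

definition energy ::
  "('g::{t2_space, second_countable_topology}, 'a::euclidean_space, real^'m) lie_data \<Rightarrow>
   'g measure \<Rightarrow> 'g set \<Rightarrow> 'a \<Rightarrow> ('g \<Rightarrow> 'g set) \<Rightarrow> real" where
  "energy G \<mu> K J \<psi> = (1/2) * (\<integral>g. form_norm_sq (pullback_kahler G K J \<psi> g) \<partial>\<mu>)"


section \<open>Second variation at the homogeneous projection\<close>

text \<open>\<open>C\<^sup>\<infinity>(G, \<pp>)\<close>, i.e. the sections of \<open>\<phi>\<^sup>-\<^sup>1T(G/K)\<close>.\<close>

definition sections ::
  "('g::{t2_space, second_countable_topology}, 'a::euclidean_space, real^'m) lie_data \<Rightarrow>
   'g set \<Rightarrow> ('g \<Rightarrow> 'a) set" where
  "sections G K = {Y. smooth_fun G Y \<and> range Y \<subseteq> lie_compl G K}"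

text \<open>Smooth two-parameter variations \<open>(s, t) \<mapsto> \<psi> s t\<close> of the projection, with
  \<open>\<bar>s\<bar>, \<bar>t\<bar> < \<epsilon>\<close>.\<close>

definition variation ::
  "('g::{t2_space, second_countable_topology}, 'a::euclidean_space, real^'m) lie_data \<Rightarrow>
   'g set \<Rightarrow> real \<Rightarrow> (real \<Rightarrow> real \<Rightarrow> 'g \<Rightarrow> 'g set) \<Rightarrow> bool" where
  "variation G K \<epsilon> \<psi> \<longleftrightarrow>
    \<epsilon> > 0 \<and>
    (\<forall>s\<in>{-\<epsilon><..<\<epsilon>}. \<forall>t\<in>{-\<epsilon><..<\<epsilon>}. range (\<psi> s t) \<subseteq> range (proj G K)) \<and>
    (\<forall>f\<in>quot_smooth G K.
       smooth_map_on (prod_atlas euclid_atlas (atlas G)) euclid_atlas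
         (({-\<epsilon><..<\<epsilon>} \<times> {-\<epsilon><..<\<epsilon>}) \<times> UNIV) (\<lambda>((s, t), g). f (\<psi> s t g))) \<and>
    \<psi> 0 0 = proj G K"

text \<open>The field along \<open>\<phi>\<close> given by the derivative at \<open>0\<close> of a one-parameter family \<open>\<eta>\<close> with
  \<open>\<eta> 0 = \<phi>\<close>, as a \<open>\<pp>\<close>-valued function on \<open>G\<close>.\<close>

definition variation_field ::
  "('g::{t2_space, second_countable_topology}, 'a::euclidean_space, real^'m) lie_data \<Rightarrow>
   'g set \<Rightarrow> (real \<Rightarrow> 'g \<Rightarrow> 'g set) \<Rightarrow> 'g \<Rightarrow> 'a" where
  "variation_field G K \<eta> g = frame_coord G K g (\<lambda>f. deriv (\<lambda>t. f (\<eta> t g)) 0)"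

text \<open>The metric \<open>h\<close> of \<open>G/K\<close> is the inner product of \<open>\<pp>\<close> under the identification.\<close>

definition represents_hessian ::
  "('g::{t2_space, second_countable_topology}, 'a::euclidean_space, real^'m) lie_data \<Rightarrow>
   'g measure \<Rightarrow> 'g set \<Rightarrow> 'a \<Rightarrow> ('g \<Rightarrow> 'a) \<Rightarrow> ('g \<Rightarrow> 'a) \<Rightarrow> bool" where
  "represents_hessian G \<mu> K J Y Z \<longleftrightarrow>
    Z \<in> sections G K \<and>
    (\<forall>\<epsilon> \<psi>. variation G K \<epsilon> \<psi> \<and> variation_field G K (\<lambda>s. \<psi> s 0) = Y \<longrightarrow>
       deriv (\<lambda>s. deriv (\<lambda>t. energy G \<mu> K J (\<psi> s t)) 0) 0 =
         (\<integral>g. variation_field G K (\<lambda>t. \<psi> 0 t) g \<bullet> Z g \<partial>\<mu>))"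

definition second_variation ::
  "('g::{t2_space, second_countable_topology}, 'a::euclidean_space, real^'m) lie_data \<Rightarrow>
   'g measure \<Rightarrow> 'g set \<Rightarrow> 'a \<Rightarrow> ('g \<Rightarrow> 'a) \<Rightarrow> 'g \<Rightarrow> 'a" where
  "second_variation G \<mu> K J Y = (THE Z. represents_hessian G \<mu> K J Y Z)"

end

theory Submission
  imports Defs
begin

text \<open>The map \<open>gK \<mapsto> Ad\<^sub>g J\<close> takes \<open>G/K\<close> to the adjoint orbit of \<open>J\<close> in the Lie algebra. If \<open>u\<close> is the
  composite of a map \<open>G \<rightarrow> G/K\<close> with it, then the pulled back Kaehler form is
  \<open>\<omega>(X, Y) = \<langle>u, [X(u), Y(u)]\<rangle>\<close>, and the triple product \<open>\<langle>a, [b, c]\<rangle>\<close> of three tangent vectors of the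
  orbit vanishes since \<open>[\<pp>, \<pp>] \<subseteq> \<kk>\<close>. Hence in a variation \<open>\<partial>\<^sub>t \<omega> = d\<beta>\<close> with
  \<open>\<beta>(X) = \<langle>u, [\<partial>\<^sub>t u, X(u)]\<rangle>\<close>. At the projection, \<open>\<omega>(X, Y) = \<langle>[J, X], Y\<rangle>\<close> and
  \<open>\<beta> = \<langle>[J, V], -\<rangle>\<close> for the variation field \<open>V\<close>. Integration by parts over \<open>G\<close> turns the Hessian into
  \<open>\<integral> \<langle>[J, X], d\<^sup>*d[J, Y]\<rangle> - (\<lambda>/2) \<integral> \<langle>X, Y - [J, J(Y)]\<rangle>\<close>: the Casimir eigenvalue enters through
  \<open>\<Sum>\<^sub>k [e\<^sub>k, [J, e\<^sub>k]] = \<lambda>J\<close>. Expanding \<open>d\<^sup>*d\<close> in the frame gives the formula, and the variations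
  \<open>g exp(sY + tX)\<cdot>o\<close> show that the Hessian determines the operator.\<close>

section \<open>Calculus of smooth maps\<close>

text \<open>\<open>G/K\<close> carries no charts here: maps into it are tested by functions, tangent
  vectors are derivations, and \<open>frame_coord\<close> is a description operator. The orbit of
  \<open>J\<close> supplies a linear target for calculus, because v -> [v, J] is an isometry of
  \<pp> inverted by ad J; a derivation that comes from a curve can thus be solved for its vector in
  \<pp>.

  Why the Hessian depends on X and Y alone: besides the product of the two first variations of
  \<omega> it contains \<omega> paired with d of the s-derivative of \<beta>, and this involves the
  mixed second derivative of the variation. At the projection \<omega> is the invariant form
  <[J, -], ->, whose codifferential is a multiple of <J, ->. Hence only the value at the vertical
  vector J survives, where the second derivative is paired with [J, J] = 0.

  Integration by parts rests on invariance of the volume: a right translation acts on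
  left-trivialised vectors by Ad, which is orthogonal for a multiple of the Killing form.

  The coefficient 3/2: the adjoint of d applied to d[J, Y] yields the sum over \<kk> with
  coefficient 2, of which 1/2 is hidden in the terms [e_r, e_s](Y) of the last sum.\<close>

lemma Ck_on_SucI:
  assumes "\<And>x. x \<in> S \<Longrightarrow> (f has_derivative D x) (at x)" "\<And>v. Ck_on k (\<lambda>x. D x v) S"
  shows "Ck_on (Suc k) f S"
  unfolding Ck_on.simps by (intro exI[of _ D] conjI ballI allI assms)

lemma Ck_on_SucE:
  assumes "Ck_on (Suc k) f S"
  obtains D where "\<And>x. x \<in> S \<Longrightarrow> (f has_derivative D x) (at x)" "\<And>v. Ck_on k (\<lambda>x. D x v) S"
  using assms that unfolding Ck_on.simps by metis

lemma Ck_on_cong: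
  assumes "open S" "\<And>x. x \<in> S \<Longrightarrow> f x = g x"
  shows "Ck_on k f S = Ck_on k g S"
proof -
  have *: "Ck_on k g S" if "Ck_on k f S" "\<And>x. x \<in> S \<Longrightarrow> f x = g x"
    for f g :: "'a::euclidean_space \<Rightarrow> 'b::euclidean_space"
  proof (cases k)
    case 0
    with that show ?thesis by (simp cong: continuous_on_cong)
  next
    case (Suc n)
    with that have "Ck_on (Suc n) f S" by simp
    then obtain D where D: "\<And>x. x\<in>S \<Longrightarrow> (f has_derivative D x) (at x)" "\<And>v. Ck_on n (\<lambda>x. D x v) S"
      by (rule Ck_on_SucE) blast
    have "\<And>x. x\<in>S \<Longrightarrow> (g has_derivative D x) (at x)"
      using has_derivative_transform_within_open[OF D(1) \<open>open S\<close>] that(2) by metis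
    then show ?thesis using D(2) Suc Ck_on_SucI by metis
  qed
  show ?thesis using *[of f g] *[of g f] assms(2) by auto
qed

lemma Ck_on_subset: "Ck_on k f S \<Longrightarrow> T \<subseteq> S \<Longrightarrow> Ck_on k f T"
proof (induction k arbitrary: f)
  case 0
  then show ?case using continuous_on_subset by (simp, blast)
next
  case (Suc k)
  from Suc.prems(1) obtain D where D: "\<And>x. x\<in>S \<Longrightarrow> (f has_derivative D x) (at x)" "\<And>v. Ck_on k (\<lambda>x. D x v) S"
    by (rule Ck_on_SucE) blast
  show ?case
    by (rule Ck_on_SucI[OF D(1) Suc.IH[OF D(2) Suc.prems(2)]]) (use Suc.prems(2) in blast)
qed

lemma Ck_on_Suc_imp: "Ck_on (Suc k) f S \<Longrightarrow> Ck_on k f S"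
proof (induction k arbitrary: f)
  case 0
  then obtain D where "\<And>x. x\<in>S \<Longrightarrow> (f has_derivative D x) (at x)"
    by (rule Ck_on_SucE) blast
  then show ?case
    using has_derivative_continuous_on[OF has_derivative_at_withinI, of S f D] by simp
next
  case (Suc k)
  from Suc.prems obtain D where D: "\<And>x. x\<in>S \<Longrightarrow> (f has_derivative D x) (at x)" "\<And>v. Ck_on (Suc k) (\<lambda>x. D x v) S"
    by (rule Ck_on_SucE) blast
  show ?case by (rule Ck_on_SucI[OF D(1) Suc.IH[OF D(2)]])
qed

text \<open>The family of derivatives hidden in \<open>Ck_on\<close> is unique, since each
  derivative is taken at x in the full space. One global choice, \<open>frechet_derivative\<close>,
  therefore serves all neighbourhoods, which is what makes smoothness a local property in
  \<open>Ck_on_local\<close>.\<close>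

lemma Ck_on_frechet:
  assumes "open S"
  shows "Ck_on (Suc k) f S \<longleftrightarrow> (\<forall>x\<in>S. f differentiable (at x)) \<and>
           (\<forall>v. Ck_on k (\<lambda>x. frechet_derivative f (at x) v) S)"
proof
  assume "Ck_on (Suc k) f S"
  then obtain D where D: "\<And>x. x\<in>S \<Longrightarrow> (f has_derivative D x) (at x)" "\<And>v. Ck_on k (\<lambda>x. D x v) S"
    by (rule Ck_on_SucE) blast
  have "\<And>x. x \<in> S \<Longrightarrow> frechet_derivative f (at x) = D x"
    using D(1) frechet_derivative_at by metis
  then have "Ck_on k (\<lambda>x. frechet_derivative f (at x) v) S" for v
    using Ck_on_cong[OF assms, of "\<lambda>x. frechet_derivative f (at x) v" "\<lambda>x. D x v"] D(2) by simp
  then show "(\<forall>x\<in>S. f differentiable (at x)) \<and> (\<forall>v. Ck_on k (\<lambda>x. frechet_derivative f (at x) v) S)"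
    using D(1) differentiable_def by blast
next
  assume "(\<forall>x\<in>S. f differentiable (at x)) \<and> (\<forall>v. Ck_on k (\<lambda>x. frechet_derivative f (at x) v) S)"
  then show "Ck_on (Suc k) f S"
    by (intro Ck_on_SucI[where D = "\<lambda>x. frechet_derivative f (at x)"]) (auto simp: frechet_derivative_works[symmetric])
qed

lemma Ck_on_local:
  assumes "open S" "\<And>x. x \<in> S \<Longrightarrow> \<exists>U. open U \<and> x \<in> U \<and> U \<subseteq> S \<and> Ck_on k f U"
  shows "Ck_on k f S"
  using assms(2)
proof (induction k arbitrary: f)
  case 0
  show ?case unfolding Ck_on.simps continuous_on_eq_continuous_at[OF assms(1)]
  proof
    fix x assume "x \<in> S"
    then obtain U where "open U" "x \<in> U" "continuous_on U f" using 0 by auto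
    then show "isCont f x" by (simp add: continuous_on_eq_continuous_at)
  qed
next
  case (Suc k)
  show ?case unfolding Ck_on_frechet[OF assms(1)]
  proof (intro conjI ballI allI)
    fix x assume "x \<in> S"
    then obtain U where "open U" "x \<in> U" "Ck_on (Suc k) f U" using Suc.prems by blast
    then show "f differentiable (at x)" using Ck_on_frechet by blast
  next
    fix v show "Ck_on k (\<lambda>x. frechet_derivative f (at x) v) S"
      by (rule Suc.IH) (use Suc.prems Ck_on_frechet in metis)
  qed
qed

lemma Ck_on_const: "Ck_on k (\<lambda>x. c) S"
  by (induction k arbitrary: c) (auto intro: Ck_on_SucI[where D = "\<lambda>x v. 0"] simp del: Ck_on.simps(2))

lemma Ck_on_linear: "bounded_linear f \<Longrightarrow> Ck_on k f S"
  by (cases k) (auto intro!: Ck_on_SucI[where D = "\<lambda>x. f"] Ck_on_const linear_continuous_on bounded_linear_imp_has_derivative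
      simp del: Ck_on.simps(2))

lemma Ck_on_linear_compose: "bounded_linear L \<Longrightarrow> Ck_on k f S \<Longrightarrow> Ck_on k (\<lambda>x. L (f x)) S"
proof (induction k arbitrary: f)
  case 0
  then show ?case using bounded_linear.continuous_on by auto
next
  case (Suc k)
  from Suc.prems(2) obtain D where "\<And>x. x\<in>S \<Longrightarrow> (f has_derivative D x) (at x)" "\<And>v. Ck_on k (\<lambda>x. D x v) S"
    by (rule Ck_on_SucE) blast
  then show ?case
    by (intro Ck_on_SucI[where D = "\<lambda>x v. L (D x v)"] bounded_linear.has_derivative[OF Suc.prems(1)] Suc.IH[OF Suc.prems(1)])
qed

lemma Ck_on_Pair: "Ck_on k f S \<Longrightarrow> Ck_on k g S \<Longrightarrow> Ck_on k (\<lambda>x. (f x, g x)) S"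
proof (induction k arbitrary: f g)
  case 0
  then show ?case by (auto intro: continuous_on_Pair)
next
  case (Suc k)
  from Suc.prems(1) obtain D where "\<And>x. x\<in>S \<Longrightarrow> (f has_derivative D x) (at x)" "\<And>v. Ck_on k (\<lambda>x. D x v) S"
    by (rule Ck_on_SucE) blast
  moreover from Suc.prems(2) obtain E where
    "\<And>x. x\<in>S \<Longrightarrow> (g has_derivative E x) (at x)" "\<And>v. Ck_on k (\<lambda>x. E x v) S"
    by (rule Ck_on_SucE) blast
  ultimately show ?case
    by (intro Ck_on_SucI[where D = "\<lambda>x v. (D x v, E x v)"] has_derivative_Pair Suc.IH)
qed

lemma Ck_on_add: "Ck_on k f S \<Longrightarrow> Ck_on k g S \<Longrightarrow> Ck_on k (\<lambda>x. f x + g x) S"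
  using Ck_on_linear_compose[OF bounded_linear_add[OF bounded_linear_fst bounded_linear_snd], of k "\<lambda>x. (f x, g x)" S] Ck_on_Pair
  by auto

lemma Ck_on_sum: "(\<And>i. i \<in> I \<Longrightarrow> Ck_on k (f i) S) \<Longrightarrow> Ck_on k (\<lambda>x. \<Sum>i\<in>I. f i x) S"
  by (induction I rule: infinite_finite_induct) (auto intro: Ck_on_add Ck_on_const)

lemma Ck_on_bilinear:
  "bounded_bilinear B \<Longrightarrow> Ck_on k f S \<Longrightarrow> Ck_on k g S \<Longrightarrow> Ck_on k (\<lambda>x. B (f x) (g x)) S"
proof (induction k arbitrary: f g)
  case 0
  then show ?case using bounded_bilinear.continuous_on by auto
next
  case (Suc k)
  from Suc.prems(2) obtain D where "\<And>x. x\<in>S \<Longrightarrow> (f has_derivative D x) (at x)" "\<And>v. Ck_on k (\<lambda>x. D x v) S"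
    by (rule Ck_on_SucE) blast
  moreover from Suc.prems(3) obtain E where
    "\<And>x. x\<in>S \<Longrightarrow> (g has_derivative E x) (at x)" "\<And>v. Ck_on k (\<lambda>x. E x v) S"
    by (rule Ck_on_SucE) blast
  ultimately show ?case
    by (intro Ck_on_SucI[where D = "\<lambda>x v. B (f x) (E x v) + B (D x v) (g x)"] bounded_bilinear.FDERIV[OF Suc.prems(1)] Ck_on_add
        Suc.IH[OF Suc.prems(1)] Ck_on_Suc_imp[OF Suc.prems(2)] Ck_on_Suc_imp[OF Suc.prems(3)])
qed

text \<open>In the chain rule the direction \<open>D x v\<close> moves with \<open>x\<close>, while
  the hypothesis on \<open>g\<close> controls its derivative along fixed directions. Expanding
  \<open>D x v\<close> in \<open>Basis\<close> gives products of a component of \<open>D x v\<close>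
  with \<open>E (f x) b\<close>, and the induction hypothesis applies to the latter factor.\<close>

lemma Ck_on_compose:
  "Ck_on k g T \<Longrightarrow> Ck_on k f S \<Longrightarrow> f ` S \<subseteq> T \<Longrightarrow> Ck_on k (\<lambda>x. g (f x)) S"
proof (induction k arbitrary: f g)
  case 0
  then show ?case using continuous_on_compose2[of T g S f] by simp
next
  case (Suc k)
  from Suc.prems(2) obtain D where D: "\<And>x. x\<in>S \<Longrightarrow> (f has_derivative D x) (at x)" "\<And>v. Ck_on k (\<lambda>x. D x v) S"
    by (rule Ck_on_SucE) blast
  from Suc.prems(1) obtain E where E: "\<And>x. x\<in>T \<Longrightarrow> (g has_derivative E x) (at x)" "\<And>v. Ck_on k (\<lambda>x. E x v) T"
    by (rule Ck_on_SucE) blast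
  have eq: "E (f x) (D x v) = (\<Sum>b\<in>Basis. (D x v \<bullet> b) *\<^sub>R E (f x) b)" if "x \<in> S" for x v
  proof -
    have "linear (E (f x))"
      using that Suc.prems(3) E(1) has_derivative_linear by blast
    then show ?thesis
      by (subst euclidean_representation[of "D x v", symmetric]) (simp add: linear_sum linear_scale)
  qed
  have der: "((\<lambda>x. g (f x)) has_derivative (\<lambda>v. \<Sum>b\<in>Basis. (D x v \<bullet> b) *\<^sub>R E (f x) b)) (at x)"
    if "x \<in> S" for x
    using has_derivative_compose[OF D(1)[OF that], of g "E (f x)"] E(1) Suc.prems(3) that
    by (auto simp: eq image_subset_iff)
  have C: "Ck_on k (\<lambda>x. \<Sum>b\<in>Basis. (D x v \<bullet> b) *\<^sub>R E (f x) b) S" for v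
    by (rule Ck_on_sum, rule Ck_on_bilinear[OF bounded_bilinear_scaleR
          Ck_on_linear_compose[OF bounded_linear_inner_left D(2)]])
       (rule Suc.IH[OF E(2) Ck_on_Suc_imp[OF Suc.prems(2)] Suc.prems(3)])
  show ?case by (rule Ck_on_SucI[OF der C])
qed

lemma smooth_onI: "(\<And>k. Ck_on k f S) \<Longrightarrow> smooth_on S f"
  and smooth_onD: "smooth_on S f \<Longrightarrow> Ck_on k f S"
  by (simp_all add: smooth_on_def)

lemma smooth_on_cong: "open S \<Longrightarrow> (\<And>x. x \<in> S \<Longrightarrow> f x = g x) \<Longrightarrow> smooth_on S f = smooth_on S g"
  unfolding smooth_on_def by (simp add: Ck_on_cong[of S f g])

lemma smooth_on_subset: "smooth_on S f \<Longrightarrow> T \<subseteq> S \<Longrightarrow> smooth_on T f"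
  by (rule smooth_onI, rule Ck_on_subset[OF smooth_onD])

lemma smooth_on_local:
  assumes "open S" "\<And>x. x \<in> S \<Longrightarrow> \<exists>U. open U \<and> x \<in> U \<and> U \<subseteq> S \<and> smooth_on U f"
  shows "smooth_on S f"
proof (rule smooth_onI, rule Ck_on_local[OF assms(1)])
  fix k x assume "x \<in> S"
  with assms(2) obtain U where "open U" "x \<in> U" "U \<subseteq> S" "smooth_on U f" by metis
  then show "\<exists>U. open U \<and> x \<in> U \<and> U \<subseteq> S \<and> Ck_on k f U"
    by (intro exI[of _ U]) (simp add: smooth_onD)
qed

lemma smooth_on_const [simp, intro]: "smooth_on S (\<lambda>x. c)"
  by (rule smooth_onI, rule Ck_on_const)

lemma smooth_on_linear: "bounded_linear L \<Longrightarrow> smooth_on S L"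
  by (rule smooth_onI, rule Ck_on_linear)

lemma smooth_on_linear_compose: "bounded_linear L \<Longrightarrow> smooth_on S f \<Longrightarrow> smooth_on S (\<lambda>x. L (f x))"
  by (rule smooth_onI, rule Ck_on_linear_compose[OF _ smooth_onD])

lemma smooth_on_Pair: "smooth_on S f \<Longrightarrow> smooth_on S g \<Longrightarrow> smooth_on S (\<lambda>x. (f x, g x))"
  by (rule smooth_onI, rule Ck_on_Pair[OF smooth_onD smooth_onD])

lemma smooth_on_add: "smooth_on S f \<Longrightarrow> smooth_on S g \<Longrightarrow> smooth_on S (\<lambda>x. f x + g x)"
  by (rule smooth_onI, rule Ck_on_add[OF smooth_onD smooth_onD])

lemma smooth_on_sum: "(\<And>i. i \<in> I \<Longrightarrow> smooth_on S (f i)) \<Longrightarrow> smooth_on S (\<lambda>x. \<Sum>i\<in>I. f i x)"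
  by (rule smooth_onI, rule Ck_on_sum, rule smooth_onD)

lemma smooth_on_bilinear:
  "bounded_bilinear B \<Longrightarrow> smooth_on S f \<Longrightarrow> smooth_on S g \<Longrightarrow> smooth_on S (\<lambda>x. B (f x) (g x))"
  by (rule smooth_onI, rule Ck_on_bilinear[OF _ smooth_onD smooth_onD])

lemma smooth_on_compose:
  "smooth_on T g \<Longrightarrow> smooth_on S f \<Longrightarrow> f ` S \<subseteq> T \<Longrightarrow> smooth_on S (\<lambda>x. g (f x))"
  by (rule smooth_onI, rule Ck_on_compose[OF smooth_onD smooth_onD])

lemma smooth_on_id [simp, intro]: "smooth_on S (\<lambda>x. x)"
  by (rule smooth_on_linear) (rule bounded_linear_ident)

lemma smooth_on_fst: "smooth_on S f \<Longrightarrow> smooth_on S (\<lambda>x. fst (f x))"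
  by (rule smooth_on_linear_compose[OF bounded_linear_fst])

lemma smooth_on_snd: "smooth_on S f \<Longrightarrow> smooth_on S (\<lambda>x. snd (f x))"
  by (rule smooth_on_linear_compose[OF bounded_linear_snd])

lemma smooth_on_minus: "smooth_on S f \<Longrightarrow> smooth_on S (\<lambda>x. - f x)"
  by (rule smooth_on_linear_compose[OF bounded_linear_minus[OF bounded_linear_ident]])

lemma smooth_on_diff: "smooth_on S f \<Longrightarrow> smooth_on S g \<Longrightarrow> smooth_on S (\<lambda>x. f x - g x)"
  using smooth_on_add[of S f "\<lambda>x. - g x"] smooth_on_minus[of S g] by simp

lemmas smooth_on_scaleR = smooth_on_bilinear[OF bounded_bilinear_scaleR]
  and smooth_on_mult = smooth_on_bilinear[OF bounded_bilinear_mult]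
  and smooth_on_inner = smooth_on_bilinear[OF bounded_bilinear_inner]

lemma smooth_on_componentwise:
  assumes "\<And>b. b \<in> Basis \<Longrightarrow> smooth_on S (\<lambda>x. f x \<bullet> b)"
  shows "smooth_on S f"
proof -
  have "smooth_on S (\<lambda>x. (f x \<bullet> b) *\<^sub>R b)" if "b \<in> Basis" for b
    using smooth_on_scaleR[OF assms[OF that] smooth_on_const[of S b]] .
  then have "smooth_on S (\<lambda>x. \<Sum>b\<in>Basis. (f x \<bullet> b) *\<^sub>R b)"
    by (rule smooth_on_sum)
  then show ?thesis by (simp add: euclidean_representation)
qed

lemma smooth_on_imp_continuous_on: "smooth_on S f \<Longrightarrow> continuous_on S f"
  using smooth_onD[of S f 0] by simp

lemma smooth_on_imp_differentiable:
  assumes "smooth_on S f" "x \<in> S" shows "f differentiable (at x)"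
proof -
  have "Ck_on (Suc 0) f S" by (rule smooth_onD[OF assms(1)])
  then obtain D where "\<And>x. x\<in>S \<Longrightarrow> (f has_derivative D x) (at x)"
    by (rule Ck_on_SucE) blast
  then show ?thesis using assms(2) differentiableI by metis
qed

lemma smooth_on_has_derivative:
  "smooth_on S f \<Longrightarrow> x \<in> S \<Longrightarrow> (f has_derivative frechet_derivative f (at x)) (at x)"
  using smooth_on_imp_differentiable[of S f x] by (simp add: frechet_derivative_works)

lemma smooth_on_frechet:
  assumes "open S" "smooth_on S f"
  shows "smooth_on S (\<lambda>x. frechet_derivative f (at x) v)"
proof (rule smooth_onI)
  fix k show "Ck_on k (\<lambda>x. frechet_derivative f (at x) v) S"
    using smooth_onD[OF assms(2), of "Suc k"] Ck_on_frechet[OF assms(1), of k f] by (simp del: Ck_on.simps(2))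
qed


text \<open>Derivatives along left-invariant fields, parameter derivatives and \<open>Ad\<close> are
  all t-derivatives, at a fixed time, of jointly smooth expressions. This lemma makes them smooth in
  the remaining variables.\<close>

lemma smooth_on_partial_snd:
  fixes H :: "'z::euclidean_space \<times> real \<Rightarrow> 'b::euclidean_space"
  assumes "open S" "smooth_on S H" "open W" "\<And>z. z \<in> W \<Longrightarrow> (z, t0) \<in> S"
  shows "smooth_on W (\<lambda>z. vector_derivative (\<lambda>t. H (z, t)) (at t0))"
    and "z \<in> W \<Longrightarrow> ((\<lambda>t. H (z, t)) has_vector_derivative vector_derivative (\<lambda>t. H (z, t)) (at t0)) (at t0)"
proof -
  have der: "((\<lambda>t. H (z, t)) has_vector_derivative frechet_derivative H (at (z, t0)) (0, 1)) (at t0)"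
    if "z \<in> W" for z
  proof -
    let ?D = "frechet_derivative H (at (z, t0))"
    have D: "(H has_derivative ?D) (at (z, t0))"
      by (rule smooth_on_has_derivative[OF assms(2) assms(4)[OF that]])
    have "((\<lambda>t. H (z, t)) has_derivative (\<lambda>h. ?D (0, h))) (at t0)"
      by (rule has_derivative_compose[of "\<lambda>t. (z, t)", OF has_derivative_Pair[OF has_derivative_const has_derivative_ident] D])
    moreover have "?D (0, h) = h *\<^sub>R ?D (0, 1)" for h
      using linear_scale[OF has_derivative_linear[OF D], of h "(0,1)"]
      by (simp only: scaleR_Pair scaleR_zero_right real_scaleR_def mult_1_right)
    then have "(\<lambda>h. ?D (0, h)) = (\<lambda>h. h *\<^sub>R ?D (0, 1))" by (rule ext)
    ultimately show ?thesis
      unfolding has_vector_derivative_def by (simp only:)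
  qed
  show "((\<lambda>t. H (z, t)) has_vector_derivative vector_derivative (\<lambda>t. H (z, t)) (at t0)) (at t0)" if "z \<in> W" for z
    using der[OF that] vector_derivative_at by metis
  have "smooth_on W (\<lambda>z. frechet_derivative H (at (z, t0)) (0, 1))"
    by (rule smooth_on_compose[OF smooth_on_frechet[OF assms(1,2)] smooth_on_Pair[OF smooth_on_id smooth_on_const]])
       (use assms(4) in auto)
  moreover have "vector_derivative (\<lambda>t. H (z, t)) (at t0) = frechet_derivative H (at (z, t0)) (0, 1)" if "z \<in> W" for z
    using der[OF that] vector_derivative_at by blast
  ultimately show "smooth_on W (\<lambda>z. vector_derivative (\<lambda>t. H (z, t)) (at t0))"
    using smooth_on_cong[OF assms(3), of "\<lambda>z. vector_derivative (\<lambda>t. H (z, t)) (at t0)"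
        "\<lambda>z. frechet_derivative H (at (z, t0)) (0, 1)"] by simp
qed

text \<open>The classical flat function exp(-1/x), with a polynomial factor in y = 1/x so that the
  family is closed under differentiation: the derivative replaces \<open>p\<close> by y^2 (p - p'),
  whence the factor \<open>[:0, 0, 1:]\<close> below.\<close>

definition flat :: "real poly \<Rightarrow> real \<Rightarrow> real" where
  "flat p x = (if x > 0 then poly p (1 / x) * exp (- (1 / x)) else 0)"

lemma poly_exp_decay: "((\<lambda>y. poly p y * exp (- y)) \<longlongrightarrow> (0::real)) at_top"
proof -
  have "((\<lambda>y. \<Sum>i\<le>degree p. coeff p i * (y ^ i / exp y)) \<longlongrightarrow> (\<Sum>i\<le>degree p. coeff p i * 0)) at_top"
    by (intro tendsto_sum tendsto_mult tendsto_const tendsto_power_div_exp_0)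
  then show ?thesis
    by (simp add: poly_altdef sum_distrib_right exp_minus divide_inverse mult.assoc)
qed

lemma flat_has_derivative:
  "(flat p has_real_derivative flat ([:0, 0, 1:] * (p - pderiv p)) x) (at x)"
proof -
  consider "x > 0" | "x < 0" | "x = 0" by linarith
  then show ?thesis
  proof cases
    case 1
    have "((\<lambda>x. poly p (1 / x) * exp (- (1 / x))) has_real_derivative flat ([:0, 0, 1:] * (p - pderiv p)) x) (at x)"
      using 1 by (auto intro!: derivative_eq_intros DERIV_chain'[OF _ poly_DERIV] simp: flat_def field_simps power2_eq_square)
    then show ?thesis
      by (rule has_field_derivative_transform_within_open[where S = "{0<..}"]) (use 1 in \<open>auto simp: flat_def\<close>)
  next
    case 2
    have "((\<lambda>x. 0) has_real_derivative flat ([:0, 0, 1:] * (p - pderiv p)) x) (at x)"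
      using 2 by (simp add: flat_def)
    then show ?thesis
      by (rule has_field_derivative_transform_within_open[where S = "{..<0}"]) (use 2 in \<open>auto simp: flat_def\<close>)
  next
    case 3
    \<comment> \<open>The difference quotient at 0 from the right is y p(y) exp(-y) with y = 1/h;
      the extra factor y is the leading 0 in \<open>pCons 0 p\<close>.\<close>
    have "((\<lambda>y. poly (pCons 0 p) y * exp (- y)) \<longlongrightarrow> 0) at_top" by (rule poly_exp_decay)
    then have "((\<lambda>h. poly (pCons 0 p) (inverse h) * exp (- inverse h)) \<longlongrightarrow> 0) (at_right 0)"
      by (rule filterlim_compose[OF _ filterlim_inverse_at_top_right])
    then have "((\<lambda>h. flat p h / h) \<longlongrightarrow> 0) (at_right 0)"
      by (rule Lim_transform_eventually)
         (auto simp: flat_def eventually_at_right_field field_simps intro!: exI[of _ 1])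
    moreover have "((\<lambda>h. flat p h / h) \<longlongrightarrow> 0) (at_left 0)"
      by (rule Lim_transform_eventually[OF tendsto_const])
         (auto simp: flat_def eventually_at_left_field intro!: exI[of _ "-1"])
    ultimately have "((\<lambda>h. flat p h / h) \<longlongrightarrow> 0) (at 0)"
      by (simp add: filterlim_split_at)
    then show ?thesis by (simp add: 3 DERIV_def flat_def)
  qed
qed

lemma smooth_on_flat: "smooth_on UNIV (flat p)"
proof (rule smooth_onI)
  fix k show "Ck_on k (flat p) UNIV"
  proof (induction k arbitrary: p)
    case 0
    have "isCont (flat p) x" for x by (rule DERIV_isCont[OF flat_has_derivative])
    then show ?case by (simp add: continuous_at_imp_continuous_on)
  next
    case (Suc k)
    show ?case
    proof (rule Ck_on_SucI)
      show "(flat p has_derivative (*) (flat ([:0, 0, 1:] * (p - pderiv p)) x)) (at x)" for x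
        using flat_has_derivative[of p x] by (simp add: has_field_derivative_def)
      show "Ck_on k (\<lambda>x. flat ([:0, 0, 1:] * (p - pderiv p)) x * v) UNIV" for v
        by (rule Ck_on_linear_compose[OF bounded_linear_mult_left Suc.IH])
    qed
  qed
qed

lemma flat_one_pos: "x > 0 \<Longrightarrow> flat 1 x > 0"
  and flat_one_zero: "x \<le> 0 \<Longrightarrow> flat 1 x = 0"
  by (simp_all add: flat_def)

section \<open>Symmetry of second derivatives\<close>

lemma mixed_difference:
  fixes f :: "'a::euclidean_space \<Rightarrow> real"
  assumes "open S" "smooth_on S f" "h > 0"
    and S: "\<And>a b. a \<in> {0..h} \<Longrightarrow> b \<in> {0..h} \<Longrightarrow> x + a *\<^sub>R u + b *\<^sub>R v \<in> S"
  obtains a b where "a \<in> {0..h}" "b \<in> {0..h}"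
    "f (x + h *\<^sub>R u + h *\<^sub>R v) - f (x + h *\<^sub>R u) - f (x + h *\<^sub>R v) + f x =
      h * h * frechet_derivative (\<lambda>y. frechet_derivative f (at y) u) (at (x + a *\<^sub>R u + b *\<^sub>R v)) v"
proof -
  let ?F = "\<lambda>y. frechet_derivative f (at y) u"
  have S1: "smooth_on S ?F" by (rule smooth_on_frechet[OF assms(1,2)])
  have d: "((\<lambda>r. g (w + r *\<^sub>R z)) has_real_derivative frechet_derivative g (at (w + r *\<^sub>R z)) z) (at r)"
    if "smooth_on S g" "w + r *\<^sub>R z \<in> S" for g :: "'a \<Rightarrow> real" and w z r
  proof -
    let ?D = "frechet_derivative g (at (w + r *\<^sub>R z))"
    have D: "(g has_derivative ?D) (at (w + r *\<^sub>R z))" by (rule smooth_on_has_derivative[OF that])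
    have "((\<lambda>r. w + r *\<^sub>R z) has_derivative (\<lambda>h. h *\<^sub>R z)) (at r)"
      by (auto intro!: derivative_eq_intros)
    from has_derivative_compose[OF this D] have "((\<lambda>r. g (w + r *\<^sub>R z)) has_derivative (\<lambda>h. ?D (h *\<^sub>R z))) (at r)" .
    moreover have "(\<lambda>h. ?D (h *\<^sub>R z)) = (*) (?D z)"
      using linear_scale[OF has_derivative_linear[OF D]] by (simp add: fun_eq_iff mult.commute)
    ultimately show ?thesis by (simp add: has_field_derivative_def)
  qed
  let ?g = "\<lambda>r. f (x + h *\<^sub>R v + r *\<^sub>R u) - f (x + r *\<^sub>R u)"
  have "\<exists>a>0. a < h \<and> ?g h - ?g 0 = (h - 0) * (?F (x + h *\<^sub>R v + a *\<^sub>R u) - ?F (x + a *\<^sub>R u))"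
  proof (rule MVT2[OF assms(3)])
    fix r assume r: "0 \<le> r" "r \<le> h"
    show "(?g has_real_derivative ?F (x + h *\<^sub>R v + r *\<^sub>R u) - ?F (x + r *\<^sub>R u)) (at r)"
      by (intro DERIV_diff d assms(2)) (use S[of r h] S[of r 0] r in \<open>simp_all add: add_ac\<close>)
  qed
  then obtain a where a: "a > 0" "a < h" and a2: "?g h - ?g 0 = h * (?F (x + h *\<^sub>R v + a *\<^sub>R u) - ?F (x + a *\<^sub>R u))"
    by auto
  let ?k = "\<lambda>r. ?F (x + a *\<^sub>R u + r *\<^sub>R v)"
  have "\<exists>b>0. b < h \<and> ?k h - ?k 0 = (h - 0) * frechet_derivative ?F (at (x + a *\<^sub>R u + b *\<^sub>R v)) v"
  proof (rule MVT2[OF assms(3)])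
    fix r assume r: "0 \<le> r" "r \<le> h"
    show "(?k has_real_derivative frechet_derivative ?F (at (x + a *\<^sub>R u + r *\<^sub>R v)) v) (at r)"
      by (intro d S1) (use S[of a r] a r in auto)
  qed
  then obtain b where b: "b > 0" "b < h" and b2: "?k h - ?k 0 = h * frechet_derivative ?F (at (x + a *\<^sub>R u + b *\<^sub>R v)) v"
    by auto
  show thesis
  proof (rule that[of a b])
    show "f (x + h *\<^sub>R u + h *\<^sub>R v) - f (x + h *\<^sub>R u) - f (x + h *\<^sub>R v) + f x =
      h * h * frechet_derivative ?F (at (x + a *\<^sub>R u + b *\<^sub>R v)) v"
      using a2 b2 by (simp add: add_ac)
  qed (use a b in auto)
qed

text \<open>The second difference over a parallelogram is symmetric in \<open>u\<close> and
  \<open>v\<close>, and two applications of the mean value theorem identify it with h^2 times a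
  mixed derivative of either order at some point of the parallelogram. Continuity of both mixed
  derivatives lets the parallelogram shrink to \<open>x\<close>.\<close>

lemma second_derivative_symmetric_real:
  fixes f :: "'a::euclidean_space \<Rightarrow> real"
  assumes "open S" "smooth_on S f" "x \<in> S"
  shows "frechet_derivative (\<lambda>y. frechet_derivative f (at y) u) (at x) v =
         frechet_derivative (\<lambda>y. frechet_derivative f (at y) v) (at x) u"
proof -
  let ?A = "\<lambda>y. frechet_derivative (\<lambda>y. frechet_derivative f (at y) u) (at y) v"
  let ?B = "\<lambda>y. frechet_derivative (\<lambda>y. frechet_derivative f (at y) v) (at y) u"
  have cont: "isCont ?A x" "isCont ?B x"
    using smooth_on_imp_continuous_on[OF smooth_on_frechet[OF assms(1) smooth_on_frechet[OF assms(1,2)]]] assms(1,3)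
    by (simp_all add: continuous_on_eq_continuous_at)
  have le: "\<bar>?A x - ?B x\<bar> \<le> e" if "e > 0" for e
  proof -
    obtain d1 where d1: "d1 > 0" "\<And>y. dist y x < d1 \<Longrightarrow> dist (?A y) (?A x) < e / 2"
      using cont(1)[unfolded continuous_at_eps_delta, rule_format, of "e / 2"] half_gt_zero[OF \<open>e > 0\<close>] by blast
    obtain d2 where d2: "d2 > 0" "\<And>y. dist y x < d2 \<Longrightarrow> dist (?B y) (?B x) < e / 2"
      using cont(2)[unfolded continuous_at_eps_delta, rule_format, of "e / 2"] half_gt_zero[OF \<open>e > 0\<close>] by blast
    obtain d3 where d3: "d3 > 0" "ball x d3 \<subseteq> S"
      using assms(1,3) open_contains_ball by metis
    define d where "d = min d1 (min d2 d3)"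
    have d: "d > 0" using d1 d2 d3 by (simp add: d_def)
    \<comment> \<open>With this \<open>h\<close> the whole parallelogram lies in the ball of radius
      \<open>d\<close>; the summand 1 keeps the denominator positive when \<open>u\<close> and
      \<open>v\<close> vanish.\<close>
    define h where "h = d / (2 * (norm u + norm v + 1))"
    have h: "h > 0" using d by (simp add: h_def add_nonneg_pos)
    have near: "dist (x + a *\<^sub>R u + b *\<^sub>R v) x < d" if "a \<in> {0..h}" "b \<in> {0..h}" for a b
    proof -
      have "dist (x + a *\<^sub>R u + b *\<^sub>R v) x \<le> \<bar>a\<bar> * norm u + \<bar>b\<bar> * norm v"
        using norm_triangle_ineq[of "a *\<^sub>R u" "b *\<^sub>R v"] by (simp add: dist_norm add_ac)
      also have "\<dots> \<le> h * norm u + h * norm v"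
        using that by (intro add_mono mult_right_mono) auto
      also have "\<dots> < h * (2 * (norm u + norm v + 1))"
        using h mult_nonneg_nonneg[of h "norm u"] mult_nonneg_nonneg[of h "norm v"]
        by (simp add: algebra_simps add_nonneg_pos)
      also have "\<dots> = d" using add_nonneg_pos[of "norm u + norm v" 1] by (simp add: h_def)
      finally show ?thesis .
    qed
    have S: "x + a *\<^sub>R u + b *\<^sub>R v \<in> S" if "a \<in> {0..h}" "b \<in> {0..h}" for a b
      using near[OF that] d3 by (auto simp: d_def dist_commute)
    obtain a b where 1: "a \<in> {0..h}" "b \<in> {0..h}"
      "f (x + h *\<^sub>R u + h *\<^sub>R v) - f (x + h *\<^sub>R u) - f (x + h *\<^sub>R v) + f x = h * h * ?A (x + a *\<^sub>R u + b *\<^sub>R v)"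
      using mixed_difference[OF assms(1,2) h, of x u v] S by metis
    obtain a' b' where 2: "a' \<in> {0..h}" "b' \<in> {0..h}"
      "f (x + h *\<^sub>R v + h *\<^sub>R u) - f (x + h *\<^sub>R v) - f (x + h *\<^sub>R u) + f x = h * h * ?B (x + a' *\<^sub>R v + b' *\<^sub>R u)"
    proof (rule mixed_difference[OF assms(1,2) h, of x v u])
      show "x + a *\<^sub>R v + b *\<^sub>R u \<in> S" if "a \<in> {0..h}" "b \<in> {0..h}" for a b
        using S[OF that(2,1)] by (simp add: add_ac)
    qed
    have "h * h * ?A (x + a *\<^sub>R u + b *\<^sub>R v) = h * h * ?B (x + a' *\<^sub>R v + b' *\<^sub>R u)"
    proof -
      have "x + h *\<^sub>R v + h *\<^sub>R u = x + h *\<^sub>R u + h *\<^sub>R v" by (simp add: add_ac)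
      then have "f (x + h *\<^sub>R v + h *\<^sub>R u) = f (x + h *\<^sub>R u + h *\<^sub>R v)" by (rule arg_cong)
      then show ?thesis using 1(3) 2(3) by linarith
    qed
    then have "?A (x + a *\<^sub>R u + b *\<^sub>R v) = ?B (x + b' *\<^sub>R u + a' *\<^sub>R v)"
      using h by (simp add: add_ac)
    moreover have "dist (?A (x + a *\<^sub>R u + b *\<^sub>R v)) (?A x) < e / 2"
      using d1(2) near[OF 1(1,2)] by (simp add: d_def)
    moreover have "dist (?B (x + b' *\<^sub>R u + a' *\<^sub>R v)) (?B x) < e / 2"
      using d2(2) near[OF 2(2,1)] by (simp add: d_def)
    ultimately show ?thesis unfolding dist_real_def abs_le_iff abs_less_iff by linarith
  qed
  have "\<bar>?A x - ?B x\<bar> \<le> 0" by (rule field_le_epsilon) (simp add: le)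
  then show ?thesis by simp
qed


lemma frechet_derivative_inner_left:
  assumes "f differentiable (at x)"
  shows "frechet_derivative (\<lambda>y. f y \<bullet> b) (at x) v = frechet_derivative f (at x) v \<bullet> b"
proof -
  have "(f has_derivative frechet_derivative f (at x)) (at x)"
    using assms by (simp add: frechet_derivative_works)
  from bounded_linear.has_derivative[OF bounded_linear_inner_left this]
  have "((\<lambda>y. f y \<bullet> b) has_derivative (\<lambda>v. frechet_derivative f (at x) v \<bullet> b)) (at x)" .
  from frechet_derivative_at[OF this] show ?thesis by (simp add: fun_eq_iff)
qed

lemma second_derivative_symmetric:
  fixes f :: "'a::euclidean_space \<Rightarrow> 'b::euclidean_space"
  assumes "open S" "smooth_on S f" "x \<in> S"
  shows "frechet_derivative (\<lambda>y. frechet_derivative f (at y) u) (at x) v =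
         frechet_derivative (\<lambda>y. frechet_derivative f (at y) v) (at x) u"
proof (rule euclidean_eqI)
  fix b :: 'b assume "b \<in> Basis"
  have sm: "smooth_on S (\<lambda>y. f y \<bullet> b)" by (rule smooth_on_inner[OF assms(2) smooth_on_const])
  have *: "frechet_derivative (\<lambda>y. frechet_derivative f (at y) u) (at x) v \<bullet> b =
     frechet_derivative (\<lambda>y. frechet_derivative (\<lambda>y. f y \<bullet> b) (at y) u) (at x) v" for u v
  proof -
    have "frechet_derivative (\<lambda>y. frechet_derivative f (at y) u) (at x) v \<bullet> b =
      frechet_derivative (\<lambda>y. frechet_derivative f (at y) u \<bullet> b) (at x) v"
      by (rule frechet_derivative_inner_left[symmetric])
        (rule smooth_on_imp_differentiable[OF smooth_on_frechet[OF assms(1,2)] assms(3)])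
    also have "\<dots> = frechet_derivative (\<lambda>y. frechet_derivative (\<lambda>y. f y \<bullet> b) (at y) u) (at x) v"
    proof -
      have "((\<lambda>y. frechet_derivative f (at y) u \<bullet> b) has_derivative
          frechet_derivative (\<lambda>y. frechet_derivative f (at y) u \<bullet> b) (at x)) (at x)"
        by (rule smooth_on_has_derivative[OF smooth_on_inner[OF smooth_on_frechet[OF assms(1,2)] smooth_on_const] assms(3)])
      then have "((\<lambda>y. frechet_derivative (\<lambda>y. f y \<bullet> b) (at y) u) has_derivative
          frechet_derivative (\<lambda>y. frechet_derivative f (at y) u \<bullet> b) (at x)) (at x)"
        by (rule has_derivative_transform_within_open[OF _ assms(1,3)])
          (simp add: frechet_derivative_inner_left smooth_on_imp_differentiable[OF assms(2)])
      from frechet_derivative_at[OF this] show ?thesis by simp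
    qed
    finally show ?thesis .
  qed
  show "frechet_derivative (\<lambda>y. frechet_derivative f (at y) u) (at x) v \<bullet> b =
         frechet_derivative (\<lambda>y. frechet_derivative f (at y) v) (at x) u \<bullet> b"
    unfolding * by (rule second_derivative_symmetric_real[OF assms(1) sm assms(3)])
qed

lemma smooth_on_has_vector_derivative_line:
  assumes "smooth_on S f" "x + t *\<^sub>R v \<in> S"
  shows "((\<lambda>t. f (x + t *\<^sub>R v)) has_vector_derivative frechet_derivative f (at (x + t *\<^sub>R v)) v) (at t)"
proof -
  let ?D = "frechet_derivative f (at (x + t *\<^sub>R v))"
  have D: "(f has_derivative ?D) (at (x + t *\<^sub>R v))" by (rule smooth_on_has_derivative[OF assms])
  have "((\<lambda>r. x + r *\<^sub>R v) has_derivative (\<lambda>h. h *\<^sub>R v)) (at t)"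
    by (auto intro!: derivative_eq_intros)
  from has_derivative_compose[OF this D] have "((\<lambda>r. f (x + r *\<^sub>R v)) has_derivative (\<lambda>h. ?D (h *\<^sub>R v))) (at t)" .
  moreover have "(\<lambda>h. ?D (h *\<^sub>R v)) = (\<lambda>h. h *\<^sub>R ?D v)"
    using linear_scale[OF has_derivative_linear[OF D]] by (simp add: fun_eq_iff)
  ultimately show ?thesis by (simp add: has_vector_derivative_def)
qed

lemma mixed_partials:
  fixes H :: "real \<times> real \<Rightarrow> 'b::euclidean_space"
  assumes "open S" "smooth_on S H" "(s0, t0) \<in> S"
  shows "vector_derivative (\<lambda>s. vector_derivative (\<lambda>t. H (s, t)) (at t0)) (at s0) =
    vector_derivative (\<lambda>t. vector_derivative (\<lambda>s. H (s, t)) (at s0)) (at t0)"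
proof -
  have t: "vector_derivative (\<lambda>t. K (s, t)) (at t1) = frechet_derivative K (at (s, t1)) (0, 1)"
    if "smooth_on S K" "(s, t1) \<in> S" for K :: "real \<times> real \<Rightarrow> 'b" and s t1
    using vector_derivative_at[OF smooth_on_has_vector_derivative_line[OF that(1), of "(s, 0)" t1 "(0, 1)"]] that(2) by simp
  have s: "vector_derivative (\<lambda>s. K (s, t)) (at s1) = frechet_derivative K (at (s1, t)) (1, 0)"
    if "smooth_on S K" "(s1, t) \<in> S" for K :: "real \<times> real \<Rightarrow> 'b" and s1 t
    using vector_derivative_at[OF smooth_on_has_vector_derivative_line[OF that(1), of "(0, t)" s1 "(1, 0)"]] that(2) by simp
  have "open {s. (s, t0) \<in> S}" "open {t. (s0, t) \<in> S}"
    using open_vimage[OF assms(1), of "\<lambda>s. (s, t0)"] open_vimage[OF assms(1), of "\<lambda>t. (s0, t)"]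
    by (simp_all add: vimage_def continuous_on_Pair)
  then have ev: "eventually (\<lambda>s. (s, t0) \<in> S) (nhds s0)" "eventually (\<lambda>t. (s0, t) \<in> S) (nhds t0)"
    using assms(3) by (auto simp: eventually_nhds)
  have "vector_derivative (\<lambda>s. vector_derivative (\<lambda>t. H (s, t)) (at t0)) (at s0) =
     vector_derivative (\<lambda>s. frechet_derivative H (at (s, t0)) (0, 1)) (at s0)"
    by (rule vector_derivative_cong_eq) (use ev(1) t[OF assms(2)] in \<open>auto elim!: eventually_mono\<close>)
  also have "\<dots> = frechet_derivative (\<lambda>z. frechet_derivative H (at z) (0, 1)) (at (s0, t0)) (1, 0)"
    by (rule s[OF smooth_on_frechet[OF assms(1,2)] assms(3)])
  also have "\<dots> = frechet_derivative (\<lambda>z. frechet_derivative H (at z) (1, 0)) (at (s0, t0)) (0, 1)"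
    by (rule second_derivative_symmetric[OF assms])
  also have "\<dots> = vector_derivative (\<lambda>t. frechet_derivative H (at (s0, t)) (1, 0)) (at t0)"
    by (rule t[OF smooth_on_frechet[OF assms(1,2)] assms(3), symmetric])
  also have "\<dots> = vector_derivative (\<lambda>t. vector_derivative (\<lambda>s. H (s, t)) (at s0)) (at t0)"
    by (rule vector_derivative_cong_eq) (use ev(2) s[OF assms(2)] in \<open>auto elim!: eventually_mono\<close>)
  finally show ?thesis .
qed

section \<open>Smooth maps on a Lie group\<close>

text \<open>The topological half of \<open>smooth_atlas\<close>, on which composition of smooth maps
  draws: \<open>smooth_map_on\<close> quantifies over all pairs of charts. In this form it passes
  directly to product atlases.\<close>

definition top_atlas :: "('p::topological_space, 'e::euclidean_space) chart set \<Rightarrow> bool" where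
  "top_atlas A \<longleftrightarrow> (\<Union>(U, c)\<in>A. U) = UNIV \<and>
    (\<forall>(U, c)\<in>A. open U \<and> open (c ` U) \<and> homeomorphism U (c ` U) c (inv_into U c))"

lemma top_atlas_chart:
  assumes "top_atlas A" "(U, c) \<in> A"
  shows "open U" "open (c ` U)" "continuous_on U c" "continuous_on (c ` U) (inv_into U c)" "inj_on c U"
    and "x \<in> U \<Longrightarrow> inv_into U c (c x) = x"
proof -
  have h: "homeomorphism U (c ` U) c (inv_into U c)" and o: "open U" "open (c ` U)"
    using assms by (auto simp: top_atlas_def)
  show "open U" "open (c ` U)" by (fact o)+
  show "continuous_on U c" "continuous_on (c ` U) (inv_into U c)"
    using h by (simp_all add: homeomorphism_def)
  show inv: "inv_into U c (c x) = x" if "x \<in> U" for x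
    using h that by (simp add: homeomorphism_def)
  show "inj_on c U" by (rule inj_on_inverseI[of U "inv_into U c"]) (rule inv)
qed

lemma top_atlas_cover:
  assumes "top_atlas A" obtains U c where "(U, c) \<in> A" "x \<in> U"
proof -
  have "x \<in> (\<Union>(U, c)\<in>A. U)" using assms by (simp add: top_atlas_def)
  then show thesis using that by auto
qed

lemma open_chart_image:
  assumes "top_atlas A" "(U, c) \<in> A" "open N"
  shows "open (c ` (U \<inter> N))"
proof -
  have "c ` (U \<inter> N) = c ` U \<inter> inv_into U c -` N"
    using top_atlas_chart(6)[OF assms(1,2)] by force
  then show ?thesis
    using continuous_open_preimage[OF top_atlas_chart(4,2)[OF assms(1,2)] assms(3)] by simp
qed

lemma smooth_map_onD:
  assumes "smooth_map_on A B W f"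
  shows "continuous_on W f"
    and "(U, c) \<in> A \<Longrightarrow> (V, d) \<in> B \<Longrightarrow> smooth_on (c ` (U \<inter> W \<inter> f -` V)) (\<lambda>y. d (f (inv_into U c y)))"
  using assms by (auto simp: smooth_map_on_def comp_def)

lemma smooth_map_onI:
  assumes "continuous_on W f"
    and "\<And>U c V d. (U, c) \<in> A \<Longrightarrow> (V, d) \<in> B \<Longrightarrow>
      smooth_on (c ` (U \<inter> W \<inter> f -` V)) (\<lambda>y. d (f (inv_into U c y)))"
  shows "smooth_map_on A B W f"
  using assms by (auto simp: smooth_map_on_def comp_def)

text \<open>A chart \<open>b\<close> around \<open>f x\<close> is inserted between the two given
  charts. It is available only near \<open>x\<close>, so the conclusion is assembled with
  \<open>smooth_on_local\<close>.\<close>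

lemma smooth_map_on_compose:
  assumes A: "top_atlas A" and B: "top_atlas B" and C: "top_atlas C"
    and f: "smooth_map_on A B W f" and h: "smooth_map_on B C W' h"
    and W: "open W" and im: "f ` W \<subseteq> W'"
  shows "smooth_map_on A C W (\<lambda>x. h (f x))"
proof (rule smooth_map_onI)
  show cont: "continuous_on W (\<lambda>x. h (f x))"
    by (rule continuous_on_compose2[OF smooth_map_onD(1)[OF h] smooth_map_onD(1)[OF f] im])
  fix U c V d assume c: "(U, c) \<in> A" and d: "(V, d) \<in> C"
  have oN: "open (W \<inter> (\<lambda>x. h (f x)) -` V)"
    by (rule continuous_open_preimage[OF cont W top_atlas_chart(1)[OF C d]])
  have eq: "U \<inter> W \<inter> (\<lambda>x. h (f x)) -` V = U \<inter> (W \<inter> (\<lambda>x. h (f x)) -` V)" by blast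
  show "smooth_on (c ` (U \<inter> W \<inter> (\<lambda>x. h (f x)) -` V)) (\<lambda>y. d (h (f (inv_into U c y))))"
    unfolding eq
  proof (rule smooth_on_local[OF open_chart_image[OF A c oN]])
    fix y assume "y \<in> c ` (U \<inter> (W \<inter> (\<lambda>x. h (f x)) -` V))"
    then obtain x where x: "y = c x" "x \<in> U" "x \<in> W" "h (f x) \<in> V" by auto
    obtain Y b where b: "(Y, b) \<in> B" "f x \<in> Y" using top_atlas_cover[OF B] .
    define N where "N = (W \<inter> (\<lambda>x. h (f x)) -` V) \<inter> (W \<inter> f -` Y)"
    have "open N" unfolding N_def
      by (intro open_Int oN continuous_open_preimage[OF smooth_map_onD(1)[OF f] W top_atlas_chart(1)[OF B b(1)]])
    then have o: "open (c ` (U \<inter> N))" by (rule open_chart_image[OF A c])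
    have sub: "c ` (U \<inter> N) \<subseteq> c ` (U \<inter> W \<inter> f -` Y)" by (auto simp: N_def)
    have s1: "smooth_on (c ` (U \<inter> N)) (\<lambda>y. b (f (inv_into U c y)))"
      by (rule smooth_on_subset[OF smooth_map_onD(2)[OF f c b(1)] sub])
    have s2: "smooth_on (c ` (U \<inter> N)) (\<lambda>y. d (h (inv_into Y b (b (f (inv_into U c y))))))"
    proof (rule smooth_on_compose[OF smooth_map_onD(2)[OF h b(1) d] s1])
      show "(\<lambda>y. b (f (inv_into U c y))) ` c ` (U \<inter> N) \<subseteq> b ` (Y \<inter> W' \<inter> h -` V)"
        using im top_atlas_chart(6)[OF A c] by (auto simp: N_def)
    qed
    have "smooth_on (c ` (U \<inter> N)) (\<lambda>y. d (h (f (inv_into U c y))))"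
      using s2 by (subst smooth_on_cong[OF o, of _ "\<lambda>y. d (h (inv_into Y b (b (f (inv_into U c y)))))"])
        (auto simp: N_def top_atlas_chart(6)[OF A c] top_atlas_chart(6)[OF B b(1)])
    moreover have "y \<in> c ` (U \<inter> N)" using x b by (auto simp: N_def)
    moreover have "c ` (U \<inter> N) \<subseteq> c ` (U \<inter> (W \<inter> (\<lambda>x. h (f x)) -` V))" by (auto simp: N_def)
    ultimately show "\<exists>Ua. open Ua \<and> y \<in> Ua \<and> Ua \<subseteq> c ` (U \<inter> (W \<inter> (\<lambda>x. h (f x)) -` V)) \<and>
        smooth_on Ua (\<lambda>y. d (h (f (inv_into U c y))))"
      using o by blast
  qed
qed

lemma top_atlas_euclid: "top_atlas euclid_atlas"
  by (auto simp: top_atlas_def euclid_atlas_def homeomorphism_def)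

lemma top_atlas_prod:
  assumes A: "top_atlas A" and B: "top_atlas B"
  shows "top_atlas (prod_atlas A B)"
  unfolding top_atlas_def
proof (intro conjI ballI)
  have "\<exists>p\<in>prod_atlas A B. (x, y) \<in> fst p" for x y
  proof -
    obtain U c where "(U, c) \<in> A" "x \<in> U" using top_atlas_cover[OF A] .
    moreover obtain V d where "(V, d) \<in> B" "y \<in> V" using top_atlas_cover[OF B] .
    ultimately show ?thesis
      by (intro bexI[of _ "(U \<times> V, map_prod c d)"]) (auto simp: prod_atlas_def)
  qed
  then show "(\<Union>(U, c)\<in>prod_atlas A B. U) = UNIV" by (force simp: case_prod_beta)
next
  fix p assume "p \<in> prod_atlas A B"
  then obtain U c V d where p: "p = (U \<times> V, map_prod c d)" "(U, c) \<in> A" "(V, d) \<in> B"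
    by (auto simp: prod_atlas_def)
  note c = top_atlas_chart[OF A p(2)] and d = top_atlas_chart[OF B p(3)]
  have im: "map_prod c d ` (U \<times> V) = c ` U \<times> d ` V" by (rule map_prod_surj_on) auto
  have inj: "inj_on (map_prod c d) (U \<times> V)" using c(5) d(5) by (rule map_prod_inj_on)
  have inv: "inv_into (U \<times> V) (map_prod c d) z = (inv_into U c (fst z), inv_into V d (snd z))"
    if "z \<in> c ` U \<times> d ` V" for z
  proof -
    obtain x y where "x \<in> U" "y \<in> V" "z = map_prod c d (x, y)" using \<open>z \<in> _\<close> by auto
    then show ?thesis using inv_into_f_f[OF inj, of "(x, y)"] c(6) d(6) by simp
  qed
  have "homeomorphism (U \<times> V) (c ` U \<times> d ` V) (map_prod c d) (inv_into (U \<times> V) (map_prod c d))"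
  proof (rule homeomorphismI)
    show "continuous_on (U \<times> V) (map_prod c d)"
      unfolding map_prod_def case_prod_beta
      by (intro continuous_on_Pair continuous_on_compose2[OF c(3) continuous_on_fst[OF continuous_on_id]]
          continuous_on_compose2[OF d(3) continuous_on_snd[OF continuous_on_id]]) auto
    have "continuous_on (c ` U \<times> d ` V) (\<lambda>z. (inv_into U c (fst z), inv_into V d (snd z)))"
      by (intro continuous_on_Pair continuous_on_compose2[OF c(4) continuous_on_fst[OF continuous_on_id]]
          continuous_on_compose2[OF d(4) continuous_on_snd[OF continuous_on_id]]) auto
    then show "continuous_on (c ` U \<times> d ` V) (inv_into (U \<times> V) (map_prod c d))"
      by (simp add: inv cong: continuous_on_cong)
    show "map_prod c d ` (U \<times> V) \<subseteq> c ` U \<times> d ` V" by (simp add: im)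
    show "inv_into (U \<times> V) (map_prod c d) ` (c ` U \<times> d ` V) \<subseteq> U \<times> V"
      using inv c(6) d(6) by auto
    show "inv_into (U \<times> V) (map_prod c d) (map_prod c d x) = x" if "x \<in> U \<times> V" for x
      by (rule inv_into_f_f[OF inj that])
    show "map_prod c d (inv_into (U \<times> V) (map_prod c d) y) = y" if "y \<in> c ` U \<times> d ` V" for y
      using f_inv_into_f[of y "map_prod c d" "U \<times> V"] that im by simp
  qed
  then show "case p of (U, c) \<Rightarrow> open U \<and> open (c ` U) \<and> homeomorphism U (c ` U) c (inv_into U c)"
    using c(1,2) d(1,2) by (auto simp: p(1) im open_Times)
qed

lemma smooth_map_on_euclid_euclid: "smooth_map_on euclid_atlas euclid_atlas W f \<longleftrightarrow> smooth_on W f"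
  by (auto simp: smooth_map_on_def euclid_atlas_def smooth_on_imp_continuous_on)

lemma smooth_map_on_const: "smooth_map_on A B W (\<lambda>x. q)"
  by (rule smooth_map_onI) auto

lemma smooth_map_on_Pair:
  assumes A: "top_atlas A" and f: "smooth_map_on A B W f" and g: "smooth_map_on A C W g"
  shows "smooth_map_on A (prod_atlas B C) W (\<lambda>x. (f x, g x))"
proof (rule smooth_map_onI)
  show "continuous_on W (\<lambda>x. (f x, g x))"
    by (rule continuous_on_Pair[OF smooth_map_onD(1)[OF f] smooth_map_onD(1)[OF g]])
  fix U c V d assume c: "(U, c) \<in> A" and d: "(V, d) \<in> prod_atlas B C"
  from d obtain V1 d1 V2 d2 where p: "V = V1 \<times> V2" "d = map_prod d1 d2" "(V1, d1) \<in> B" "(V2, d2) \<in> C"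
    by (auto simp: prod_atlas_def)
  have "smooth_on (c ` (U \<inter> W \<inter> (\<lambda>x. (f x, g x)) -` V)) (\<lambda>y. (d1 (f (inv_into U c y)), d2 (g (inv_into U c y))))"
    by (rule smooth_on_Pair[OF smooth_on_subset[OF smooth_map_onD(2)[OF f c p(3)]]
          smooth_on_subset[OF smooth_map_onD(2)[OF g c p(4)]]]) (auto simp: p(1))
  then show "smooth_on (c ` (U \<inter> W \<inter> (\<lambda>x. (f x, g x)) -` V)) (\<lambda>y. d (f (inv_into U c y), g (inv_into U c y)))"
    by (simp add: p(2))
qed

text \<open>The only chart of \<open>euclid_atlas\<close> is the whole space, so the domain of the
  coordinate expression does not depend on \<open>f\<close>, and smoothness in charts already
  contains the continuity demanded by \<open>smooth_map_on\<close>.\<close>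

lemma smooth_map_on_into_euclidI:
  fixes A :: "('p::t2_space, 'e::euclidean_space) chart set" and f :: "'p \<Rightarrow> 'f::euclidean_space"
  assumes A: "top_atlas A" and W: "open W"
    and sm: "\<And>U c. (U, c) \<in> A \<Longrightarrow> smooth_on (c ` (U \<inter> W)) (\<lambda>y. f (inv_into U c y))"
  shows "smooth_map_on A euclid_atlas W f"
proof (rule smooth_map_onI)
  show "continuous_on W f"
    unfolding continuous_on_eq_continuous_at[OF W]
  proof
    fix x assume "x \<in> W"
    obtain U c where c: "(U, c) \<in> A" "x \<in> U" using top_atlas_cover[OF A] .
    have "continuous_on (U \<inter> W) (\<lambda>x. f (inv_into U c (c x)))"
      by (rule continuous_on_compose2[OF smooth_on_imp_continuous_on[OF sm[OF c(1)]]
            continuous_on_subset[OF top_atlas_chart(3)[OF A c(1)]]]) auto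
    then have "continuous_on (U \<inter> W) f"
      by (rule continuous_on_eq) (simp add: top_atlas_chart(6)[OF A c(1)])
    then show "isCont f x"
      using continuous_on_eq_continuous_at[OF open_Int[OF top_atlas_chart(1)[OF A c(1)] W]] c(2) \<open>x \<in> W\<close> by blast
  qed
  fix U c V d assume "(U, c) \<in> A" "(V, d) \<in> (euclid_atlas :: ('f, 'f) chart set)"
  then show "smooth_on (c ` (U \<inter> W \<inter> f -` V)) (\<lambda>y. d (f (inv_into U c y)))"
    using sm by (auto simp: euclid_atlas_def)
qed


section \<open>Plots: calculus on the group pulled back to open sets of Euclidean spaces\<close>

context lie_group
begin

lemma top_atlas_G: "top_atlas (atlas G)"
  using atlas by (auto simp: smooth_atlas_def top_atlas_def)

lemma in_carrier [simp, intro]: "x \<in> carrier G"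
  by (simp add: carrier_UNIV)

text \<open>A plot in the sense of diffeology. Group operations preserve plots and smooth functions
  are tested on them, so that group-valued expressions can be treated without reference to charts of
  the target.\<close>

definition plot :: "'z::euclidean_space set \<Rightarrow> ('z \<Rightarrow> 'g) \<Rightarrow> bool" where
  "plot S p \<longleftrightarrow> open S \<and> smooth_map_on euclid_atlas (atlas G) S p"

lemma plot_const: "open S \<Longrightarrow> plot S (\<lambda>x. q)"
  by (simp add: plot_def smooth_map_on_const)

lemma plot_map:
  assumes "smooth_map_on (atlas G) (atlas G) UNIV h" "plot S p"
  shows "plot S (\<lambda>x. h (p x))"
  using smooth_map_on_compose[OF top_atlas_euclid top_atlas_G top_atlas_G _ assms(1), of S p] assms(2)
  by (simp add: plot_def)

lemma plot_mult:
  assumes "plot S p" "plot S q"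
  shows "plot S (\<lambda>x. p x \<otimes> q x)"
  using smooth_map_on_compose[OF top_atlas_euclid top_atlas_prod[OF top_atlas_G top_atlas_G] top_atlas_G
    smooth_map_on_Pair[OF top_atlas_euclid] mult_smooth, of S p q] assms
  by (simp add: plot_def)

lemma plot_inv: "plot S p \<Longrightarrow> plot S (\<lambda>x. inv (p x))"
  by (rule plot_map[OF inv_smooth])

lemma plot_compose:
  assumes "plot T p" "smooth_on S f" "open S" "f ` S \<subseteq> T"
  shows "plot S (\<lambda>x. p (f x))"
  using smooth_map_on_compose[OF top_atlas_euclid top_atlas_euclid top_atlas_G _ _ assms(3,4), of p] assms
  by (simp add: plot_def smooth_map_on_euclid_euclid)

lemma plot_exp: "smooth_on S f \<Longrightarrow> open S \<Longrightarrow> plot S (\<lambda>x. lie_exp G (f x))"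
  by (rule plot_compose[of UNIV]) (auto simp: plot_def exp_smooth)

text \<open>This is where the compatibility of charts in \<open>smooth_atlas\<close> enters: read in
  another chart, the inverse chart is a transition map.\<close>

lemma plot_chart:
  assumes "(U, c) \<in> atlas G"
  shows "plot (c ` U) (inv_into U c)"
  unfolding plot_def
proof (intro conjI smooth_map_onI)
  note c = top_atlas_chart[OF top_atlas_G assms]
  show "open (c ` U)" "continuous_on (c ` U) (inv_into U c)" by (fact c)+
  fix V d W k assume "(V, d) \<in> (euclid_atlas :: (real^'m, real^'m) chart set)" and k: "(W, k) \<in> atlas G"
  then have V: "V = UNIV" "d = id" by (auto simp: euclid_atlas_def)
  have "d ` (V \<inter> c ` U \<inter> inv_into U c -` W) = c ` (U \<inter> W)" using c(6) by (force simp: V)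
  moreover have "smooth_on (c ` (U \<inter> W)) (\<lambda>y. k (inv_into U c y))"
    using atlas assms k by (force simp: smooth_atlas_def comp_def)
  ultimately show "smooth_on (d ` (V \<inter> c ` U \<inter> inv_into U c -` W)) (\<lambda>y. k (inv_into U c (inv_into V d y)))"
    by (simp add: V)
qed

lemma plot_chart_compose:
  assumes "(U, c) \<in> atlas G" "plot S p" "p ` S \<subseteq> U"
  shows "smooth_on S (\<lambda>x. c (p x))"
proof -
  have "smooth_map_on euclid_atlas (atlas G) S p" using assms(2) by (simp add: plot_def)
  from smooth_map_onD(2)[OF this _ assms(1), of UNIV id]
  have "smooth_on (S \<inter> p -` U) (\<lambda>x. c (p x))" by (simp add: euclid_atlas_def)
  moreover have "S \<inter> p -` U = S" using assms(3) by blast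
  ultimately show ?thesis by simp
qed

lemma plot_continuous_on: "plot S p \<Longrightarrow> continuous_on S p"
  by (simp add: plot_def smooth_map_on_def)

lemma plot_subset:
  assumes "plot T p" "open S" "S \<subseteq> T" shows "plot S p"
  using plot_compose[OF assms(1) smooth_on_id assms(2)] assms(3) by simp

section \<open>Functions on the group that depend smoothly on a parameter\<close>

definition smooth_par :: "'z::euclidean_space set \<Rightarrow> ('z \<Rightarrow> 'g \<Rightarrow> 'v::euclidean_space) \<Rightarrow> bool" where
  "smooth_par W F \<longleftrightarrow> open W \<and>
     smooth_map_on (prod_atlas euclid_atlas (atlas G)) euclid_atlas (W \<times> UNIV) (\<lambda>(z, g). F z g)"

lemma smooth_par_plot:
  assumes "smooth_par W F" "smooth_on S z" "z ` S \<subseteq> W" "plot S p"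
  shows "smooth_on S (\<lambda>y. F (z y) (p y))"
proof -
  have "smooth_map_on euclid_atlas euclid_atlas S (\<lambda>x. case (z x, p x) of (z, g) \<Rightarrow> F z g)"
  proof (rule smooth_map_on_compose[OF top_atlas_euclid top_atlas_prod[OF top_atlas_euclid top_atlas_G] top_atlas_euclid])
    show "smooth_map_on euclid_atlas (prod_atlas euclid_atlas (atlas G)) S (\<lambda>x. (z x, p x))"
      using assms(2,4) by (intro smooth_map_on_Pair[OF top_atlas_euclid]) (auto simp: smooth_map_on_euclid_euclid plot_def)
    show "smooth_map_on (prod_atlas euclid_atlas (atlas G)) euclid_atlas (W \<times> UNIV) (\<lambda>(z, g). F z g)"
      using assms(1) by (simp add: smooth_par_def)
    show "open S" using assms(4) by (simp add: plot_def)
    show "(\<lambda>x. (z x, p x)) ` S \<subseteq> W \<times> UNIV" using assms(3) by auto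
  qed
  then show ?thesis by (simp add: smooth_map_on_euclid_euclid)
qed

lemma smooth_parI:
  fixes W :: "'z::euclidean_space set" and F :: "'z \<Rightarrow> 'g \<Rightarrow> 'v::euclidean_space"
  assumes W: "open W"
    and sm: "\<And>U c. (U, c) \<in> atlas G \<Longrightarrow> smooth_on (W \<times> c ` U) (\<lambda>y. F (fst y) (inv_into U c (snd y)))"
  shows "smooth_par W F"
  unfolding smooth_par_def
proof (intro conjI W smooth_map_on_into_euclidI[OF top_atlas_prod[OF top_atlas_euclid top_atlas_G]])
  show "open (W \<times> (UNIV :: 'g set))" using W by (simp add: open_Times)
  fix U' :: "('z \<times> 'g) set" and c' assume "(U', c') \<in> prod_atlas euclid_atlas (atlas G)"
  then obtain U c where p: "U' = UNIV \<times> U" "c' = map_prod id c" "(U, c) \<in> atlas G"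
    by (auto simp: prod_atlas_def euclid_atlas_def)
  note c = top_atlas_chart[OF top_atlas_G p(3)]
  have inj: "inj_on (map_prod id c) (UNIV \<times> U)" by (rule map_prod_inj_on[OF _ c(5)]) simp
  have inv: "inv_into (UNIV \<times> U) (map_prod id c) (z, y) = (z, inv_into U c y)" if "y \<in> c ` U" for z y
    using inv_into_f_f[OF inj, of "(z, inv_into U c y)"] that c(6) by auto
  have im: "c' ` (U' \<inter> W \<times> UNIV) = W \<times> c ` U" by (force simp: p)
  have "smooth_on (W \<times> c ` U) (\<lambda>y. case inv_into U' c' y of (z, g) \<Rightarrow> F z g)"
    using sm[OF p(3)]
    by (subst smooth_on_cong[OF open_Times[OF W c(2)], of _ "\<lambda>y. F (fst y) (inv_into U c (snd y))"])
      (auto simp: p(1,2) inv)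
  then show "smooth_on (c' ` (U' \<inter> W \<times> UNIV)) (\<lambda>y. case inv_into U' c' y of (z, g) \<Rightarrow> F z g)"
    by (simp add: im)
qed

lemma smooth_funI:
  assumes "\<And>U c. (U, c) \<in> atlas G \<Longrightarrow> smooth_on (c ` U) (\<lambda>y. f (inv_into U c y))"
  shows "smooth_fun G f"
  unfolding smooth_fun_def
  by (rule smooth_map_on_into_euclidI[OF top_atlas_G]) (simp_all add: assms)

lemma smooth_fun_plot:
  assumes "smooth_fun G f" "plot S p"
  shows "smooth_on S (\<lambda>y. f (p y))"
  using smooth_map_on_compose[OF top_atlas_euclid top_atlas_G top_atlas_euclid, of S p UNIV f] assms
  by (simp add: plot_def smooth_fun_def smooth_map_on_euclid_euclid)

lemma smooth_par_const: "smooth_fun G f \<Longrightarrow> open W \<Longrightarrow> smooth_par W (\<lambda>z. f)"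
proof (rule smooth_parI)
  fix U c assume "smooth_fun G f" "open W" and c: "(U, c) \<in> atlas G"
  note ch = top_atlas_chart[OF top_atlas_G c]
  show "smooth_on (W \<times> c ` U) (\<lambda>y. f (inv_into U c (snd y)))"
    by (rule smooth_fun_plot[OF \<open>smooth_fun G f\<close>], rule plot_compose[OF plot_chart[OF c] smooth_on_snd[OF smooth_on_id]])
      (use \<open>open W\<close> ch(2) in \<open>auto intro: open_Times\<close>)
qed

lemma smooth_par_fun:
  assumes "smooth_par W F" "z \<in> W" shows "smooth_fun G (F z)"
proof (rule smooth_funI)
  fix U c assume c: "(U, c) \<in> atlas G"
  show "smooth_on (c ` U) (\<lambda>y. F z (inv_into U c y))"
    by (rule smooth_par_plot[OF assms(1) smooth_on_const _ plot_chart[OF c]]) (use assms(2) in auto)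
qed


lemma smooth_par_open: "smooth_par W F \<Longrightarrow> open W"
  by (simp add: smooth_par_def)

lemma smooth_par_chart:
  assumes "smooth_par W F" "(U, c) \<in> atlas G"
  shows "smooth_on (W \<times> c ` U) (\<lambda>y. F (fst y) (inv_into U c (snd y)))"
proof (rule smooth_par_plot[OF assms(1) smooth_on_fst[OF smooth_on_id]])
  show "plot (W \<times> c ` U) (\<lambda>x. inv_into U c (snd x))"
    by (rule plot_compose[OF plot_chart[OF assms(2)] smooth_on_snd[OF smooth_on_id]])
      (use smooth_par_open[OF assms(1)] top_atlas_chart(2)[OF top_atlas_G assms(2)] in \<open>auto intro: open_Times\<close>)
qed auto

lemma smooth_par_subset:
  assumes "smooth_par W F" "open W'" "W' \<subseteq> W" shows "smooth_par W' F"
  by (rule smooth_parI[OF assms(2)], rule smooth_on_subset, rule smooth_par_chart[OF assms(1)])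
     (use assms(3) in auto)

lemma smooth_par_linear:
  assumes "bounded_linear L" "smooth_par W F" shows "smooth_par W (\<lambda>z g. L (F z g))"
  by (rule smooth_parI[OF smooth_par_open[OF assms(2)]], rule smooth_on_linear_compose[OF assms(1)],
      rule smooth_par_chart[OF assms(2)])

lemma smooth_par_bilinear:
  assumes "bounded_bilinear B" "smooth_par W F" "smooth_par W H" shows "smooth_par W (\<lambda>z g. B (F z g) (H z g))"
  by (rule smooth_parI[OF smooth_par_open[OF assms(2)]], rule smooth_on_bilinear[OF assms(1)],
      rule smooth_par_chart[OF assms(2)], assumption, rule smooth_par_chart[OF assms(3)])

lemma smooth_par_add:
  assumes "smooth_par W F" "smooth_par W H" shows "smooth_par W (\<lambda>z g. F z g + H z g)"
  by (rule smooth_parI[OF smooth_par_open[OF assms(1)]], rule smooth_on_add,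
      rule smooth_par_chart[OF assms(1)], assumption, rule smooth_par_chart[OF assms(2)])

lemma smooth_par_diff:
  assumes "smooth_par W F" "smooth_par W H" shows "smooth_par W (\<lambda>z g. F z g - H z g)"
  by (rule smooth_parI[OF smooth_par_open[OF assms(1)]], rule smooth_on_diff,
      rule smooth_par_chart[OF assms(1)], assumption, rule smooth_par_chart[OF assms(2)])

lemma smooth_par_sum:
  assumes "open W" "\<And>i. i \<in> I \<Longrightarrow> smooth_par W (F i)" shows "smooth_par W (\<lambda>z g. \<Sum>i\<in>I. F i z g)"
  by (rule smooth_parI[OF assms(1)], rule smooth_on_sum, rule smooth_par_chart[OF assms(2)])

lemma smooth_par_componentwise:
  assumes "open W" "\<And>b. b \<in> Basis \<Longrightarrow> smooth_par W (\<lambda>z g. F z g \<bullet> b)" shows "smooth_par W F"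
  by (rule smooth_parI[OF assms(1)], rule smooth_on_componentwise, rule smooth_par_chart[OF assms(2)])

lemma smooth_par_inner:
  "smooth_par W F \<Longrightarrow> smooth_par W H \<Longrightarrow> smooth_par W (\<lambda>z g. F z g \<bullet> H z g)"
  by (rule smooth_par_bilinear[OF bounded_bilinear_inner])

lemma smooth_par_mult:
  "smooth_par W F \<Longrightarrow> smooth_par W H \<Longrightarrow> smooth_par W (\<lambda>z g. F z g * H z g :: real)"
  by (rule smooth_par_bilinear[OF bounded_bilinear_mult])

lemma smooth_par_constant: "open W \<Longrightarrow> smooth_par W (\<lambda>z g. c)"
  by (rule smooth_parI) auto

text \<open>A function is read as a family over the real line that ignores its parameter. The
  closure properties of \<open>smooth_fun\<close> below are then inherited from those of
  \<open>smooth_par\<close>.\<close>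

lemma smooth_fun_iff: "smooth_fun G f \<longleftrightarrow> smooth_par (UNIV :: real set) (\<lambda>z. f)"
  using smooth_par_const[of f UNIV] smooth_par_fun[of UNIV "\<lambda>z. f" 0] by auto

lemma smooth_fun_linear: "bounded_linear L \<Longrightarrow> smooth_fun G f \<Longrightarrow> smooth_fun G (\<lambda>g. L (f g))"
  unfolding smooth_fun_iff by (rule smooth_par_linear)

lemma smooth_fun_bilinear:
  "bounded_bilinear B \<Longrightarrow> smooth_fun G f \<Longrightarrow> smooth_fun G h \<Longrightarrow> smooth_fun G (\<lambda>g. B (f g) (h g))"
  unfolding smooth_fun_iff by (rule smooth_par_bilinear)

lemma smooth_fun_add: "smooth_fun G f \<Longrightarrow> smooth_fun G h \<Longrightarrow> smooth_fun G (\<lambda>g. f g + h g)"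
  unfolding smooth_fun_iff by (rule smooth_par_add)

lemma smooth_fun_diff: "smooth_fun G f \<Longrightarrow> smooth_fun G h \<Longrightarrow> smooth_fun G (\<lambda>g. f g - h g)"
  unfolding smooth_fun_iff by (rule smooth_par_diff)

lemma smooth_fun_const: "smooth_fun G (\<lambda>g. c)"
  unfolding smooth_fun_iff by (rule smooth_par_constant) simp

lemma smooth_fun_sum: "(\<And>i. i \<in> I \<Longrightarrow> smooth_fun G (f i)) \<Longrightarrow> smooth_fun G (\<lambda>g. \<Sum>i\<in>I. f i g)"
  unfolding smooth_fun_iff by (rule smooth_par_sum) auto

lemma smooth_fun_componentwise: "(\<And>b. b \<in> Basis \<Longrightarrow> smooth_fun G (\<lambda>g. f g \<bullet> b)) \<Longrightarrow> smooth_fun G f"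
  unfolding smooth_fun_iff by (rule smooth_par_componentwise) auto

lemma smooth_fun_compose:
  assumes "smooth_fun G f" "smooth_map_on (atlas G) (atlas G) UNIV h"
  shows "smooth_fun G (\<lambda>x. f (h x))"
  by (rule smooth_funI, rule smooth_fun_plot[OF assms(1)], rule plot_map[OF assms(2)], rule plot_chart)

lemma smooth_fun_translate:
  assumes "smooth_fun G f" shows "smooth_fun G (\<lambda>x. f (a \<otimes> x \<otimes> b))"
proof (rule smooth_funI)
  fix U c assume c: "(U, c) \<in> atlas G"
  show "smooth_on (c ` U) (\<lambda>y. f (a \<otimes> inv_into U c y \<otimes> b))"
    using top_atlas_chart(2)[OF top_atlas_G c]
    by (intro smooth_fun_plot[OF assms] plot_mult plot_const plot_chart[OF c])
qed

lemma smooth_fun_imp_continuous: "smooth_fun G f \<Longrightarrow> continuous_on UNIV f"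
  by (simp add: smooth_fun_def smooth_map_on_def)

lemma smooth_par_continuous:
  "smooth_par W F \<Longrightarrow> continuous_on (W \<times> UNIV) (\<lambda>(z, g). F z g)"
  by (simp add: smooth_par_def smooth_map_on_def)

section \<open>The exponential map, derivatives along left-invariant fields and in
  parameters\<close>

lemma exp_zero [simp]: "lie_exp G 0 = \<one>"
proof -
  have "lie_exp G 0 \<otimes> lie_exp G 0 = lie_exp G 0" using exp_add[of 0 0 0] by simp
  then show ?thesis using r_cancel_one[OF in_carrier in_carrier, of "lie_exp G 0" "lie_exp G 0"] by simp
qed

lemma exp_minus: "lie_exp G (- X) = inv (lie_exp G X)"
proof -
  have "lie_exp G (- X) \<otimes> lie_exp G X = \<one>" using exp_add[of "- 1" 1 X] by simp
  then show ?thesis using inv_equality[of "lie_exp G (- X)" "lie_exp G X"] by simp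
qed

lemma plot_exp_line: "plot UNIV (\<lambda>t. g \<otimes> lie_exp G (t *\<^sub>R X))" for t :: real
  by (intro plot_mult plot_const plot_exp smooth_on_linear bounded_linear_scaleR_left) auto

lemma smooth_par_lder:
  assumes F: "smooth_par W F" shows "smooth_par W (\<lambda>z. lder G X (F z))"
proof (rule smooth_parI[OF smooth_par_open[OF F]])
  fix U c assume c: "(U, c) \<in> atlas G"
  have o: "open (W \<times> c ` U)" using smooth_par_open[OF F] top_atlas_chart(2)[OF top_atlas_G c] by (rule open_Times)
  let ?H = "\<lambda>y. F (fst (fst y)) (inv_into U c (snd (fst y)) \<otimes> lie_exp G (snd y *\<^sub>R X))"
  have oo: "open ((W \<times> c ` U) \<times> (UNIV :: real set))" by (rule open_Times[OF o open_UNIV])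
  have "smooth_on ((W \<times> c ` U) \<times> UNIV) ?H"
    by (rule smooth_par_plot[OF F], intro smooth_on_fst smooth_on_id, force,
        intro plot_mult plot_exp plot_compose[OF plot_chart[OF c]] smooth_on_snd smooth_on_fst smooth_on_id
          smooth_on_linear_compose[OF bounded_linear_scaleR_left] oo) auto
  from smooth_on_partial_snd(1)[OF oo this o, of 0]
  show "smooth_on (W \<times> c ` U) (\<lambda>y. lder G X (F (fst y)) (inv_into U c (snd y)))"
    by (simp add: lder_def)
qed

lemma smooth_fun_lder: "smooth_fun G f \<Longrightarrow> smooth_fun G (lder G X f)"
  unfolding smooth_fun_iff by (rule smooth_par_lder)

lemma lder_has_vector_derivative:
  assumes "smooth_fun G f"
  shows "((\<lambda>t. f (g \<otimes> lie_exp G (t *\<^sub>R X))) has_vector_derivative lder G X f g) (at 0)"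
proof -
  have "smooth_on UNIV (\<lambda>t. f (g \<otimes> lie_exp G (t *\<^sub>R X)))"
    by (rule smooth_fun_plot[OF assms plot_exp_line])
  from smooth_on_imp_differentiable[OF this, of 0] show ?thesis
    unfolding lder_def vector_derivative_works by simp
qed

definition pder :: "'z::euclidean_space \<Rightarrow> ('z \<Rightarrow> 'g \<Rightarrow> 'v::euclidean_space) \<Rightarrow> 'z \<Rightarrow> 'g \<Rightarrow> 'v" where
  "pder v F z g = vector_derivative (\<lambda>t. F (z + t *\<^sub>R v) g) (at 0)"

lemma open_shift:
  fixes W :: "'z::euclidean_space set"
  assumes "open W" shows "open {y :: ('z \<times> 'b::topological_space) \<times> real. fst (fst y) + snd y *\<^sub>R v \<in> W}"
proof -
  have "continuous_on UNIV (\<lambda>y :: ('z \<times> 'b) \<times> real. fst (fst y) + snd y *\<^sub>R v)"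
    by (intro continuous_intros)
  from open_vimage[OF assms this] show ?thesis by (simp add: vimage_def)
qed

lemma smooth_par_pder:
  assumes F: "smooth_par W F" shows "smooth_par W (pder v F)"
proof (rule smooth_parI[OF smooth_par_open[OF F]])
  fix U c assume c: "(U, c) \<in> atlas G"
  have o: "open (W \<times> c ` U)" using smooth_par_open[OF F] top_atlas_chart(2)[OF top_atlas_G c] by (rule open_Times)
  let ?S = "{y. fst (fst y) + snd y *\<^sub>R v \<in> W} \<inter> (UNIV \<times> c ` U) \<times> (UNIV :: real set)"
  let ?H = "\<lambda>y. F (fst (fst y) + snd y *\<^sub>R v) (inv_into U c (snd (fst y)))"
  have oo: "open ?S" using top_atlas_chart(2)[OF top_atlas_G c] smooth_par_open[OF F]
    by (intro open_Int open_shift open_Times) auto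
  have "smooth_on ?S ?H"
    by (rule smooth_par_plot[OF F], intro smooth_on_add smooth_on_fst smooth_on_id
         smooth_on_linear_compose[OF bounded_linear_scaleR_left] smooth_on_snd, force,
        intro plot_compose[OF plot_chart[OF c]] smooth_on_snd smooth_on_fst smooth_on_id oo) auto
  from smooth_on_partial_snd(1)[OF oo this o, of 0]
  have "smooth_on (W \<times> c ` U) (\<lambda>z. vector_derivative (\<lambda>t. F (fst z + t *\<^sub>R v) (inv_into U c (snd z))) (at 0))"
    by fastforce
  then show "smooth_on (W \<times> c ` U) (\<lambda>y. pder v F (fst y) (inv_into U c (snd y)))"
    by (simp add: pder_def)
qed

lemma pder_has_vector_derivative_at:
  assumes F: "smooth_par W F" and "z + t0 *\<^sub>R v \<in> W"
  shows "((\<lambda>t. F (z + t *\<^sub>R v) g) has_vector_derivative pder v F (z + t0 *\<^sub>R v) g) (at t0)"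
proof -
  have sm: "smooth_on W (\<lambda>z. F z g)"
    by (rule smooth_par_plot[OF F smooth_on_id _ plot_const]) (use smooth_par_open[OF F] in auto)
  have "pder v F w g = frechet_derivative (\<lambda>z. F z g) (at w) v" if "w \<in> W" for w
    using vector_derivative_at[OF smooth_on_has_vector_derivative_line[OF sm, of w 0 v]] that by (simp add: pder_def)
  then show ?thesis
    using smooth_on_has_vector_derivative_line[OF sm assms(2)] assms(2) by simp
qed

lemma pder_has_vector_derivative:
  assumes "smooth_par W F" "z \<in> W"
  shows "((\<lambda>t. F (z + t *\<^sub>R v) g) has_vector_derivative pder v F z g) (at 0)"
  using pder_has_vector_derivative_at[OF assms(1), of z 0 v g] assms(2) by simp

lemma pder_cong:
  assumes "open W" "z \<in> W" "\<And>z. z \<in> W \<Longrightarrow> F z g = H z g"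
  shows "pder v F z g = pder v H z g"
  unfolding pder_def
proof (rule vector_derivative_cong_eq)
  have "open ((\<lambda>t::real. z + t *\<^sub>R v) -` W)"
    by (rule open_vimage[OF assms(1)]) (intro continuous_intros)
  moreover have "0 \<in> (\<lambda>t::real. z + t *\<^sub>R v) -` W" using assms(2) by simp
  ultimately have "eventually (\<lambda>t. t \<in> (\<lambda>t::real. z + t *\<^sub>R v) -` W) (nhds 0)"
    by (rule eventually_nhds_in_open)
  then show "\<forall>\<^sub>F t in nhds 0. t \<in> UNIV \<longrightarrow> F (z + t *\<^sub>R v) g = H (z + t *\<^sub>R v) g"
    by eventually_elim (use assms(3) in auto)
qed auto

text \<open>Both sides are mixed partial derivatives at the origin of the function F (z + s v) (g
  exp(tX)) of the two real variables s and t.\<close>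

lemma pder_lder:
  assumes F: "smooth_par W F" and "z \<in> W"
  shows "pder v (\<lambda>z. lder G X (F z)) z g = lder G X (pder v F z) g"
proof -
  let ?S = "{s. z + s *\<^sub>R v \<in> W} \<times> (UNIV :: real set)"
  have o: "open ?S"
  proof (rule open_Times[OF _ open_UNIV])
    have "continuous_on UNIV (\<lambda>s :: real. z + s *\<^sub>R v)" by (intro continuous_intros)
    from open_vimage[OF smooth_par_open[OF F] this] show "open {s. z + s *\<^sub>R v \<in> W}" by (simp add: vimage_def)
  qed
  have "smooth_on ?S (\<lambda>y. F (z + fst y *\<^sub>R v) (g \<otimes> lie_exp G (snd y *\<^sub>R X)))"
    by (rule smooth_par_plot[OF F], intro smooth_on_add smooth_on_const
         smooth_on_linear_compose[OF bounded_linear_scaleR_left] smooth_on_fst smooth_on_id, force,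
        intro plot_mult plot_const plot_exp smooth_on_linear_compose[OF bounded_linear_scaleR_left] smooth_on_snd smooth_on_id o)
  from mixed_partials[OF o this, of 0 0] show ?thesis
    using assms(2) by (simp add: pder_def lder_def)
qed

lemma lder_bilinear:
  assumes "bounded_bilinear B" "smooth_fun G f" "smooth_fun G h"
  shows "lder G X (\<lambda>g. B (f g) (h g)) g = B (f g) (lder G X h g) + B (lder G X f g) (h g)"
  unfolding lder_def[of G X "\<lambda>g. B (f g) (h g)"]
  using bounded_bilinear.has_vector_derivative[OF assms(1) lder_has_vector_derivative[OF assms(2), of g X]
      lder_has_vector_derivative[OF assms(3), of g X]] by (intro vector_derivative_at) simp

lemma lder_linear:
  assumes "bounded_linear L" "smooth_fun G f"
  shows "lder G X (\<lambda>g. L (f g)) g = L (lder G X f g)"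
  unfolding lder_def[of G X "\<lambda>g. L (f g)"]
  by (intro vector_derivative_at bounded_linear.has_vector_derivative[OF assms(1)] lder_has_vector_derivative assms)

lemma lder_add:
  assumes "smooth_fun G f" "smooth_fun G h"
  shows "lder G X (\<lambda>g. f g + h g) g = lder G X f g + lder G X h g"
  unfolding lder_def[of G X "\<lambda>g. f g + h g"]
  by (intro vector_derivative_at has_vector_derivative_add lder_has_vector_derivative assms)

lemma lder_diff:
  assumes "smooth_fun G f" "smooth_fun G h"
  shows "lder G X (\<lambda>g. f g - h g) g = lder G X f g - lder G X h g"
  unfolding lder_def[of G X "\<lambda>g. f g - h g"]
  by (intro vector_derivative_at has_vector_derivative_diff lder_has_vector_derivative assms)

lemma lder_const: "lder G X (\<lambda>g. c) g = 0"
  by (simp add: lder_def)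

lemma lder_sum:
  assumes "\<And>i. i \<in> I \<Longrightarrow> smooth_fun G (f i)"
  shows "lder G X (\<lambda>g. \<Sum>i\<in>I. f i g) g = (\<Sum>i\<in>I. lder G X (f i) g)"
  unfolding lder_def[of G X "\<lambda>g. \<Sum>i\<in>I. f i g"]
  by (intro vector_derivative_at has_vector_derivative_sum lder_has_vector_derivative assms)

lemma pder_bilinear:
  assumes "bounded_bilinear B" "smooth_par W F" "smooth_par W H" "z \<in> W"
  shows "pder v (\<lambda>z g. B (F z g) (H z g)) z g = B (F z g) (pder v H z g) + B (pder v F z g) (H z g)"
  unfolding pder_def[of v "\<lambda>z g. B (F z g) (H z g)"]
  using bounded_bilinear.has_vector_derivative[OF assms(1) pder_has_vector_derivative[OF assms(2,4), of v g]
      pder_has_vector_derivative[OF assms(3,4), of v g]] by (intro vector_derivative_at) simp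

lemma pder_linear:
  assumes "bounded_linear L" "smooth_par W F" "z \<in> W"
  shows "pder v (\<lambda>z g. L (F z g)) z g = L (pder v F z g)"
  unfolding pder_def[of v "\<lambda>z g. L (F z g)"]
  by (intro vector_derivative_at bounded_linear.has_vector_derivative[OF assms(1)] pder_has_vector_derivative[OF assms(2,3)])

lemma pder_diff:
  assumes "smooth_par W F" "smooth_par W H" "z \<in> W"
  shows "pder v (\<lambda>z g. F z g - H z g) z g = pder v F z g - pder v H z g"
  unfolding pder_def[of v "\<lambda>z g. F z g - H z g"]
  by (intro vector_derivative_at has_vector_derivative_diff pder_has_vector_derivative[OF assms(1,3)]
     pder_has_vector_derivative[OF assms(2,3)])

lemma pder_sum:
  assumes "\<And>i. i \<in> I \<Longrightarrow> smooth_par W (F i)" "z \<in> W"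
  shows "pder v (\<lambda>z g. \<Sum>i\<in>I. F i z g) z g = (\<Sum>i\<in>I. pder v (F i) z g)"
  unfolding pder_def[of v "\<lambda>z g. \<Sum>i\<in>I. F i z g"]
  by (intro vector_derivative_at has_vector_derivative_sum pder_has_vector_derivative[OF assms(1,2)])

text \<open>The derivation along \<open>X\<close> is the directional derivative at 0, in direction
  \<open>X\<close>, of the single map v -> f (g exp(v)); its total differentiability gives
  additivity.\<close>

lemma lder_linear_in:
  assumes f: "smooth_fun G f" shows "linear (\<lambda>X. lder G X f g)"
proof -
  have sm: "smooth_on UNIV (\<lambda>v. f (g \<otimes> lie_exp G v))"
    by (intro smooth_fun_plot[OF f] plot_mult plot_const plot_exp) auto
  have "lder G X f g = frechet_derivative (\<lambda>v. f (g \<otimes> lie_exp G v)) (at 0) X" for X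
    using vector_derivative_at[OF smooth_on_has_vector_derivative_line[OF sm, of 0 0 X]] by (simp add: lder_def)
  then have "(\<lambda>X. lder G X f g) = frechet_derivative (\<lambda>v. f (g \<otimes> lie_exp G v)) (at 0)" by (rule ext)
  then show ?thesis using has_derivative_linear[OF smooth_on_has_derivative[OF sm, of 0]] by simp
qed

end

section \<open>The adjoint representation\<close>

text \<open>The derivative along (1, 1) is the sum of those along (1, 0) and (0, 1). It serves as
  the Leibniz rule for products of group-valued curves: each factor gets its own time, and the two
  times are then set equal.\<close>

lemma has_vector_derivative_diagonal:
  fixes H :: "real \<times> real \<Rightarrow> 'b::euclidean_space"
  assumes "smooth_on S H" "(0, 0) \<in> S"
    and a: "((\<lambda>h. H (h, 0)) has_vector_derivative A) (at 0)"
    and b: "((\<lambda>h. H (0, h)) has_vector_derivative B) (at 0)"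
  shows "((\<lambda>h. H (h, h)) has_vector_derivative A + B) (at 0)"
proof -
  let ?D = "frechet_derivative H (at (0, 0))"
  have z: "(0::real, 0::real) = 0" by (simp add: zero_prod_def)
  have l: "((\<lambda>t. H (0 + t *\<^sub>R v)) has_vector_derivative ?D v) (at 0)" for v
    using smooth_on_has_vector_derivative_line[OF assms(1), of 0 0 v] assms(2) by (simp add: z)
  have "A = ?D (1, 0)" "B = ?D (0, 1)"
    using vector_derivative_unique_at[OF a] l[of "(1, 0)"] vector_derivative_unique_at[OF b] l[of "(0, 1)"] by simp_all
  moreover have "?D (1, 1) = ?D (1, 0) + ?D (0, 1)"
    using linear_add[OF has_derivative_linear[OF smooth_on_has_derivative[OF assms(1,2)]], of "(1, 0)" "(0, 1)"] by simp
  ultimately show ?thesis using l[of "(1, 1)"] by simp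
qed

section \<open>Cutoff functions, a first-order logarithm, velocities of curves\<close>

context lie_group
begin

text \<open>The preimage \<open>L\<close> of the support under the chart is compact, hence closed
  because the group is Hausdorff. Every point outside \<open>U\<close> thus has the complement of
  \<open>L\<close> as a neighbourhood, and the extended function vanishes on it.\<close>

lemma smooth_fun_extend_zero:
  fixes h :: "real^'m \<Rightarrow> 'v::euclidean_space"
  assumes c: "(U, c) \<in> atlas G" and h: "smooth_on (c ` U) h"
    and K: "compact K" "K \<subseteq> c ` U" "\<And>y. y \<in> c ` U \<Longrightarrow> y \<notin> K \<Longrightarrow> h y = 0"
  shows "smooth_fun G (\<lambda>x. if x \<in> U then h (c x) else 0)"
proof (rule smooth_funI)
  fix V d assume d: "(V, d) \<in> atlas G"
  note C = top_atlas_chart[OF top_atlas_G c] and D = top_atlas_chart[OF top_atlas_G d]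
  let ?f = "\<lambda>x. if x \<in> U then h (c x) else 0"
  define L where "L = inv_into U c ` K"
  have "compact L" unfolding L_def
    by (rule compact_continuous_image[OF continuous_on_subset[OF C(4) K(2)] K(1)])
  then have L: "closed L" by (rule compact_imp_closed)
  have oU: "open (d ` (V \<inter> U))" by (rule open_chart_image[OF top_atlas_G d C(1)])
  have oL: "open (d ` (V \<inter> - L))" by (rule open_chart_image[OF top_atlas_G d]) (use L in auto)
  show "smooth_on (d ` V) (\<lambda>y. ?f (inv_into V d y))"
  proof (rule smooth_on_local[OF D(2)])
    fix y assume "y \<in> d ` V"
    show "\<exists>O'. open O' \<and> y \<in> O' \<and> O' \<subseteq> d ` V \<and> smooth_on O' (\<lambda>y. ?f (inv_into V d y))"
    proof (cases "inv_into V d y \<in> U")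
      case True
      have "smooth_on (d ` (V \<inter> U)) (\<lambda>y. h (c (inv_into V d y)))"
        by (rule smooth_on_compose[OF h plot_chart_compose[OF c plot_subset[OF plot_chart[OF d] oU]]])
          (use D(6) in auto)
      then have "smooth_on (d ` (V \<inter> U)) (\<lambda>y. ?f (inv_into V d y))"
        by (subst smooth_on_cong[OF oU, of _ "\<lambda>y. h (c (inv_into V d y))"]) (auto simp: D(6))
      moreover have "y \<in> d ` (V \<inter> U)" using True \<open>y \<in> d ` V\<close> D(6) by auto
      ultimately show ?thesis using oU by blast
    next
      case False
      have "smooth_on (d ` (V \<inter> - L)) (\<lambda>y. ?f (inv_into V d y))"
      proof (subst smooth_on_cong[OF oL, of _ "\<lambda>y. 0"])
        fix z assume "z \<in> d ` (V \<inter> - L)"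
        then obtain x where x: "z = d x" "x \<in> V" "x \<notin> L" by auto
        have "h (c x) = 0" if "x \<in> U"
          using K(3)[of "c x"] x(3) that C(6)[OF that] by (force simp: L_def)
        then show "?f (inv_into V d z) = 0" using x D(6) by simp
      qed simp
      moreover have "inv_into V d y \<notin> L" using False K(2) C(6) by (auto simp: L_def)
      then have "y \<in> d ` (V \<inter> - L)" using \<open>y \<in> d ` V\<close> D(6) by auto
      ultimately show ?thesis using oL by blast
    qed
  qed
qed

lemma smooth_on_flat_ball: "smooth_on S (\<lambda>y. flat 1 (r\<^sup>2 - (norm (y - y0))\<^sup>2))"
  by (rule smooth_on_compose[OF smooth_on_flat], unfold power2_norm_eq_inner)
     (auto intro!: smooth_on_diff smooth_on_const smooth_on_inner smooth_on_id)

lemma flat_ball_zero: "0 \<le> r \<Longrightarrow> y \<notin> cball y0 r \<Longrightarrow> flat 1 (r\<^sup>2 - (norm (y - y0))\<^sup>2) = 0"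
  by (rule flat_one_zero) (simp add: dist_norm norm_minus_commute)

lemma bump_function:
  assumes "open N" "a \<in> N"
  obtains f :: "'g \<Rightarrow> real" where "smooth_fun G f" "f a > 0" "\<And>x. x \<notin> N \<Longrightarrow> f x = 0"
proof -
  obtain U c where c: "(U, c) \<in> atlas G" "a \<in> U" using top_atlas_cover[OF top_atlas_G] .
  note C = top_atlas_chart[OF top_atlas_G c(1)]
  have "open (c ` (U \<inter> N))" by (rule open_chart_image[OF top_atlas_G c(1) assms(1)])
  then obtain r where r: "r > 0" "cball (c a) r \<subseteq> c ` (U \<inter> N)"
    using open_contains_cball c(2) assms(2) by (metis Int_iff imageI)
  let ?h = "\<lambda>y. flat 1 (r\<^sup>2 - (norm (y - c a))\<^sup>2)"
  show thesis
  proof (rule that)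
    show "smooth_fun G (\<lambda>x. if x \<in> U then ?h (c x) else 0)"
      by (rule smooth_fun_extend_zero[OF c(1) smooth_on_flat_ball, of "cball (c a) r"])
        (use r flat_ball_zero[OF less_imp_le[OF r(1)]] in auto)
    show "(if a \<in> U then ?h (c a) else 0) > 0"
      using c(2) r(1) by (simp add: flat_one_pos)
    show "(if x \<in> U then ?h (c x) else 0) = 0" if "x \<notin> N" for x
    proof (cases "x \<in> U")
      case True
      have "c x \<notin> cball (c a) r"
      proof
        assume "c x \<in> cball (c a) r"
        then obtain x' where "x' \<in> U" "x' \<in> N" "c x = c x'" using r(2) by blast
        then show False using inj_onD[OF C(5), of x x'] True that by auto
      qed
      then show ?thesis by (simp add: flat_ball_zero[OF less_imp_le[OF r(1)]])
    qed simp
  qed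
qed

lemma smooth_fun_separates:
  assumes "\<And>f :: 'g \<Rightarrow> real. smooth_fun G f \<Longrightarrow> f x = f y"
  shows "x = y"
proof (rule ccontr)
  assume "x \<noteq> y"
  then obtain f :: "'g \<Rightarrow> real" where "smooth_fun G f" "f x > 0" "\<And>z. z \<notin> - {y} \<Longrightarrow> f z = 0"
    using bump_function[of "- {y}" x] by (metis ComplI open_Compl closed_singleton singletonD)
  then show False using assms[of f] by auto
qed

lemma identity_chart:
  obtains U c D where "(U, c) \<in> atlas G" "\<one> \<in> U" "((\<lambda>X. c (lie_exp G X)) has_derivative D) (at 0)" "bij D"
    "linear D" "linear (inv_into UNIV D)"
proof -
  obtain U c where c: "(U, c) \<in> atlas G" "\<one> \<in> U" using top_atlas_cover[OF top_atlas_G] .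
  obtain D where D: "((c \<circ> lie_exp G) has_derivative D) (at 0)" "bij D" using exp_deriv[OF c] by auto
  have "linear D" by (rule has_derivative_linear[OF D(1)])
  moreover from this have "linear (inv_into UNIV D)"
  proof -
    obtain E where E: "linear E" "E \<circ> D = id"
      using linear_injective_left_inverse[OF \<open>linear D\<close> bij_is_inj[OF D(2)]] by auto
    have "inv_into UNIV D = E"
      using E(2) surj_f_inv_f[OF bij_is_surj[OF D(2)]] by (metis comp_apply id_apply ext)
    then show ?thesis using E(1) by simp
  qed
  ultimately show thesis using that[OF c] D by (auto simp: comp_def)
qed

lemma lder_chart:
  assumes c: "(U, c) \<in> atlas G" "\<one> \<in> U" and D: "((\<lambda>X. c (lie_exp G X)) has_derivative D) (at 0)"
    and F: "(F has_derivative F') (at (c \<one>))" and f: "\<And>x. x \<in> U \<Longrightarrow> f (g \<otimes> x) = F (c x)"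
  shows "((\<lambda>t. f (g \<otimes> lie_exp G (t *\<^sub>R Z))) has_vector_derivative F' (D Z)) (at 0)"
proof -
  have 1: "((\<lambda>t. t *\<^sub>R Z) has_derivative (\<lambda>t. t *\<^sub>R Z)) (at 0)"
    by (auto intro!: derivative_eq_intros)
  have "((\<lambda>t. c (lie_exp G (t *\<^sub>R Z))) has_derivative (\<lambda>t. D (t *\<^sub>R Z))) (at 0)"
    by (rule has_derivative_compose[OF 1]) (simp add: D)
  then have "((\<lambda>t. F (c (lie_exp G (t *\<^sub>R Z)))) has_derivative (\<lambda>t. F' (D (t *\<^sub>R Z)))) (at 0)"
    by (rule has_derivative_compose) (simp add: F)
  moreover have "F' (D (t *\<^sub>R Z)) = t *\<^sub>R F' (D Z)" for t
    using linear_scale[OF has_derivative_linear[OF D]] linear_scale[OF has_derivative_linear[OF F]] by simp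
  ultimately have der: "((\<lambda>t. F (c (lie_exp G (t *\<^sub>R Z)))) has_vector_derivative F' (D Z)) (at 0)"
    by (simp add: has_vector_derivative_def)
  let ?S = "{t::real. lie_exp G (t *\<^sub>R Z) \<in> U}"
  have "continuous_on UNIV (\<lambda>t::real. lie_exp G (t *\<^sub>R Z))"
    using plot_continuous_on[OF plot_exp_line[of \<one> Z]] by simp
  from open_vimage[OF top_atlas_chart(1)[OF top_atlas_G c(1)] this] have "open ?S" by (simp add: vimage_def)
  then show ?thesis
    by (rule has_vector_derivative_transform_within_open[OF der]) (use c(2) f in auto)
qed

text \<open>A chart around the identity, followed by the inverse of the differential of exp and cut
  off, is a logarithm to first order at the identity. It is defined and smooth on the whole group,
  and that accuracy suffices to recover a Lie algebra element from its derivation.\<close>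

lemma exists_log_function:
  "\<exists>l :: 'g \<Rightarrow> 'a. smooth_fun G l \<and> l \<one> = 0 \<and> (\<forall>Z. lder G Z l \<one> = Z)"
proof -
  obtain U c D where c: "(U, c) \<in> atlas G" "\<one> \<in> U" and D: "((\<lambda>X. c (lie_exp G X)) has_derivative D) (at 0)" "bij D"
    and L: "linear D" "linear (inv_into UNIV D)" by (rule identity_chart)
  note C = top_atlas_chart[OF top_atlas_G c(1)]
  obtain r where r: "r > 0" "cball (c \<one>) r \<subseteq> c ` U"
    using open_contains_cball[of "c ` U"] C(2) c(2) by blast
  let ?b = "\<lambda>y. flat 1 (r\<^sup>2 - (norm (y - c \<one>))\<^sup>2)"
  \<comment> \<open>Dividing by the value at the centre normalises the cutoff to 1 there. Its
    derivative then contributes nothing at the centre, since the linear factor vanishes at that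
    point.\<close>
  define h where "h y = (?b y / ?b (c \<one>)) *\<^sub>R inv_into UNIV D (y - c \<one>)" for y
  have bpos: "?b (c \<one>) > 0" using r(1) by (simp add: flat_one_pos)
  have lin: "bounded_linear (inv_into UNIV D)" using L(2) linear_conv_bounded_linear by blast
  have sb: "smooth_on UNIV (\<lambda>y. ?b y / ?b (c \<one>))"
    unfolding divide_inverse by (intro smooth_on_mult smooth_on_flat_ball smooth_on_const)
  have sl: "smooth_on UNIV (\<lambda>y. inv_into UNIV D (y - c \<one>))"
    by (intro smooth_on_linear_compose[OF lin] smooth_on_diff smooth_on_id smooth_on_const)
  have h: "smooth_on UNIV h" unfolding h_def by (rule smooth_on_scaleR[OF sb sl])
  let ?l = "\<lambda>x. if x \<in> U then h (c x) else 0"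
  have "smooth_fun G ?l"
    by (rule smooth_fun_extend_zero[OF c(1) smooth_on_subset[OF h], of "cball (c \<one>) r"])
      (use r flat_ball_zero[OF less_imp_le[OF r(1)]] in \<open>auto simp: h_def\<close>)
  moreover have "?l \<one> = 0" using linear_0[OF L(2)] by (simp add: h_def)
  moreover have "lder G Z ?l \<one> = Z" for Z
  proof -
    let ?b' = "frechet_derivative (\<lambda>y. ?b y / ?b (c \<one>)) (at (c \<one>))"
    have "((\<lambda>y. y - c \<one>) has_derivative (\<lambda>w. w)) (at (c \<one>))" by (auto intro!: derivative_eq_intros)
    from bounded_linear.has_derivative[OF lin this]
    have d2: "((\<lambda>y. inv_into UNIV D (y - c \<one>)) has_derivative inv_into UNIV D) (at (c \<one>))" .
    have "(h has_derivative (\<lambda>w. (?b (c \<one>) / ?b (c \<one>)) *\<^sub>R inv_into UNIV D w + ?b' w *\<^sub>R inv_into UNIV D (c \<one> - c \<one>))) (at (c \<one>))"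
      unfolding h_def by (rule has_derivative_scaleR[OF smooth_on_has_derivative[OF sb] d2]) simp
    then have h': "(h has_derivative inv_into UNIV D) (at (c \<one>))"
      using bpos by (simp add: linear_0[OF L(2)])
    have "((\<lambda>t. ?l (\<one> \<otimes> lie_exp G (t *\<^sub>R Z))) has_vector_derivative inv_into UNIV D (D Z)) (at 0)"
      by (rule lder_chart[OF c D(1) h']) simp
    from vector_derivative_at[OF this] show ?thesis
      using D(2) by (simp add: lder_def bij_is_inj)
  qed
  ultimately show ?thesis by blast
qed

definition logf :: "'g \<Rightarrow> 'a" where
  "logf = (SOME l. smooth_fun G l \<and> l \<one> = 0 \<and> (\<forall>Z. lder G Z l \<one> = Z))"

lemma logf: "smooth_fun G logf" "logf \<one> = 0" "lder G Z logf \<one> = Z"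
  using someI_ex[OF exists_log_function] by (simp_all add: logf_def)

lemma lder_translate: "lder G Z (\<lambda>x. f (a \<otimes> x)) g = lder G Z f (a \<otimes> g)"
  by (simp add: lder_def m_assoc)

lemma smooth_fun_left: "smooth_fun G f \<Longrightarrow> smooth_fun G (\<lambda>x. f (a \<otimes> x))"
  using smooth_fun_translate[of f a \<one>] by simp

lemma lder_log: "lder G Z (\<lambda>x. logf (inv g \<otimes> x)) g = Z"
  by (simp add: lder_translate logf)

text \<open>The translate of \<open>logf\<close> to \<open>g\<close> has derivative \<open>Z\<close>
  along \<open>Z\<close>, so its components are enough real-valued test functions. Every uniqueness
  claim behind the description operators for Lie algebra elements is reduced to this.\<close>

lemma lder_inject:
  assumes "\<And>f :: 'g \<Rightarrow> real. smooth_fun G f \<Longrightarrow> lder G Z f g = lder G Z' f g"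
  shows "Z = Z'"
proof (rule euclidean_eqI)
  fix b :: 'a assume "b \<in> Basis"
  have sm: "smooth_fun G (\<lambda>x. logf (inv g \<otimes> x))" by (rule smooth_fun_left[OF logf(1)])
  have "lder G W (\<lambda>x. logf (inv g \<otimes> x) \<bullet> b) g = W \<bullet> b" for W
    using lder_linear[OF bounded_linear_inner_left sm, of W b g] by (simp add: lder_log)
  then show "Z \<bullet> b = Z' \<bullet> b"
    using assms[OF smooth_fun_linear[OF bounded_linear_inner_left sm], of b] by simp
qed

text \<open>The left-trivialised velocity at time 0, read through the first-order logarithm centred
  at the starting point.\<close>

definition velocity :: "(real \<Rightarrow> 'g) \<Rightarrow> 'a" where
  "velocity \<gamma> = vector_derivative (\<lambda>t. logf (inv (\<gamma> 0) \<otimes> \<gamma> t)) (at 0)"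

lemma velocity_chart:
  fixes f :: "'g \<Rightarrow> 'v::euclidean_space"
  assumes c: "(U, c) \<in> atlas G" "\<one> \<in> U" and D: "((\<lambda>X. c (lie_exp G X)) has_derivative D) (at 0)" "bij D"
    and p: "plot S \<gamma>" "0 \<in> S" and f: "smooth_fun G f"
  shows "((\<lambda>t. f (\<gamma> t)) has_vector_derivative
     lder G (inv_into UNIV D (vector_derivative (\<lambda>t. c (inv (\<gamma> 0) \<otimes> \<gamma> t)) (at 0))) f (\<gamma> 0)) (at 0)"
proof -
  note C = top_atlas_chart[OF top_atlas_G c(1)]
  let ?g = "\<gamma> 0" and ?\<delta> = "\<lambda>t. inv (\<gamma> 0) \<otimes> \<gamma> t"
  define w where "w = vector_derivative (\<lambda>t. c (?\<delta> t)) (at 0)"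
  define F where "F y = f (?g \<otimes> inv_into U c y)" for y
  have S: "open S" using p by (simp add: plot_def)
  have pd: "plot S ?\<delta>" by (rule plot_mult[OF plot_const[OF S] p(1)])
  define T where "T = S \<inter> ?\<delta> -` U"
  have T: "open T" unfolding T_def
    by (rule continuous_open_preimage[OF plot_continuous_on[OF pd] S C(1)])
  have 0: "0 \<in> T" using p c by (simp add: T_def)
  have "smooth_on T (\<lambda>t. c (?\<delta> t))"
    by (rule plot_chart_compose[OF c(1) plot_subset[OF pd T]]) (auto simp: T_def)
  from smooth_on_imp_differentiable[OF this 0]
  have w: "((\<lambda>t. c (?\<delta> t)) has_vector_derivative w) (at 0)" by (simp add: w_def vector_derivative_works)
  have "smooth_on (c ` U) F" unfolding F_def
    by (rule smooth_fun_plot[OF smooth_fun_left[OF f] plot_chart[OF c(1)]])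
  then have F: "(F has_derivative frechet_derivative F (at (c \<one>))) (at (c \<one>))"
    by (rule smooth_on_has_derivative) (use c(2) in auto)
  have Fe: "f (?g \<otimes> x) = F (c x)" if "x \<in> U" for x using that C(6) by (simp add: F_def)
  have "((\<lambda>t. f (?g \<otimes> lie_exp G (t *\<^sub>R inv_into UNIV D w))) has_vector_derivative
      frechet_derivative F (at (c \<one>)) (D (inv_into UNIV D w))) (at 0)"
    by (rule lder_chart[OF c D(1) F Fe])
  then have l: "lder G (inv_into UNIV D w) f ?g = frechet_derivative F (at (c \<one>)) w"
    using D(2) by (simp add: lder_def vector_derivative_at bij_is_surj surj_f_inv_f)
  have "((\<lambda>t. F (c (?\<delta> t))) has_derivative (\<lambda>h. frechet_derivative F (at (c \<one>)) (h *\<^sub>R w))) (at 0)"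
    by (rule has_derivative_compose[OF w[unfolded has_vector_derivative_def]]) (simp add: F)
  then have "((\<lambda>t. F (c (?\<delta> t))) has_vector_derivative frechet_derivative F (at (c \<one>)) w) (at 0)"
    by (simp add: has_vector_derivative_def linear_scale[OF has_derivative_linear[OF F]])
  then have "((\<lambda>t. f (\<gamma> t)) has_vector_derivative frechet_derivative F (at (c \<one>)) w) (at 0)"
  proof (rule has_vector_derivative_transform_within_open[OF _ T 0])
    fix t assume "t \<in> T"
    then have "F (c (?\<delta> t)) = f (?g \<otimes> ?\<delta> t)" using Fe by (simp add: T_def)
    then show "F (c (?\<delta> t)) = f (\<gamma> t)" by (simp add: m_assoc[symmetric])
  qed
  then show ?thesis unfolding l[symmetric] by (simp only: w_def)
qed

text \<open>A chart at the identity yields some Lie algebra element that represents the derivative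
  of every smooth function along the curve (\<open>velocity_chart\<close>). Testing it on the
  translated \<open>logf\<close> identifies this element as
  \<open>velocity \<gamma>\<close>.\<close>

lemma velocity:
  assumes p: "plot S \<gamma>" "0 \<in> S" and f: "smooth_fun G f"
  shows "((\<lambda>t. f (\<gamma> t)) has_vector_derivative lder G (velocity \<gamma>) f (\<gamma> 0)) (at 0)"
proof -
  obtain U c D where c: "(U, c) \<in> atlas G" "\<one> \<in> U" and D: "((\<lambda>X. c (lie_exp G X)) has_derivative D) (at 0)" "bij D"
    by (rule identity_chart)
  note v = velocity_chart[OF c D p]
  have "velocity \<gamma> = inv_into UNIV D (vector_derivative (\<lambda>t. c (inv (\<gamma> 0) \<otimes> \<gamma> t)) (at 0))"
    unfolding velocity_def
    by (subst vector_derivative_at[OF v[OF smooth_fun_left[OF logf(1)]]]) (simp add: lder_log)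
  then show ?thesis using v[OF f] by simp
qed

lemma velocity_unique:
  assumes p: "plot S \<gamma>" "0 \<in> S"
    and "\<And>f :: 'g \<Rightarrow> real. smooth_fun G f \<Longrightarrow> ((\<lambda>t. f (\<gamma> t)) has_vector_derivative lder G Z f (\<gamma> 0)) (at 0)"
  shows "velocity \<gamma> = Z"
  by (rule lder_inject[of _ "\<gamma> 0"]) (metis assms(3) velocity[OF p] vector_derivative_at)

lemma velocity_exp: "velocity (\<lambda>t. g \<otimes> lie_exp G (t *\<^sub>R Z)) = Z"
  by (rule velocity_unique[OF plot_exp_line]) (simp_all add: lder_has_vector_derivative)

lemma exp_line_inject:
  assumes "\<And>t. lie_exp G (t *\<^sub>R Z) = lie_exp G (t *\<^sub>R Z')" shows "Z = Z'"
  using velocity_exp[of \<one> Z] velocity_exp[of \<one> Z'] assms by simp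

text \<open>With Z the velocity of \<tau>, the curve \<delta>(t) = \<tau>(t) exp(-tZ) is constant:
  the homomorphism laws move its derivative at any time to time 0, where the contributions Z and -Z
  cancel. Constancy is tested on smooth functions, which separate points.\<close>

lemma one_parameter_subgroup:
  assumes p: "plot UNIV \<tau>" and hom: "\<And>s t. \<tau> (s + t) = \<tau> s \<otimes> \<tau> t"
  shows "\<tau> t = lie_exp G (t *\<^sub>R velocity \<tau>)"
proof -
  let ?Z = "velocity \<tau>"
  have "\<tau> 0 \<otimes> \<tau> 0 = \<tau> 0" using hom[of 0 0] by simp
  then have \<tau>0: "\<tau> 0 = \<one>" using r_cancel_one[OF in_carrier in_carrier, of "\<tau> 0" "\<tau> 0"] by simp
  define \<delta> where "\<delta> t = \<tau> t \<otimes> lie_exp G (- t *\<^sub>R ?Z)" for t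
  have "f (\<delta> t) = f \<one>" if f: "smooth_fun G f" for f :: "'g \<Rightarrow> real"
  proof -
    have "((\<lambda>t. f (\<delta> t)) has_vector_derivative 0) (at t)" for t
    proof -
      let ?F = "\<lambda>x. f (\<tau> t \<otimes> x \<otimes> lie_exp G (- t *\<^sub>R ?Z))"
      have F: "smooth_fun G ?F" by (rule smooth_fun_translate[OF f])
      let ?H = "\<lambda>y. ?F (\<tau> (fst y) \<otimes> lie_exp G (snd y *\<^sub>R (- ?Z)))"
      have H: "smooth_on (UNIV :: (real \<times> real) set) ?H"
        by (rule smooth_fun_plot[OF F], intro plot_mult plot_exp plot_compose[OF p] smooth_on_fst smooth_on_snd
           smooth_on_id smooth_on_linear_compose[OF bounded_linear_scaleR_left]) auto
      have a: "((\<lambda>h. ?H (h, 0)) has_vector_derivative lder G ?Z ?F \<one>) (at 0)"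
        using velocity[OF p _ F] by (simp add: \<tau>0)
      have b: "((\<lambda>h. ?H (0, h)) has_vector_derivative lder G (- ?Z) ?F \<one>) (at 0)"
        using lder_has_vector_derivative[OF F, of \<one> "- ?Z"] by (simp add: \<tau>0)
      have "((\<lambda>h. ?H (h, h)) has_vector_derivative 0) (at 0)"
        using has_vector_derivative_diagonal[OF H _ a b] linear_neg[OF lder_linear_in[OF F]] by simp
      then have h: "((\<lambda>h. ?H (h, h)) has_vector_derivative 0) (at (t - t))" by simp
      have "((\<lambda>s. ?H (s - t, s - t)) has_vector_derivative (1 *\<^sub>R 0)) (at t)"
        by (rule vector_diff_chain_at[of "\<lambda>s. s - t" 1 t "\<lambda>h. ?H (h, h)", unfolded comp_def, OF _ h])
          (auto intro!: derivative_eq_intros)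
      moreover have "?H (s - t, s - t) = f (\<delta> s)" for s
      proof -
        have "\<delta> s = \<tau> (t + (s - t)) \<otimes> lie_exp G ((- (s - t) + - t) *\<^sub>R ?Z)" by (simp add: \<delta>_def)
        also have "\<dots> = \<tau> t \<otimes> (\<tau> (s - t) \<otimes> lie_exp G (- (s - t) *\<^sub>R ?Z)) \<otimes> lie_exp G (- t *\<^sub>R ?Z)"
          unfolding hom exp_add by (simp add: m_assoc)
        finally show ?thesis by (simp add: algebra_simps)
      qed
      ultimately show ?thesis by simp
    qed
    then have "((\<lambda>t. f (\<delta> t)) has_real_derivative 0) (at t)" for t
      by (simp add: has_real_derivative_iff_has_vector_derivative)
    then have "f (\<delta> t) = f (\<delta> 0)" by (intro DERIV_isconst_all) blast
    then show ?thesis by (simp add: \<delta>_def \<tau>0)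
  qed
  then have "\<delta> t = \<one>" by (rule smooth_fun_separates)
  then have "\<tau> t = inv (lie_exp G (- t *\<^sub>R ?Z))"
    unfolding \<delta>_def using inv_equality[of "\<tau> t" "lie_exp G (- t *\<^sub>R ?Z)"] by simp
  then show ?thesis using exp_minus[of "- t *\<^sub>R ?Z"] by simp
qed


section \<open>Differentials of homomorphisms and the adjoint action\<close>

definition lie_hom :: "('g \<Rightarrow> 'g) \<Rightarrow> bool" where
  "lie_hom \<tau> \<longleftrightarrow> smooth_map_on (atlas G) (atlas G) UNIV \<tau> \<and> (\<forall>x y. \<tau> (x \<otimes> y) = \<tau> x \<otimes> \<tau> y)"

text \<open>Phrased exactly as \<open>Ad\<close>, so that conjugations and the involution of a
  symmetric pair are covered by the same lemmas.\<close>

definition lie_diff :: "('g \<Rightarrow> 'g) \<Rightarrow> 'a \<Rightarrow> 'a" where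
  "lie_diff \<tau> X = (THE Z. \<forall>t. lie_exp G (t *\<^sub>R Z) = \<tau> (lie_exp G (t *\<^sub>R X)))"

lemma lie_diff_unique:
  assumes "\<And>t. lie_exp G (t *\<^sub>R Z) = \<tau> (lie_exp G (t *\<^sub>R X))" shows "lie_diff \<tau> X = Z"
  unfolding lie_diff_def
proof (rule the_equality)
  fix Z' assume "\<forall>t. lie_exp G (t *\<^sub>R Z') = \<tau> (lie_exp G (t *\<^sub>R X))"
  then show "Z' = Z" by (intro exp_line_inject) (simp add: assms)
qed (simp add: assms)

text \<open>The image of t -> exp(tX) under a smooth homomorphism is a one-parameter subgroup, hence
  again of exponential form; so the description in \<open>lie_diff\<close> has a solution.\<close>

lemma lie_diff_exp:
  assumes "lie_hom \<tau>"
  shows "lie_exp G (t *\<^sub>R lie_diff \<tau> X) = \<tau> (lie_exp G (t *\<^sub>R X))"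
proof -
  let ?\<gamma> = "\<lambda>t. \<tau> (lie_exp G (t *\<^sub>R X))"
  have "plot UNIV (\<lambda>t. lie_exp G (t *\<^sub>R X))" using plot_exp_line[of \<one> X] by simp
  then have p: "plot UNIV ?\<gamma>"
    by (rule plot_map[of \<tau>, rotated]) (use assms in \<open>simp add: lie_hom_def\<close>)
  have "?\<gamma> (s + t) = ?\<gamma> s \<otimes> ?\<gamma> t" for s t
    using assms by (simp add: exp_add lie_hom_def)
  then have e: "lie_exp G (t *\<^sub>R velocity ?\<gamma>) = ?\<gamma> t" for t
    by (rule one_parameter_subgroup[OF p, symmetric])
  have "lie_diff \<tau> X = velocity ?\<gamma>" by (rule lie_diff_unique) (rule e)
  then show ?thesis by (simp add: e)
qed

lemma lder_lie_diff:
  assumes "lie_hom \<tau>"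
  shows "lder G (lie_diff \<tau> X) f (\<tau> g) = lder G X (\<lambda>x. f (\<tau> x)) g"
  using assms by (simp add: lder_def lie_diff_exp lie_hom_def)

lemma linear_lie_diff:
  assumes "lie_hom \<tau>" shows "linear (lie_diff \<tau>)"
proof (rule linearI)
  have sm: "smooth_fun G (\<lambda>x. f (\<tau> x))" if "smooth_fun G f" for f :: "'g \<Rightarrow> real"
    using smooth_fun_compose[OF that] assms by (simp add: lie_hom_def)
  show "lie_diff \<tau> (X + Y) = lie_diff \<tau> X + lie_diff \<tau> Y" for X Y
    by (rule lder_inject[of _ "\<tau> \<one>"])
      (simp add: lder_lie_diff[OF assms] linear_add[OF lder_linear_in] sm)
  show "lie_diff \<tau> (r *\<^sub>R X) = r *\<^sub>R lie_diff \<tau> X" for r X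
    by (rule lder_inject[of _ "\<tau> \<one>"])
      (simp add: lder_lie_diff[OF assms] linear_scale[OF lder_linear_in] sm)
qed

lemma smooth_map_two_sided: "smooth_map_on (atlas G) (atlas G) UNIV (\<lambda>x. a \<otimes> x \<otimes> b)"
proof -
  have id: "smooth_map_on (atlas G) (atlas G) UNIV (\<lambda>x. x)"
  proof (rule smooth_map_onI)
    fix U c V d assume c: "(U, c) \<in> atlas G" and d: "(V, d) \<in> atlas G"
    have "smooth_on (c ` (U \<inter> V)) (\<lambda>y. d (inv_into U c y))"
      using atlas c d by (force simp: smooth_atlas_def comp_def)
    moreover have "U \<inter> UNIV \<inter> (\<lambda>x. x) -` V = U \<inter> V" by auto
    ultimately show "smooth_on (c ` (U \<inter> UNIV \<inter> (\<lambda>x. x) -` V)) (\<lambda>y. d (inv_into U c y))" by simp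
  qed (rule continuous_on_id)
  have mult: "smooth_map_on (atlas G) (atlas G) UNIV (\<lambda>x. p x \<otimes> q x)"
    if "smooth_map_on (atlas G) (atlas G) UNIV p" "smooth_map_on (atlas G) (atlas G) UNIV q" for p q
    using smooth_map_on_compose[OF top_atlas_G top_atlas_prod[OF top_atlas_G top_atlas_G] top_atlas_G
        smooth_map_on_Pair[OF top_atlas_G that] mult_smooth] by simp
  show ?thesis by (intro mult id smooth_map_on_const)
qed

lemma lie_hom_conj: "lie_hom (\<lambda>x. g \<otimes> x \<otimes> inv g)"
proof -
  have "g \<otimes> (x \<otimes> y) \<otimes> inv g = (g \<otimes> x \<otimes> inv g) \<otimes> (g \<otimes> y \<otimes> inv g)" for x y
  proof -
    have "(g \<otimes> x \<otimes> inv g) \<otimes> (g \<otimes> y \<otimes> inv g) = g \<otimes> x \<otimes> (inv g \<otimes> g) \<otimes> y \<otimes> inv g" by (simp only: m_assoc in_carrier)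
    then show ?thesis by (simp add: m_assoc)
  qed
  then show ?thesis by (simp add: lie_hom_def smooth_map_two_sided)
qed

lemma Ad_eq: "Ad G g = lie_diff (\<lambda>x. g \<otimes> x \<otimes> inv g)"
  by (simp add: Ad_def lie_diff_def fun_eq_iff)

lemma exp_Ad: "lie_exp G (t *\<^sub>R Ad G g X) = g \<otimes> lie_exp G (t *\<^sub>R X) \<otimes> inv g"
  unfolding Ad_eq by (rule lie_diff_exp[OF lie_hom_conj])

lemma linear_Ad: "linear (Ad G g)"
  unfolding Ad_eq by (rule linear_lie_diff[OF lie_hom_conj])

lemma bounded_linear_Ad: "bounded_linear (Ad G g)"
  using linear_Ad linear_conv_bounded_linear by blast

lemma Ad_unique:
  "(\<And>t. lie_exp G (t *\<^sub>R Z) = g \<otimes> lie_exp G (t *\<^sub>R X) \<otimes> inv g) \<Longrightarrow> Ad G g X = Z"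
  unfolding Ad_eq by (rule lie_diff_unique)

lemma Ad_one [simp]: "Ad G \<one> X = X"
  by (rule Ad_unique) simp

lemma Ad_mult: "Ad G (g \<otimes> h) X = Ad G g (Ad G h X)"
  by (rule Ad_unique) (simp add: exp_Ad inv_mult_group m_assoc)

lemma Ad_inv_cancel [simp]: "Ad G (inv g) (Ad G g X) = X" "Ad G g (Ad G (inv g) X) = X"
  by (simp_all add: Ad_mult[symmetric])

text \<open>Trades the description operator for a t-derivative of an expression that is jointly
  smooth in \<open>g\<close> and t, from which smoothness of \<open>Ad\<close> in \<open>g\<close>
  follows.\<close>

lemma Ad_as_derivative: "Ad G g X = vector_derivative (\<lambda>t. logf (g \<otimes> lie_exp G (t *\<^sub>R X) \<otimes> inv g)) (at 0)"
  using logf(3)[of "Ad G g X"] by (simp add: lder_def exp_Ad)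

lemma smooth_fun_Ad: "smooth_fun G (\<lambda>g. Ad G g X)"
proof (rule smooth_funI)
  fix U c assume c: "(U, c) \<in> atlas G"
  note C = top_atlas_chart[OF top_atlas_G c]
  have o: "open (c ` U \<times> (UNIV :: real set))" by (rule open_Times[OF C(2) open_UNIV])
  have "smooth_on (c ` U \<times> UNIV) (\<lambda>y. logf (inv_into U c (fst y) \<otimes> lie_exp G (snd y *\<^sub>R X) \<otimes> inv (inv_into U c (fst y))))"
    by (rule smooth_fun_plot[OF logf(1)], intro plot_mult plot_inv plot_exp plot_compose[OF plot_chart[OF c]] smooth_on_fst
      smooth_on_snd smooth_on_id smooth_on_linear_compose[OF bounded_linear_scaleR_left] o) auto
  from smooth_on_partial_snd(1)[OF o this C(2), of 0]
  show "smooth_on (c ` U) (\<lambda>y. Ad G (inv_into U c y) X)" by (simp add: Ad_as_derivative)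
qed

section \<open>The bracket as the differential of the adjoint action\<close>

definition ad :: "'a \<Rightarrow> 'a \<Rightarrow> 'a" where
  "ad X Y = lder G X (\<lambda>g. Ad G g Y) \<one>"

text \<open>The conjugation is split into two independent times: K(a, b) is the t-derivative at 0 of
  f (g exp(aX) exp(tY) exp(-bX)). Its a-derivative is XYf, its b-derivative is -YXf by symmetry of
  mixed partials, and on the diagonal a = b = s it is the derivative of f along Ad of exp(sX)
  applied to Y.\<close>

lemma lder_ad:
  fixes f :: "'g \<Rightarrow> 'v::euclidean_space"
  assumes f: "smooth_fun G f"
  shows "lder G (ad X Y) f g = lder G X (lder G Y f) g - lder G Y (lder G X f) g"
proof -
  let ?L = "\<lambda>W. lder G W f g"
  have L: "bounded_linear ?L" using lder_linear_in[OF f] linear_conv_bounded_linear by blast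
  have "((\<lambda>s. Ad G (lie_exp G (s *\<^sub>R X)) Y) has_vector_derivative ad X Y) (at 0)"
    using lder_has_vector_derivative[OF smooth_fun_Ad[of Y], of \<one> X] by (simp add: ad_def)
  from bounded_linear.has_vector_derivative[OF L this]
  have lhs: "((\<lambda>s. ?L (Ad G (lie_exp G (s *\<^sub>R X)) Y)) has_vector_derivative ?L (ad X Y)) (at 0)" .
  let ?H = "\<lambda>y. f (g \<otimes> lie_exp G (fst (fst y) *\<^sub>R X) \<otimes> lie_exp G (snd y *\<^sub>R Y) \<otimes> lie_exp G (snd (fst y) *\<^sub>R (- X)))"
  have H: "smooth_on (UNIV :: ((real \<times> real) \<times> real) set) ?H"
    by (rule smooth_fun_plot[OF f], intro plot_mult plot_const plot_exp smooth_on_linear_compose[OF bounded_linear_scaleR_left]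
       smooth_on_fst smooth_on_snd smooth_on_id) auto
  define K where "K y = vector_derivative (\<lambda>t. ?H (y, t)) (at 0)" for y
  have K: "smooth_on UNIV K" unfolding K_def
    by (rule smooth_on_partial_snd(1)[OF _ H]) auto
  have "K (a, 0) = lder G Y f (g \<otimes> lie_exp G (a *\<^sub>R X))" for a
    by (simp add: K_def lder_def)
  then have a: "((\<lambda>a. K (a, 0)) has_vector_derivative lder G X (lder G Y f) g) (at 0)"
    using lder_has_vector_derivative[OF smooth_fun_lder[OF f, of Y], of g X] by simp
  have b: "((\<lambda>b. K (0, b)) has_vector_derivative - lder G Y (lder G X f) g) (at 0)"
  proof -
    let ?M = "\<lambda>y. f (g \<otimes> lie_exp G (snd y *\<^sub>R Y) \<otimes> lie_exp G (fst y *\<^sub>R (- X)))"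
    have M: "smooth_on (UNIV :: (real \<times> real) set) ?M"
      by (rule smooth_fun_plot[OF f], intro plot_mult plot_const plot_exp smooth_on_linear_compose[OF bounded_linear_scaleR_left]
         smooth_on_fst smooth_on_snd smooth_on_id) auto
    have "smooth_on UNIV (\<lambda>b. K (0, b))"
      by (rule smooth_on_compose[OF K]) (auto intro: smooth_on_Pair)
    from smooth_on_imp_differentiable[OF this, of 0]
    have "((\<lambda>b. K (0, b)) has_vector_derivative vector_derivative (\<lambda>b. K (0, b)) (at 0)) (at 0)"
      by (simp add: vector_derivative_works)
    moreover have "vector_derivative (\<lambda>b. K (0, b)) (at 0) =
       vector_derivative (\<lambda>s. vector_derivative (\<lambda>t. ?M (s, t)) (at 0)) (at 0)"
      by (simp add: K_def)
    also have "\<dots> = vector_derivative (\<lambda>t. vector_derivative (\<lambda>s. ?M (s, t)) (at 0)) (at 0)"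
      by (rule mixed_partials[OF open_UNIV M]) simp
    also have "\<dots> = vector_derivative (\<lambda>t. lder G (- X) f (g \<otimes> lie_exp G (t *\<^sub>R Y))) (at 0)"
      by (simp add: lder_def)
    also have "\<dots> = vector_derivative (\<lambda>t. - lder G X f (g \<otimes> lie_exp G (t *\<^sub>R Y))) (at 0)"
      by (simp add: linear_neg[OF lder_linear_in[OF f]])
    also have "\<dots> = - lder G Y (lder G X f) g"
      by (rule vector_derivative_at[OF has_vector_derivative_minus[OF lder_has_vector_derivative[OF smooth_fun_lder[OF f]]]])
    ultimately show ?thesis by simp
  qed
  have "((\<lambda>s. K (s, s)) has_vector_derivative lder G X (lder G Y f) g + - lder G Y (lder G X f) g) (at 0)"
    by (rule has_vector_derivative_diagonal[OF K _ a b]) simp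
  moreover have "K (s, s) = ?L (Ad G (lie_exp G (s *\<^sub>R X)) Y)" for s
    by (simp add: K_def lder_def exp_Ad exp_minus m_assoc)
  ultimately show ?thesis using vector_derivative_unique_at[OF lhs] by simp
qed

lemma bracket_eq_ad: "bracket G X Y = ad X Y"
  unfolding bracket_def
proof (rule the_equality)
  show "\<forall>f :: 'g \<Rightarrow> real. smooth_fun G f \<longrightarrow> (\<forall>g. lder G (ad X Y) f g = lder G X (lder G Y f) g - lder G Y (lder G X f) g)"
    using lder_ad by blast
  show "Z = ad X Y" if "\<forall>f :: 'g \<Rightarrow> real. smooth_fun G f \<longrightarrow>
     (\<forall>g. lder G Z f g = lder G X (lder G Y f) g - lder G Y (lder G X f) g)" for Z
    by (rule lder_inject[of _ \<one>]) (simp add: that lder_ad)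
qed

lemma lder_bracket:
  "smooth_fun G f \<Longrightarrow> lder G (bracket G X Y) f g = lder G X (lder G Y f) g - lder G Y (lder G X f) g"
  unfolding bracket_eq_ad by (rule lder_ad)

lemma lder_Ad: "lder G X (\<lambda>g. Ad G g Y) g = Ad G g (bracket G X Y)"
proof -
  have "lder G X (\<lambda>g. Ad G g Y) g = lder G X (\<lambda>x. Ad G g (Ad G x Y)) \<one>"
    by (simp add: lder_def Ad_mult)
  also have "\<dots> = Ad G g (bracket G X Y)"
    unfolding bracket_eq_ad ad_def by (rule lder_linear[OF bounded_linear_Ad smooth_fun_Ad])
  finally show ?thesis .
qed

lemma bilinear_bracket: "bilinear (bracket G)"
  unfolding bilinear_def
proof (intro conjI allI)
  show "linear (bracket G X)" for X
  proof (rule linearI)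
    show "bracket G X (Y + Z) = bracket G X Y + bracket G X Z" for Y Z
      unfolding bracket_eq_ad ad_def linear_add[OF linear_Ad] by (rule lder_add[OF smooth_fun_Ad smooth_fun_Ad])
    show "bracket G X (r *\<^sub>R Y) = r *\<^sub>R bracket G X Y" for r Y
      unfolding bracket_eq_ad ad_def linear_scale[OF linear_Ad] by (rule lder_linear[OF bounded_linear_scaleR_right smooth_fun_Ad])
  qed
  show "linear (\<lambda>X. bracket G X Y)" for Y
    unfolding bracket_eq_ad ad_def by (rule lder_linear_in[OF smooth_fun_Ad])
qed

lemma bounded_bilinear_bracket: "bounded_bilinear (bracket G)"
  using bilinear_bracket bilinear_conv_bounded_bilinear by blast

lemmas linear_bracket = bilinear_bracket[unfolded bilinear_def, THEN conjunct1, rule_format]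
  and linear_bracket_left = bilinear_bracket[unfolded bilinear_def, THEN conjunct2, rule_format]

lemmas bracket_simps = linear_add[OF linear_bracket] linear_add[OF linear_bracket_left]
  linear_diff[OF linear_bracket] linear_diff[OF linear_bracket_left]
  linear_neg[OF linear_bracket] linear_neg[OF linear_bracket_left]
  linear_scale[OF linear_bracket] linear_scale[OF linear_bracket_left]
  linear_0[OF linear_bracket] linear_0[OF linear_bracket_left]

lemma bracket_anticomm: "bracket G X Y = - bracket G Y X"
  by (rule lder_inject[of _ \<one>]) (simp add: lder_bracket linear_neg[OF lder_linear_in])

lemma bracket_self [simp]: "bracket G X X = 0"
proof -
  have "2 *\<^sub>R bracket G X X = bracket G X X + bracket G X X" by (rule scaleR_2)
  also have "\<dots> = 0" by (subst bracket_anticomm) simp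
  finally show ?thesis by simp
qed

text \<open>As operators on functions the derivations satisfy the identity because composition is
  associative; \<open>lder_inject\<close> carries it back to the Lie algebra.\<close>

lemma jacobi: "bracket G X (bracket G Y Z) = bracket G (bracket G X Y) Z + bracket G Y (bracket G X Z)"
proof (rule lder_inject[of _ \<one>])
  fix f :: "'g \<Rightarrow> real" assume f: "smooth_fun G f"
  have e: "lder G (bracket G A B) f = (\<lambda>g. lder G A (lder G B f) g - lder G B (lder G A f) g)" for A B
    using lder_bracket[OF f] by blast
  note sm = smooth_fun_lder[OF f] smooth_fun_lder[OF smooth_fun_lder[OF f]]
  show "lder G (bracket G X (bracket G Y Z)) f \<one> = lder G (bracket G (bracket G X Y) Z + bracket G Y (bracket G X Z)) f \<one>"
    unfolding linear_add[OF lder_linear_in[OF f]]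
    by (simp add: lder_bracket[OF f] lder_bracket[OF sm(1)] e lder_diff[OF sm(2) sm(2)])
qed

lemma lie_diff_bracket:
  assumes "lie_hom \<tau>"
  shows "lie_diff \<tau> (bracket G X Y) = bracket G (lie_diff \<tau> X) (lie_diff \<tau> Y)"
proof (rule lder_inject[of _ "\<tau> \<one>"])
  fix f :: "'g \<Rightarrow> real" assume f: "smooth_fun G f"
  have sm: "smooth_fun G (\<lambda>x. f (\<tau> x))" using smooth_fun_compose[OF f] assms by (simp add: lie_hom_def)
  show "lder G (lie_diff \<tau> (bracket G X Y)) f (\<tau> \<one>) = lder G (bracket G (lie_diff \<tau> X) (lie_diff \<tau> Y)) f (\<tau> \<one>)"
    by (simp add: lder_lie_diff[OF assms] lder_bracket[OF f] lder_bracket[OF sm])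
qed

lemma Ad_bracket: "Ad G g (bracket G X Y) = bracket G (Ad G g X) (Ad G g Y)"
  unfolding Ad_eq by (rule lie_diff_bracket[OF lie_hom_conj])

end

section \<open>Invariance of the Killing form and of the inner product\<close>

lemma trace_commute:
  fixes A B :: "'a::euclidean_space \<Rightarrow> 'a"
  assumes "linear A" "linear B"
  shows "(\<Sum>b\<in>Basis. A (B b) \<bullet> b) = (\<Sum>b\<in>Basis. B (A b) \<bullet> b)"
proof -
  have e: "(\<Sum>b\<in>Basis. P (Q b) \<bullet> b) = (\<Sum>b\<in>Basis. \<Sum>c\<in>Basis. (Q b \<bullet> c) * (P c \<bullet> b))"
    if "linear P" for P Q :: "'a \<Rightarrow> 'a"
  proof (rule sum.cong[OF refl])
    fix b :: 'a
    have "P (Q b) = (\<Sum>c\<in>Basis. (Q b \<bullet> c) *\<^sub>R P c)"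
      by (subst euclidean_representation[of "Q b", symmetric]) (simp add: linear_sum[OF that] linear_scale[OF that])
    then show "P (Q b) \<bullet> b = (\<Sum>c\<in>Basis. (Q b \<bullet> c) * (P c \<bullet> b))" by (simp add: inner_sum_left)
  qed
  show ?thesis unfolding e[OF assms(1)] e[OF assms(2)]
    by (subst sum.swap) (simp add: mult.commute)
qed

context lie_group
begin

lemma linear_bracket_bracket: "linear (\<lambda>b. bracket G X (bracket G Y b))"
  using linear_compose[OF linear_bracket[of Y] linear_bracket[of X]] by (simp add: comp_def)

text \<open>The Jacobi identity expands both sides into traces of triple products of ad; the terms
  that remain differ by a cyclic permutation under the trace.\<close>

lemma killing_invariant: "killing G (bracket G X Y) Z = - killing G Y (bracket G X Z)"
proof -
  let ?t = "\<lambda>A. \<Sum>b\<in>Basis. A b \<bullet> (b::'a)"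
  let ?b = "bracket G"
  have j: "?b (?b X Y) W = ?b X (?b Y W) - ?b Y (?b X W)" for X Y W
    using jacobi[of X Y W] by simp
  have 1: "killing G (?b X Y) Z = ?t (\<lambda>b. ?b X (?b Y (?b Z b))) - ?t (\<lambda>b. ?b Y (?b X (?b Z b)))"
    unfolding killing_def by (simp add: j inner_diff_left sum_subtractf)
  have 2: "killing G Y (?b X Z) = ?t (\<lambda>b. ?b Y (?b X (?b Z b))) - ?t (\<lambda>b. ?b Y (?b Z (?b X b)))"
    unfolding killing_def by (simp add: j bracket_simps inner_diff_left sum_subtractf)
  have 3: "?t (\<lambda>b. ?b X (?b Y (?b Z b))) = ?t (\<lambda>b. ?b Y (?b Z (?b X b)))"
    by (rule trace_commute[OF linear_bracket linear_bracket_bracket])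
  show ?thesis by (simp add: 1 2 3)
qed

lemma killing_automorphism:
  assumes "linear A" "bij A" "\<And>X Y. A (bracket G X Y) = bracket G (A X) (A Y)"
  shows "killing G (A X) (A Y) = killing G X Y"
proof -
  obtain B where B: "linear B" "B \<circ> A = id"
    using linear_injective_left_inverse[OF assms(1) bij_is_inj[OF assms(2)]] by auto
  have AB: "A (B W) = W" for W
    using B(2) surjD[OF bij_is_surj[OF assms(2)], of W] by (metis comp_apply id_apply)
  have BA: "B (A W) = W" for W using B(2) by (metis comp_apply id_apply)
  have l: "linear (\<lambda>b. bracket G X (bracket G Y (B b)))"
    using linear_compose[OF B(1) linear_bracket_bracket, of X Y] by (simp add: comp_def)
  have "killing G (A X) (A Y) = (\<Sum>b\<in>Basis. A (bracket G X (bracket G Y (B b))) \<bullet> b)"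
    unfolding killing_def by (simp add: assms(3) AB)
  also have "\<dots> = killing G X Y"
    unfolding killing_def by (subst trace_commute[OF assms(1) l]) (simp add: BA)
  finally show ?thesis .
qed

end

locale killing_lie_group = lie_group G for G :: "('g::{t2_space, second_countable_topology}, 'a::euclidean_space, real^'m) lie_data"
    (structure) +
  assumes killing_metric: "killing_metric G"
begin

lemma inner_killing: "\<exists>c. \<forall>X Y. X \<bullet> Y = - c * killing G X Y"
  using killing_metric by (auto simp: killing_metric_def)

lemma inner_bracket: "bracket G X Y \<bullet> Z = - (Y \<bullet> bracket G X Z)"
proof -
  obtain c where "\<And>X Y. X \<bullet> Y = - c * killing G X Y" using inner_killing by metis
  then show ?thesis by (simp only: killing_invariant)
qed

lemma inner_automorphism:
  assumes "linear A" "bij A" "\<And>X Y. A (bracket G X Y) = bracket G (A X) (A Y)"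
  shows "A X \<bullet> A Y = X \<bullet> Y"
proof -
  obtain c where "\<And>X Y. X \<bullet> Y = - c * killing G X Y" using inner_killing by metis
  then show ?thesis by (simp only: killing_automorphism[OF assms])
qed

lemma bij_Ad: "bij (Ad G g)"
proof (rule o_bij)
  show "Ad G (inv g) \<circ> Ad G g = id" "Ad G g \<circ> Ad G (inv g) = id" by (simp_all add: fun_eq_iff)
qed

lemma Ad_inner [simp]: "Ad G g X \<bullet> Ad G g Y = X \<bullet> Y"
  by (rule inner_automorphism[of "Ad G g", OF linear_Ad bij_Ad Ad_bracket])

end

section \<open>The invariant volume\<close>

text \<open>The change of variables formula of the library is restricted to index types of class
  \<open>wellorder\<close>; a well-ordered copy of an arbitrary finite type carries it over.\<close>

typedef 'a wo = "UNIV :: 'a set" by simp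

lemma bij_Rep_wo: "bij (Rep_wo :: 'a wo \<Rightarrow> 'a)"
proof (rule bijI)
  show "inj (Rep_wo :: 'a wo \<Rightarrow> 'a)" by (simp add: inj_on_def Rep_wo_inject)
  show "surj (Rep_wo :: 'a wo \<Rightarrow> 'a)" by (rule surjI[of _ Abs_wo]) (simp add: Abs_wo_inverse)
qed

instance wo :: (finite) finite
proof
  show "finite (UNIV :: 'a wo set)"
    using bij_Rep_wo by (metis bij_betw_finite finite)
qed

instantiation wo :: (finite) wellorder
begin

definition less_eq_wo :: "'a wo \<Rightarrow> 'a wo \<Rightarrow> bool" where
  "less_eq_wo x y \<longleftrightarrow> to_nat (Rep_wo x) \<le> to_nat (Rep_wo y)"

definition less_wo :: "'a wo \<Rightarrow> 'a wo \<Rightarrow> bool" where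
  "less_wo x y \<longleftrightarrow> to_nat (Rep_wo x) < to_nat (Rep_wo y)"

instance
proof
  fix x y z :: "'a wo"
  show "x = y" if "x \<le> y" "y \<le> x"
    using that by (simp add: less_eq_wo_def Rep_wo_inject)
  show "P a" if "\<And>x. (\<And>y. y < x \<Longrightarrow> P y) \<Longrightarrow> P x" for P :: "'a wo \<Rightarrow> bool" and a
    by (rule measure_induct_rule[of "\<lambda>x. to_nat (Rep_wo x)"]) (rule that, simp add: less_wo_def)
qed (auto simp: less_eq_wo_def less_wo_def)

end

text \<open>Conjugation by \<open>f\<close> matches the permutations of the two index sets and
  preserves signs, so the Leibniz expansions agree term by term.\<close>

lemma det_reindex:
  fixes A :: "'a::comm_ring_1^'n^'n" and f :: "'k::finite \<Rightarrow> 'n"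
  assumes f: "bij f"
  shows "det (\<chi> i j. A $ f i $ f j) = det A"
proof -
  have sub: "f (inv_into UNIV f x) = x" "inv_into UNIV f (f y) = y" for x y
    using f by (simp_all add: bij_is_surj surj_f_inv_f bij_is_inj)
  have "det (\<chi> i j. A $ f i $ f j) =
     (\<Sum>p | p permutes UNIV. of_int (sign p) * (\<Prod>i\<in>UNIV. A $ f i $ f (p i)))"
    by (simp add: det_def)
  also have "\<dots> = (\<Sum>p | p permutes UNIV. of_int (sign p) * (\<Prod>i\<in>UNIV. A $ i $ p i))"
  proof (rule sum.reindex_bij_witness[of _ "\<lambda>p. inv_into UNIV f \<circ> p \<circ> f" "map_permutation UNIV f"])
    fix p :: "'k \<Rightarrow> 'k" assume "p \<in> {p. p permutes UNIV}"
    then have p: "p permutes UNIV" by simp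
    have m: "map_permutation UNIV f p = f \<circ> p \<circ> inv_into UNIV f"
      using f by (simp add: map_permutation_def fun_eq_iff bij_is_surj)
    show "inv_into UNIV f \<circ> map_permutation UNIV f p \<circ> f = p" by (simp add: m fun_eq_iff sub)
    have "bij (f \<circ> p \<circ> inv_into UNIV f)"
      using f permutes_bij[OF p] by (intro bij_comp bij_imp_bij_inv) auto
    then show "map_permutation UNIV f p \<in> {p. p permutes UNIV}"
      unfolding m by (auto intro: bij_imp_permutes)
    have "(\<Prod>i\<in>UNIV. A $ i $ (f \<circ> p \<circ> inv_into UNIV f) i) = (\<Prod>i\<in>UNIV. A $ f i $ f (p i))"
      by (rule prod.reindex_bij_witness[of _ f "inv_into UNIV f"]) (simp_all add: sub)
    moreover have "sign (map_permutation UNIV f p) = sign p"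
      by (rule sign_map_permutation) (use f p in \<open>auto simp: bij_is_inj\<close>)
    ultimately show "of_int (sign (map_permutation UNIV f p)) * (\<Prod>i\<in>UNIV. A $ i $ map_permutation UNIV f p i)
       = of_int (sign p) * (\<Prod>i\<in>UNIV. A $ f i $ f (p i))" by (simp add: m)
  next
    fix p :: "'n \<Rightarrow> 'n" assume "p \<in> {p. p permutes UNIV}"
    then have p: "p permutes UNIV" by simp
    show "map_permutation UNIV f (inv_into UNIV f \<circ> p \<circ> f) = p"
      using f by (simp add: map_permutation_def fun_eq_iff bij_is_surj sub)
    have "bij (inv_into UNIV f \<circ> p \<circ> f)"
      using f permutes_bij[OF p] by (intro bij_comp bij_imp_bij_inv) auto
    then show "inv_into UNIV f \<circ> p \<circ> f \<in> {p. p permutes UNIV}" by (auto intro: bij_imp_permutes)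
  qed
  finally show ?thesis by (simp add: det_def)
qed

definition reindex :: "('k \<Rightarrow> 'n) \<Rightarrow> real^'n \<Rightarrow> real^'k" where
  "reindex f x = (\<chi> i. x $ f i)"

lemma linear_reindex: "linear (reindex f)"
  by (rule linearI) (simp_all add: reindex_def vec_eq_iff)

lemma reindex_inv:
  assumes "bij f"
  shows "reindex f (reindex (inv_into UNIV f) x) = x" "reindex (inv_into UNIV f) (reindex f y) = y"
  using assms by (simp_all add: reindex_def vec_eq_iff bij_is_surj surj_f_inv_f bij_is_inj)

lemma borel_measurable_reindex [measurable]: "reindex f \<in> borel_measurable borel"
  by (intro borel_measurable_continuous_onI linear_continuous_on)
    (use linear_reindex linear_conv_bounded_linear in blast)

lemma lborel_distr_reindex:
  fixes f :: "'k::finite \<Rightarrow> 'n::finite"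
  assumes f: "bij f"
  shows "distr lborel borel (reindex f) = (lborel :: (real^'k) measure)"
proof (rule lborel_eqI[symmetric])
  fix l u :: "real^'k" assume "\<And>b. b \<in> Basis \<Longrightarrow> l \<bullet> b \<le> u \<bullet> b"
  then have le: "l $ i \<le> u $ i" for i by (metis axis_in_Basis_iff cart_eq_inner_axis Basis_real_def singletonI)
  have sub: "f (inv_into UNIV f x) = x" for x using f by (simp add: bij_is_surj surj_f_inv_f)
  have B: "(\<Prod>b\<in>Basis. v \<bullet> b) = (\<Prod>i\<in>UNIV. v $ i)" for v :: "real^'d::finite"
    by (simp add: Basis_vec_def UNION_singleton_eq_range prod.reindex inj_on_def axis_eq_axis cart_eq_inner_axis[symmetric] inner_axis)
  have pre: "reindex f -` box l u = box (reindex (inv_into UNIV f) l) (reindex (inv_into UNIV f) u)"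
  proof -
    have "(\<forall>i. l $ i < x $ f i \<and> x $ f i < u $ i) \<longleftrightarrow> (\<forall>j. l $ inv_into UNIV f j < x $ j \<and> x $ j < u $ inv_into UNIV f j)" for x :: "real^'n"
      using sub f by (metis bij_inv_eq_iff)
    then show ?thesis by (auto simp: mem_box_cart reindex_def)
  qed
  have "emeasure (distr lborel borel (reindex f)) (box l u) = emeasure lborel (box (reindex (inv_into UNIV f) l) (reindex (inv_into UNIV f) u))"
    by (subst emeasure_distr) (simp_all add: pre)
  also have "\<dots> = (\<Prod>b\<in>Basis. (reindex (inv_into UNIV f) u - reindex (inv_into UNIV f) l) \<bullet> b)"
  proof (rule emeasure_lborel_box)
    show "reindex (inv_into UNIV f) l \<bullet> b \<le> reindex (inv_into UNIV f) u \<bullet> b" if "b \<in> Basis" for b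
      using that le by (auto simp: Basis_vec_def inner_axis reindex_def)
  qed
  also have "(\<Prod>b\<in>Basis. (reindex (inv_into UNIV f) u - reindex (inv_into UNIV f) l) \<bullet> b) = (\<Prod>b\<in>Basis. (u - l) \<bullet> b)"
    unfolding B
    by (rule prod.reindex_bij_witness[of _ f "inv_into UNIV f"]) (use f in \<open>auto simp: reindex_def sub bij_is_inj\<close>)
  finally show "emeasure (distr lborel borel (reindex f)) (box l u) = (\<Prod>b\<in>Basis. (u - l) \<bullet> b)" .
qed simp

lemma nn_integral_absolutely_integrable:
  fixes f :: "'a::euclidean_space \<Rightarrow> real"
  assumes "f absolutely_integrable_on S" "\<And>x. x \<in> S \<Longrightarrow> 0 \<le> f x"
  shows "(\<integral>\<^sup>+ x. ennreal (f x) * indicator S x \<partial>lborel) = ennreal (integral S f)"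
proof -
  have "(\<integral>\<^sup>+ x. ennreal (f x) * indicator S x \<partial>lborel) = (\<integral>\<^sup>+ x. ennreal (indicator S x *\<^sub>R f x) \<partial>lebesgue)"
    unfolding nn_integral_completion by (rule nn_integral_cong) (simp split: split_indicator)
  also have "\<dots> = ennreal (integral\<^sup>L lebesgue (\<lambda>x. indicator S x *\<^sub>R f x))"
    by (rule nn_integral_eq_integral)
      (use assms in \<open>auto simp: set_integrable_def split: split_indicator\<close>)
  also have "integral\<^sup>L lebesgue (\<lambda>x. indicator S x *\<^sub>R f x) = integral S f"
    using set_lebesgue_integral_eq_integral(2)[OF assms(1)] by (simp add: set_lebesgue_integral_def)
  finally show ?thesis .
qed

text \<open>On the compact set \<open>L\<close> the transformed density is continuous, hence
  integrable, and so it is over the Borel subset \<open>S\<close>. The change of variables for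
  absolutely integrable functions, applied with values in \<open>real^1\<close>, then gives the
  equality of nonnegative integrals.\<close>

lemma nn_integral_change_of_variables_wo:
  fixes T :: "real^'m::{finite,wellorder} \<Rightarrow> real^'m::_" and \<rho> :: "real^'m::_ \<Rightarrow> real"
  assumes S: "S \<in> sets borel" and L: "compact L" "S \<subseteq> L"
    and T: "\<And>x. x \<in> L \<Longrightarrow> (T has_derivative T' x) (at x)" and inj: "inj_on T L"
    and pos: "\<And>x. x \<in> L \<Longrightarrow> 0 \<le> \<rho> (T x)"
    and cont: "continuous_on L (\<lambda>x. \<bar>det (matrix (T' x))\<bar> * \<rho> (T x))"
  shows "(\<integral>\<^sup>+ y. ennreal (\<rho> y) * indicator (T ` S) y \<partial>lborel) =
     (\<integral>\<^sup>+ x. ennreal (\<bar>det (matrix (T' x))\<bar> * \<rho> (T x)) * indicator S x \<partial>lborel)"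
proof -
  let ?g = "\<lambda>x. \<bar>det (matrix (T' x))\<bar> * \<rho> (T x)"
  have Sl: "S \<in> sets lebesgue" using S by simp
  have der: "(T has_derivative T' x) (at x within S)" if "x \<in> S" for x
    using T L(2) that has_derivative_at_withinI by blast
  have injS: "inj_on T S" using inj L(2) by (rule inj_on_subset)
  obtain B where B: "\<And>x. x \<in> L \<Longrightarrow> norm (?g x) \<le> B"
    using compact_imp_bounded[OF compact_continuous_image[OF cont L(1)]] by (force simp: bounded_iff)
  have Lb: "L \<in> sets borel" using L(1) by (simp add: borel_compact)
  have "set_integrable lborel L ?g"
    using borel_integrable_compact[OF L(1) cont] by (simp add: set_integrable_def mult.commute indicator_scaleR_eq_if if_distrib cong: if_cong)
  then have "set_integrable lborel S ?g"
    by (rule set_integrable_subset) (use S L in auto)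
  then have g: "?g absolutely_integrable_on S"
    unfolding set_integrable_def using integrable_completion[of "\<lambda>x. indicator S x *\<^sub>R ?g x" lborel]
    by (metis (no_types, lifting) borel_measurable_integrable)
  have "(\<lambda>x. \<bar>det (matrix (T' x))\<bar> *\<^sub>R vec (\<rho> (T x)) :: real^1) absolutely_integrable_on S \<and>
      integral S (\<lambda>x. \<bar>det (matrix (T' x))\<bar> *\<^sub>R vec (\<rho> (T x)) :: real^1) = vec b
     \<longleftrightarrow> (\<lambda>y. vec (\<rho> y) :: real^1) absolutely_integrable_on (T ` S) \<and> integral (T ` S) (\<lambda>y. vec (\<rho> y)) = (vec b :: real^1)" for b
    by (rule has_absolute_integral_change_of_variables[OF Sl der injS])
  moreover have "\<bar>det (matrix (T' x))\<bar> *\<^sub>R vec (\<rho> (T x)) = (vec (?g x) :: real^1)" for x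
    by (simp add: vec_eq_iff)
  ultimately have cov: "?g absolutely_integrable_on S \<and> integral S ?g = b
     \<longleftrightarrow> \<rho> absolutely_integrable_on (T ` S) \<and> integral (T ` S) \<rho> = b" for b
    by (simp add: absolutely_integrable_on_1_iff integral_on_1_eq)
  have r: "\<rho> absolutely_integrable_on (T ` S)" "integral (T ` S) \<rho> = integral S ?g"
    using cov[of "integral S ?g"] g by auto
  have "(\<integral>\<^sup>+ y. ennreal (\<rho> y) * indicator (T ` S) y \<partial>lborel) = ennreal (integral (T ` S) \<rho>)"
    by (rule nn_integral_absolutely_integrable[OF r(1)]) (use pos L in auto)
  also have "\<dots> = (\<integral>\<^sup>+ x. ennreal (?g x) * indicator S x \<partial>lborel)"
    unfolding r(2) by (rule nn_integral_absolutely_integrable[OF g, symmetric]) (use pos L in auto)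
  finally show ?thesis .
qed

text \<open>Relabelling the coordinates on both sides of \<open>T\<close> alters neither Lebesgue
  measure (\<open>lborel_distr_reindex\<close>) nor the Jacobian determinant
  (\<open>det_reindex\<close>).\<close>

lemma nn_integral_change_of_variables:
  fixes T :: "real^'m \<Rightarrow> real^'m" and \<rho> :: "real^'m \<Rightarrow> real"
  assumes S: "S \<in> sets borel" and L: "compact L" "S \<subseteq> L"
    and T: "\<And>x. x \<in> L \<Longrightarrow> (T has_derivative T' x) (at x)" and inj: "inj_on T L"
    and pos: "\<And>x. x \<in> L \<Longrightarrow> 0 \<le> \<rho> (T x)"
    and cont: "continuous_on L (\<lambda>x. \<bar>det (matrix (T' x))\<bar> * \<rho> (T x))"
    and m1: "(\<lambda>y. ennreal (\<rho> y) * indicator (T ` S) y) \<in> borel_measurable borel"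
    and m2: "(\<lambda>x. ennreal (\<bar>det (matrix (T' x))\<bar> * \<rho> (T x)) * indicator S x) \<in> borel_measurable borel"
  shows "(\<integral>\<^sup>+ y. ennreal (\<rho> y) * indicator (T ` S) y \<partial>lborel) =
     (\<integral>\<^sup>+ x. ennreal (\<bar>det (matrix (T' x))\<bar> * \<rho> (T x)) * indicator S x \<partial>lborel)"
proof -
  let ?r = "Rep_wo :: 'm wo \<Rightarrow> 'm"
  let ?f = "reindex ?r" and ?h = "reindex (inv_into UNIV ?r)"
  note fh = reindex_inv[OF bij_Rep_wo[where 'a = 'm]]
  have lf: "bounded_linear ?f" and lh: "bounded_linear ?h"
    using linear_reindex linear_conv_bounded_linear by blast+
  let ?T = "\<lambda>z. ?f (T (?h z))" and ?T' = "\<lambda>z w. ?f (T' (?h z) (?h w))"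
  have M: "det (matrix (?T' z)) = det (matrix (T' (?h z)))" for z
  proof -
    have "?h (axis i 1) = axis (?r i) 1" for i
      using bij_Rep_wo[where 'a='m] by (auto simp: reindex_def axis_def vec_eq_iff bij_is_inj bij_is_surj surj_f_inv_f)
    then have "matrix (?T' z) = (\<chi> i j. matrix (T' (?h z)) $ ?r i $ ?r j)"
      by (simp add: matrix_def reindex_def vec_eq_iff)
    then show ?thesis by (simp add: det_reindex[OF bij_Rep_wo])
  qed
  have der: "(?T has_derivative ?T' z) (at z)" if "z \<in> ?f ` L" for z
  proof -
    have "?h z \<in> L" using that fh by auto
    from has_derivative_compose[OF bounded_linear_imp_has_derivative[OF lh] T[OF this]]
    show ?thesis by (rule bounded_linear.has_derivative[OF lf])
  qed
  have cf: "continuous_on A ?f" and ch: "continuous_on B ?h" for A B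
    using lf lh linear_continuous_on by blast+
  have im: "?f ` A = ?h -` A" for A
  proof
    show "?h -` A \<subseteq> ?f ` A" by (metis fh(1) image_eqI subsetI vimageE)
  qed (auto simp: fh)
  have "?T ` ?f ` S = ?f ` (T ` S)" by (simp add: image_image fh)
  then have img: "?f ` S = ?h -` S" "?T ` ?f ` S = ?h -` (T ` S)" by (simp_all only: im)
  have *: "(\<integral>\<^sup>+ y. ennreal (\<rho> (?h y)) * indicator (?T ` ?f ` S) y \<partial>lborel) =
     (\<integral>\<^sup>+ x. ennreal (\<bar>det (matrix (?T' x))\<bar> * \<rho> (?h (?T x))) * indicator (?f ` S) x \<partial>lborel)"
  proof (rule nn_integral_change_of_variables_wo[where L = "?f ` L" and \<rho> = "\<lambda>y. \<rho> (?h y)"])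
    show "?f ` S \<in> sets borel"
      unfolding img using measurable_sets[OF borel_measurable_reindex S, of "inv_into UNIV ?r"] by simp
    show "compact (?f ` L)" by (rule compact_continuous_image[OF cf L(1)])
    show "?f ` S \<subseteq> ?f ` L" using L(2) by auto
    show "inj_on ?T (?f ` L)"
    proof (rule inj_onI)
      fix x y assume "x \<in> ?f ` L" "y \<in> ?f ` L" and e: "?T x = ?T y"
      then obtain a b where ab: "a \<in> L" "b \<in> L" "x = ?f a" "y = ?f b" by auto
      from e have "?h (?T x) = ?h (?T y)" by simp
      then have "T a = T b" by (simp add: ab fh)
      then have "a = b" by (rule inj_onD[OF inj _ ab(1,2)])
      then show "x = y" by (simp add: ab)
    qed
    show "0 \<le> \<rho> (?h (?T x))" if "x \<in> ?f ` L" for x using that pos fh by auto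
    have "continuous_on (?f ` L) (\<lambda>z. \<bar>det (matrix (T' (?h z)))\<bar> * \<rho> (T (?h z)))"
      by (rule continuous_on_compose2[OF cont ch]) (use fh in auto)
    then show "continuous_on (?f ` L) (\<lambda>x. \<bar>det (matrix (?T' x))\<bar> * \<rho> (?h (?T x)))"
      by (simp add: M fh)
  qed (rule der)
  have tr: "(\<integral>\<^sup>+ y. F y \<partial>lborel) = (\<integral>\<^sup>+ z. F (?h z) \<partial>lborel)" if "F \<in> borel_measurable borel" for F :: "real^'m \<Rightarrow> ennreal"
  proof -
    have "(\<integral>\<^sup>+ y. F y \<partial>lborel) = (\<integral>\<^sup>+ y. F y \<partial>distr lborel borel ?h)"
      by (simp only: lborel_distr_reindex[OF bij_imp_bij_inv[OF bij_Rep_wo]])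
    also have "\<dots> = (\<integral>\<^sup>+ z. F (?h z) \<partial>lborel)"
      by (rule nn_integral_distr) (use that in auto)
    finally show ?thesis .
  qed
  have i1: "(indicator (?f ` S) z :: ennreal) = indicator S (?h z)" for z
    unfolding img(1) by (simp add: indicator_def)
  have i2: "(indicator (?T ` ?f ` S) z :: ennreal) = indicator (T ` S) (?h z)" for z
    unfolding img(2) by (simp add: indicator_def)
  show ?thesis
    unfolding tr[OF m1] tr[OF m2] using * unfolding i1 i2 by (simp add: M fh)
qed

section \<open>Left trivialisation and the volume density in a chart\<close>

lemma linear_inverse_same_dim:
  fixes A :: "'a::euclidean_space \<Rightarrow> 'b::euclidean_space"
  assumes "linear A" "linear B" "\<And>x. B (A x) = x" "DIM('a) = DIM('b)"
  shows "A (B y) = y"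
proof -
  obtain h :: "'b \<Rightarrow> 'a" and k where hk: "linear h" "linear k" "\<And>x. k (h x) = x" "\<And>y. h (k y) = y"
    using isomorphisms_UNIV_UNIV[of, where 'M = 'b and 'N = 'a] assms(4) by metis
  have "inj (\<lambda>x. A (h x))"
    by (rule injI) (metis assms(3) hk(3))
  then have "surj (\<lambda>x. A (h x))"
    using linear_injective_imp_surjective[OF linear_compose[OF hk(1) assms(1), unfolded comp_def]] by blast
  then obtain x where "y = A (h x)" by (metis surjD)
  then show ?thesis by (simp add: assms(3))
qed

context lie_group
begin

lemma dim_lie_algebra: "DIM('a) = CARD('m)"
proof -
  obtain U c and D :: "'a \<Rightarrow> real^'m" where "linear D" "bij D" by (rule identity_chart)
  then have "dim (D ` UNIV) = dim (UNIV :: 'a set)"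
    by (intro dim_image_eq) (auto simp: bij_is_inj)
  then show ?thesis using \<open>bij D\<close> by (simp add: bij_is_surj)
qed

lemma chart_exp_smooth:
  assumes c: "(U, c) \<in> atlas G"
  shows "open {v. g \<otimes> lie_exp G v \<in> U}" "smooth_on {v. g \<otimes> lie_exp G v \<in> U} (\<lambda>v. c (g \<otimes> lie_exp G v))"
proof -
  have p: "plot UNIV (\<lambda>v. g \<otimes> lie_exp G v)" by (intro plot_mult plot_const plot_exp) auto
  show o: "open {v. g \<otimes> lie_exp G v \<in> U}"
    using open_vimage[OF top_atlas_chart(1)[OF top_atlas_G c] plot_continuous_on[OF p]] by (simp add: vimage_def)
  show "smooth_on {v. g \<otimes> lie_exp G v \<in> U} (\<lambda>v. c (g \<otimes> lie_exp G v))"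
    by (rule plot_chart_compose[OF c plot_subset[OF p o]]) auto
qed

definition chart_log :: "'g set \<Rightarrow> ('g \<Rightarrow> real^'m) \<Rightarrow> 'g \<Rightarrow> real^'m \<Rightarrow> 'a" where
  "chart_log U c g y = logf (inv g \<otimes> inv_into U c y)"

text \<open>Let A be the differential at 0 of v -> c (g exp(v)). The differential of
  \<open>chart_log\<close> is a left inverse of A because \<open>logf\<close> inverts exp to first
  order; since the dimensions agree it is a two-sided inverse, which settles existence and
  uniqueness in the description of \<open>left_triv\<close>.\<close>

lemma left_triv_eq:
  assumes c: "(U, c) \<in> atlas G" and g: "g \<in> U"
  shows "left_triv G c g = frechet_derivative (chart_log U c g) (at (c g))" (is "_ = ?T")
    and "((\<lambda>t. c (g \<otimes> lie_exp G (t *\<^sub>R left_triv G c g w))) has_vector_derivative w) (at 0)"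
    and "((\<lambda>t. c (g \<otimes> lie_exp G (t *\<^sub>R X))) has_vector_derivative w) (at 0) \<Longrightarrow> left_triv G c g w = X"
    and "linear (left_triv G c g)"
proof -
  note C = top_atlas_chart[OF top_atlas_G c]
  note e = chart_exp_smooth[OF c, of g]
  let ?A = "frechet_derivative (\<lambda>v. c (g \<otimes> lie_exp G v)) (at 0)"
  have A: "((\<lambda>t. c (g \<otimes> lie_exp G (t *\<^sub>R X))) has_vector_derivative ?A X) (at 0)" for X
    using smooth_on_has_vector_derivative_line[OF e(2), of 0 0 X] g by simp
  have lA: "linear ?A"
    by (rule has_derivative_linear[OF smooth_on_has_derivative[OF e(2)]]) (use g in simp)
  have "smooth_on (c ` U) (chart_log U c g)" unfolding chart_log_def
    by (rule smooth_fun_plot[OF smooth_fun_left[OF logf(1)] plot_chart[OF c]])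
  then have T: "(chart_log U c g has_derivative ?T) (at (c g))"
    by (rule smooth_on_has_derivative) (use g in auto)
  have lT: "linear ?T" by (rule has_derivative_linear[OF T])
  have TA: "?T (?A X) = X" for X
  proof -
    have "((\<lambda>t. chart_log U c g (c (g \<otimes> lie_exp G (t *\<^sub>R X)))) has_derivative (\<lambda>h. ?T (h *\<^sub>R ?A X))) (at 0)"
      by (rule has_derivative_compose[OF A[unfolded has_vector_derivative_def]]) (simp add: T)
    then have 1: "((\<lambda>t. chart_log U c g (c (g \<otimes> lie_exp G (t *\<^sub>R X)))) has_vector_derivative ?T (?A X)) (at 0)"
      by (simp add: has_vector_derivative_def linear_scale[OF lT])
    have o: "open {t :: real. g \<otimes> lie_exp G (t *\<^sub>R X) \<in> U}"
    proof -
      have "continuous_on UNIV (\<lambda>t :: real. t *\<^sub>R X)" by (intro continuous_intros)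
      from open_vimage[OF e(1) this] show ?thesis by (simp add: vimage_def)
    qed
    have "((\<lambda>t. logf (\<one> \<otimes> lie_exp G (t *\<^sub>R X))) has_vector_derivative ?T (?A X)) (at 0)"
      by (rule has_vector_derivative_transform_within_open[OF 1 o])
        (use g in \<open>auto simp: chart_log_def C(6) m_assoc[symmetric]\<close>)
    then show ?thesis
      using lder_has_vector_derivative[OF logf(1), of \<one> X] logf(3) vector_derivative_unique_at by metis
  qed
  have AT: "?A (?T w) = w" for w
    by (rule linear_inverse_same_dim[OF lA lT TA]) (simp add: dim_lie_algebra)
  show eq: "left_triv G c g = ?T"
  proof
    fix w show "left_triv G c g w = ?T w" unfolding left_triv_def
    proof (rule the_equality)
      show "((\<lambda>t. c (g \<otimes> lie_exp G (t *\<^sub>R ?T w))) has_vector_derivative w) (at 0)"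
        using A[of "?T w"] by (simp add: AT)
      fix X assume "((\<lambda>t. c (g \<otimes> lie_exp G (t *\<^sub>R X))) has_vector_derivative w) (at 0)"
      then have "?A X = w" using A vector_derivative_unique_at by blast
      then show "X = ?T w" using TA by metis
    qed
  qed
  show "((\<lambda>t. c (g \<otimes> lie_exp G (t *\<^sub>R left_triv G c g w))) has_vector_derivative w) (at 0)"
    using A[of "?T w"] by (simp add: AT eq)
  show "left_triv G c g w = X" if "((\<lambda>t. c (g \<otimes> lie_exp G (t *\<^sub>R X))) has_vector_derivative w) (at 0)"
    unfolding eq using that A vector_derivative_unique_at TA by metis
  show "linear (left_triv G c g)" by (simp add: eq lT)
qed

text \<open>Here the base point moves too. The trivialisation is therefore written as a partial
  derivative, taken on the diagonal, of one smooth function of two points: \<open>logf\<close> of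
  the first inverse times the second.\<close>

lemma left_triv_continuous:
  assumes c: "(U, c) \<in> atlas G"
  shows "continuous_on (c ` U) (\<lambda>y. left_triv G c (inv_into U c y) w)"
proof -
  note C = top_atlas_chart[OF top_atlas_G c]
  have o: "open (c ` U \<times> c ` U)" by (rule open_Times[OF C(2) C(2)])
  let ?H = "\<lambda>z. logf (inv (inv_into U c (fst z)) \<otimes> inv_into U c (snd z))"
  have H: "smooth_on (c ` U \<times> c ` U) ?H"
    by (rule smooth_fun_plot[OF logf(1)], intro plot_mult plot_inv plot_compose[OF plot_chart[OF c]] smooth_on_fst
      smooth_on_snd smooth_on_id o) auto
  have eq: "left_triv G c (inv_into U c y) w = frechet_derivative ?H (at (y, y)) (0, w)" if y: "y \<in> c ` U" for y
  proof -
    have g: "inv_into U c y \<in> U" "c (inv_into U c y) = y" using y C(6) by auto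
    have h: "smooth_on (c ` U) (chart_log U c (inv_into U c y))" unfolding chart_log_def
      by (rule smooth_fun_plot[OF smooth_fun_left[OF logf(1)] plot_chart[OF c]])
    have "((\<lambda>t. ?H ((y, y) + t *\<^sub>R (0, w))) has_vector_derivative frechet_derivative ?H (at (y, y)) (0, w)) (at 0)"
      using smooth_on_has_vector_derivative_line[OF H, of "(y, y)" 0 "(0, w)"] y by simp
    moreover have "((\<lambda>t. chart_log U c (inv_into U c y) (y + t *\<^sub>R w)) has_vector_derivative left_triv G c (inv_into U c y) w) (at 0)"
      using smooth_on_has_vector_derivative_line[OF h, of y 0 w] y by (simp add: left_triv_eq(1)[OF c g(1)] g(2))
    ultimately show ?thesis by (simp add: chart_log_def vector_derivative_unique_at)
  qed
  have "continuous_on (c ` U) (\<lambda>y. frechet_derivative ?H (at (y, y)) (0, w))"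
    by (rule continuous_on_compose2[OF smooth_on_imp_continuous_on[OF smooth_on_frechet[OF o H]]
          continuous_on_Pair[OF continuous_on_id continuous_on_id]]) auto
  then show ?thesis by (rule continuous_on_eq) (simp add: eq)
qed

definition vol_density :: "'g set \<Rightarrow> ('g \<Rightarrow> real^'m) \<Rightarrow> real^'m \<Rightarrow> real" where
  "vol_density U c y = sqrt (det (metric_matrix G c (inv_into U c y)))"

lemma continuous_on_det:
  fixes A :: "'z::topological_space \<Rightarrow> real^'m^'m"
  assumes "\<And>i j. continuous_on S (\<lambda>x. A x $ i $ j)"
  shows "continuous_on S (\<lambda>x. det (A x))"
  unfolding det_def by (intro continuous_on_sum continuous_on_mult continuous_on_const continuous_on_prod assms)

lemma vol_density_continuous:
  assumes c: "(U, c) \<in> atlas G"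
  shows "continuous_on (c ` U) (vol_density U c)"
  unfolding vol_density_def
  by (intro continuous_on_real_sqrt continuous_on_det)
    (simp add: metric_matrix_def continuous_on_inner left_triv_continuous[OF c])

text \<open>The metric matrix is a Gram matrix; its square root is a determinant once the Lie algebra is
  identified isometrically with the chart domain.\<close>

lemma frame_isometry:
  obtains h :: "'a \<Rightarrow> real^'m" and k where "linear h" "linear k" "\<And>x y. h x \<bullet> h y = x \<bullet> y" "\<And>x y. k x \<bullet> k y = x \<bullet> y"
    "\<And>x. k (h x) = x" "\<And>y. h (k y) = y"
proof -
  obtain h :: "'a \<Rightarrow> real^'m" and k where hk: "linear h" "linear k" "\<And>x. norm (h x) = norm x" "\<And>x. norm (k x) = norm x"
     "\<And>x. k (h x) = x" "\<And>y. h (k y) = y"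
    using isomorphisms_UNIV_UNIV[where 'M = 'a and 'N = "real^'m"] dim_lie_algebra by auto
  have "f x \<bullet> f y = x \<bullet> y" if "linear f" "\<And>x. norm (f x) = norm x"
    for f :: "'p::euclidean_space \<Rightarrow> 'q::euclidean_space" and x y
    using that by (simp add: dot_norm linear_add[OF that(1), symmetric])
  then show thesis using that hk by metis
qed

lemma vol_density_det:
  fixes h :: "'a \<Rightarrow> real^'m"
  assumes c: "(U, c) \<in> atlas G" and g: "g \<in> U"
    and h: "linear h" "\<And>x y. h x \<bullet> h y = x \<bullet> y"
  shows "vol_density U c (c g) = \<bar>det (matrix (\<lambda>w. h (left_triv G c g w)))\<bar>"
proof -
  let ?B = "matrix (\<lambda>w. h (left_triv G c g w))"
  have "metric_matrix G c g = transpose ?B ** ?B"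
    by (simp add: vec_eq_iff metric_matrix_def matrix_matrix_mult_def transpose_def matrix_def h(2)[symmetric] inner_vec_def)
  then have "det (metric_matrix G c g) = (det ?B)\<^sup>2"
    by (simp add: det_mul power2_eq_square)
  then show ?thesis using top_atlas_chart(6)[OF top_atlas_G c g] by (simp add: vol_density_def)
qed

lemma vol_density_pos:
  assumes c: "(U, c) \<in> atlas G" and g: "g \<in> U"
  shows "vol_density U c (c g) > 0"
proof -
  obtain h :: "'a \<Rightarrow> real^'m" and k where h: "linear h" "linear k" "\<And>x y. h x \<bullet> h y = x \<bullet> y"
    "\<And>x. k (h x) = x" "\<And>y. h (k y) = y"
    using frame_isometry by metis
  let ?f = "\<lambda>w. h (left_triv G c g w)"
  have l: "linear ?f" using linear_compose[OF left_triv_eq(4)[OF c g] h(1)] by (simp add: comp_def)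
  have "inj (left_triv G c g)"
  proof (rule injI)
    fix w w' assume "left_triv G c g w = left_triv G c g w'"
    then show "w = w'"
      using vector_derivative_unique_at[OF left_triv_eq(2)[OF c g, of w]] left_triv_eq(2)[OF c g, of w'] by simp
  qed
  then have "inj ?f" using inj_compose[of h "left_triv G c g"] inj_on_inverseI[of UNIV k h] h(4) by (simp add: comp_def)
  then have "det (matrix ?f) \<noteq> 0" using det_nz_iff_inj[OF l] by blast
  then show ?thesis by (simp add: vol_density_det[OF c g h(1,3)])
qed


end

lemma borel_continuous_preimage:
  assumes "continuous_on S f" "S \<in> sets borel" "B \<in> sets borel"
  shows "S \<inter> f -` B \<in> sets borel"
proof -
  have "f \<in> borel_measurable (restrict_space borel S)"
    by (rule borel_measurable_continuous_on_restrict[OF assms(1)])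
  from measurable_sets[OF this assms(3)] have "f -` B \<inter> S \<in> sets (restrict_space borel S)"
    by (simp add: space_restrict_space)
  then show ?thesis using assms(2) by (simp add: sets_restrict_space_iff Int_commute)
qed

lemma ennreal_indicator_borel_measurable:
  fixes f :: "'a::topological_space \<Rightarrow> real"
  assumes "continuous_on A f" "A \<in> sets borel"
  shows "(\<lambda>y. ennreal (f y) * indicator A y) \<in> borel_measurable borel"
proof -
  have "(\<lambda>y. ennreal (indicator A y *\<^sub>R f y)) \<in> borel_measurable borel"
    using borel_measurable_continuous_on_indicator[OF assms(2,1)] by measurable
  moreover have "(\<lambda>y. ennreal (indicator A y *\<^sub>R f y)) = (\<lambda>y. ennreal (f y) * indicator A y)"
    by (auto simp: fun_eq_iff split: split_indicator)
  ultimately show ?thesis by simp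
qed

context lie_group
begin

lemma borel_chart_image:
  assumes c: "(U, c) \<in> atlas G" and B: "B \<in> sets borel" "B \<subseteq> U"
  shows "c ` B \<in> sets borel"
proof -
  note C = top_atlas_chart[OF top_atlas_G c]
  have "c ` B = c ` U \<inter> inv_into U c -` B" using B C(6) by (force simp: subset_iff)
  then show ?thesis using borel_continuous_preimage[OF C(4) _ B(1)] C(2) by simp
qed

lemma continuous_on_mult_right: "continuous_on S (\<lambda>x. x \<otimes> h)"
  using smooth_map_two_sided[of \<one> h] by (auto simp: smooth_map_on_def intro: continuous_on_subset)

lemma mult_right_image: "(\<lambda>x. x \<otimes> h) ` B = (\<lambda>x. x \<otimes> inv h) -` B"
proof
  show "(\<lambda>x. x \<otimes> inv h) -` B \<subseteq> (\<lambda>x. x \<otimes> h) ` B"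
  proof
    fix x assume "x \<in> (\<lambda>x. x \<otimes> inv h) -` B"
    moreover have "x = (x \<otimes> inv h) \<otimes> h" by (simp add: m_assoc)
    ultimately show "x \<in> (\<lambda>x. x \<otimes> h) ` B" by blast
  qed
qed (auto simp: m_assoc)

lemma borel_mult_right:
  assumes "B \<in> sets borel" shows "(\<lambda>x. x \<otimes> h) ` B \<in> sets borel"
  using borel_continuous_preimage[OF continuous_on_mult_right, of UNIV B "inv h"] assms by (simp add: mult_right_image)

lemma compact_neighbourhood:
  assumes c: "(U, c) \<in> atlas G" and x: "x \<in> U" "x \<in> N" "open N"
  obtains N' L where "open N'" "x \<in> N'" "N' \<subseteq> L" "compact L" "L \<subseteq> U \<inter> N"
proof -
  note C = top_atlas_chart[OF top_atlas_G c]
  have "open (c ` (U \<inter> N))" by (rule open_chart_image[OF top_atlas_G c x(3)])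
  then obtain r where r: "r > 0" "cball (c x) r \<subseteq> c ` (U \<inter> N)"
    using open_contains_cball x by (metis Int_iff imageI)
  show thesis
  proof (rule that)
    show "open (U \<inter> c -` ball (c x) r)" by (rule continuous_open_preimage[OF C(3,1)]) simp
    show "x \<in> U \<inter> c -` ball (c x) r" using x r by simp
    show "U \<inter> c -` ball (c x) r \<subseteq> inv_into U c ` cball (c x) r"
    proof
      fix y assume y: "y \<in> U \<inter> c -` ball (c x) r"
      then have "y = inv_into U c (c y)" "c y \<in> cball (c x) r" using C(6) by auto
      then show "y \<in> inv_into U c ` cball (c x) r" by (rule image_eqI)
    qed
    show "compact (inv_into U c ` cball (c x) r)"
      by (rule compact_continuous_image[OF continuous_on_subset[OF C(4)]]) (use r in auto)
    show "inv_into U c ` cball (c x) r \<subseteq> U \<inter> N"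
    proof
      fix y assume "y \<in> inv_into U c ` cball (c x) r"
      then obtain z where "z \<in> U \<inter> N" "y = inv_into U c (c z)" using r(2) by blast
      then show "y \<in> U \<inter> N" using C(6) by auto
    qed
  qed
qed

end

section \<open>Invariance of the volume under right translations\<close>

context killing_lie_group
begin

text \<open>Since x exp(tX) h = x h exp(t Ad(h^{-1}) X), right translation by \<open>h\<close> acts
  on left-trivialised vectors by the adjoint action of \<open>inv h\<close>. This is orthogonal, so
  in an isometric frame its matrix \<open>?Q\<close> has determinant of absolute value 1, and only
  the Jacobian of the coordinate map is left between the two densities.\<close>

lemma vol_density_transform:
  assumes c: "(U, c) \<in> atlas G" and d: "(V, d) \<in> atlas G" and x: "x \<in> U" "x \<otimes> h \<in> V"
    and T: "((\<lambda>y. d (inv_into U c y \<otimes> h)) has_derivative T') (at (c x))"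
  shows "\<bar>det (matrix T')\<bar> * vol_density V d (d (x \<otimes> h)) = vol_density U c (c x)"
proof -
  note C = top_atlas_chart[OF top_atlas_G c]
  have lT: "linear T'" by (rule has_derivative_linear[OF T])
  have key: "left_triv G d (x \<otimes> h) (T' w) = Ad G (inv h) (left_triv G c x w)" for w
  proof (rule left_triv_eq(3)[OF d x(2)])
    let ?X = "left_triv G c x w"
    have "((\<lambda>t. d (inv_into U c (c (x \<otimes> lie_exp G (t *\<^sub>R ?X))) \<otimes> h)) has_derivative (\<lambda>t. T' (t *\<^sub>R w))) (at 0)"
      by (rule has_derivative_compose[OF left_triv_eq(2)[OF c x(1), unfolded has_vector_derivative_def]]) (simp add: T)
    then have 1: "((\<lambda>t. d (inv_into U c (c (x \<otimes> lie_exp G (t *\<^sub>R ?X))) \<otimes> h)) has_vector_derivative T' w) (at 0)"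
      by (simp add: has_vector_derivative_def linear_scale[OF lT])
    have o: "open {t :: real. x \<otimes> lie_exp G (t *\<^sub>R ?X) \<in> U}"
    proof -
      have "continuous_on UNIV (\<lambda>t :: real. t *\<^sub>R ?X)" by (intro continuous_intros)
      from open_vimage[OF chart_exp_smooth(1)[OF c] this] show ?thesis by (simp add: vimage_def)
    qed
    show "((\<lambda>t. d (x \<otimes> h \<otimes> lie_exp G (t *\<^sub>R Ad G (inv h) ?X))) has_vector_derivative T' w) (at 0)"
    proof (rule has_vector_derivative_transform_within_open[OF 1 o])
      show "0 \<in> {t :: real. x \<otimes> lie_exp G (t *\<^sub>R ?X) \<in> U}" using x by simp
      fix t assume t: "t \<in> {t :: real. x \<otimes> lie_exp G (t *\<^sub>R ?X) \<in> U}"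
      have "x \<otimes> h \<otimes> lie_exp G (t *\<^sub>R Ad G (inv h) ?X) = x \<otimes> (h \<otimes> inv h) \<otimes> lie_exp G (t *\<^sub>R ?X) \<otimes> h"
        unfolding exp_Ad inv_inv[OF in_carrier] by (simp only: m_assoc in_carrier)
      then show "d (inv_into U c (c (x \<otimes> lie_exp G (t *\<^sub>R ?X))) \<otimes> h) = d (x \<otimes> h \<otimes> lie_exp G (t *\<^sub>R Ad G (inv h) ?X))"
        using t by (simp add: C(6))
    qed
  qed
  obtain f :: "'a \<Rightarrow> real^'m" and k where f: "linear f" "linear k" "\<And>x y. f x \<bullet> f y = x \<bullet> y" "\<And>x y. k x \<bullet> k y = x \<bullet> y"
    "\<And>x. k (f x) = x"
    using frame_isometry by metis
  let ?Q = "\<lambda>y. f (Ad G (inv h) (k y))"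
  let ?A = "\<lambda>w. f (left_triv G c x w)" and ?B = "\<lambda>w. f (left_triv G d (x \<otimes> h) w)"
  have lQ: "linear ?Q"
    using linear_compose[OF linear_compose[OF f(2) linear_Ad] f(1)] by (simp add: comp_def)
  have lA: "linear ?A" using linear_compose[OF left_triv_eq(4)[OF c x(1)] f(1)] by (simp add: comp_def)
  have lB: "linear ?B" using linear_compose[OF left_triv_eq(4)[OF d x(2)] f(1)] by (simp add: comp_def)
  have "orthogonal_transformation ?Q"
    using lQ by (simp add: orthogonal_transformation_def f)
  then have "\<bar>det (matrix ?Q)\<bar> = 1"
    using orthogonal_transformation_matrix det_orthogonal_matrix by fastforce
  moreover have "matrix ?B ** matrix T' = matrix ?Q ** matrix ?A"
    using matrix_compose[OF lT lB] matrix_compose[OF lA lQ] by (simp add: comp_def key f)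
  then have "det (matrix ?B) * det (matrix T') = det (matrix ?Q) * det (matrix ?A)"
    by (metis det_mul)
  then have "\<bar>det (matrix ?B)\<bar> * \<bar>det (matrix T')\<bar> = \<bar>det (matrix ?Q)\<bar> * \<bar>det (matrix ?A)\<bar>"
    by (metis abs_mult)
  ultimately show ?thesis
    by (simp add: vol_density_det[OF c x(1) f(1,3)] vol_density_det[OF d x(2) f(1,3)] mult.commute)
qed

end

locale riemannian_lie_group = killing_lie_group G for G :: "('g::{t2_space, second_countable_topology}, 'a::euclidean_space, real^'m) lie_data"
    (structure) +
  fixes \<mu> :: "'g measure"
  assumes volume: "riemannian_volume G \<mu>" and compact_G: "compact (UNIV :: 'g set)"
begin

lemma sets_volume [simp, measurable_cong]: "sets \<mu> = sets borel"
  using volume by (simp add: riemannian_volume_def)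

lemma space_volume [simp]: "space \<mu> = UNIV"
  using sets_eq_imp_space_eq[OF sets_volume] by simp

lemma emeasure_chart:
  assumes "(U, c) \<in> atlas G" "B \<in> sets borel" "B \<subseteq> U"
  shows "emeasure \<mu> B = (\<integral>\<^sup>+ y. ennreal (vol_density U c y) * indicator (c ` B) y \<partial>lborel)"
  using volume assms by (auto simp: riemannian_volume_def vol_density_def)

text \<open>A change of variables within one pair of charts: on \<open>L\<close> the Jacobian turns
  the density at the translated point into the density at the point itself, by
  \<open>vol_density_transform\<close>.\<close>

lemma emeasure_translate_local:
  assumes c: "(U, c) \<in> atlas G" and d: "(V, d) \<in> atlas G"
    and L: "compact L" "L \<subseteq> U" "\<And>x. x \<in> L \<Longrightarrow> x \<otimes> h \<in> V" and B: "B \<in> sets borel" "B \<subseteq> L"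
  shows "emeasure \<mu> ((\<lambda>x. x \<otimes> h) ` B) = emeasure \<mu> B"
proof -
  note C = top_atlas_chart[OF top_atlas_G c] and D = top_atlas_chart[OF top_atlas_G d]
  let ?R = "\<lambda>x. x \<otimes> h"
  let ?T = "\<lambda>y. d (inv_into U c y \<otimes> h)"
  define T' where "T' y = frechet_derivative ?T (at y)" for y
  have oV: "open (?R -` V)" by (rule open_vimage[OF D(1) continuous_on_mult_right])
  have o: "open (c ` (U \<inter> ?R -` V))" by (rule open_chart_image[OF top_atlas_G c oV])
  have "smooth_on (c ` (U \<inter> ?R -` V)) ?T"
    by (rule plot_chart_compose[OF d plot_mult[OF plot_subset[OF plot_chart[OF c] o] plot_const[OF o]]])
      (use C(6) in auto)
  then have T: "(?T has_derivative T' (c x)) (at (c x))" if "x \<in> L" for x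
    unfolding T'_def by (rule smooth_on_has_derivative) (use that L in auto)
  have dens: "\<bar>det (matrix (T' (c x)))\<bar> * vol_density V d (?T (c x)) = vol_density U c (c x)" if "x \<in> L" for x
    using vol_density_transform[OF c d _ L(3)[OF that] T[OF that]] that L(2) C(6) by auto
  have RB: "?R ` B \<in> sets borel" by (rule borel_mult_right[OF B(1)])
  have RV: "?R ` B \<subseteq> V" using L(3) B(2) by auto
  have BU: "B \<subseteq> U" using B L by auto
  have im: "?T ` c ` B = d ` ?R ` B"
    unfolding image_image by (rule image_cong[OF refl]) (use BU C(6) in auto)
  have dens': "\<bar>det (matrix (T' y))\<bar> * vol_density V d (?T y) = vol_density U c y" if "y \<in> c ` L" for y
    using that dens by blast
  have "emeasure \<mu> (?R ` B) = (\<integral>\<^sup>+ y. ennreal (vol_density V d y) * indicator (?T ` c ` B) y \<partial>lborel)"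
    unfolding im by (rule emeasure_chart[OF d RB RV])
  also have "\<dots> = (\<integral>\<^sup>+ y. ennreal (\<bar>det (matrix (T' y))\<bar> * vol_density V d (?T y)) * indicator (c ` B) y \<partial>lborel)"
  proof (rule nn_integral_change_of_variables)
    show cB: "c ` B \<in> sets borel" by (rule borel_chart_image[OF c B(1) BU])
    show "compact (c ` L)" by (rule compact_continuous_image[OF continuous_on_subset[OF C(3) L(2)] L(1)])
    show "c ` B \<subseteq> c ` L" using B(2) by (rule image_mono)
    show "(?T has_derivative T' y) (at y)" if "y \<in> c ` L" for y using that T by blast
    show "inj_on ?T (c ` L)"
    proof (rule inj_onI)
      fix y z assume "y \<in> c ` L" "z \<in> c ` L" and e: "?T y = ?T z"
      then obtain a b where ab: "a \<in> L" "b \<in> L" "y = c a" "z = c b" by auto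
      moreover have "inv_into U c (c a) = a" "inv_into U c (c b) = b" using ab L(2) C(6) by blast+
      ultimately have "d (a \<otimes> h) = d (b \<otimes> h)" using e by simp
      then have "a \<otimes> h = b \<otimes> h" by (rule inj_onD[OF D(5)]) (use ab L in auto)
      then show "y = z" using ab by simp
    qed
    show "0 \<le> vol_density V d (?T y)" if "y \<in> c ` L" for y
    proof -
      obtain a where a: "a \<in> L" "y = c a" using \<open>y \<in> c ` L\<close> by auto
      then show ?thesis using vol_density_pos[OF d L(3)[OF a(1)]] L(2) C(6) by (auto intro: less_imp_le)
    qed
    have "continuous_on (c ` L) (vol_density U c)"
      by (rule continuous_on_subset[OF vol_density_continuous[OF c] image_mono[OF L(2)]])
    then show cont: "continuous_on (c ` L) (\<lambda>y. \<bar>det (matrix (T' y))\<bar> * vol_density V d (?T y))"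
      by (rule continuous_on_eq) (simp add: dens')
    show "(\<lambda>y. ennreal (vol_density V d y) * indicator (?T ` c ` B) y) \<in> borel_measurable borel"
      unfolding im
      by (rule ennreal_indicator_borel_measurable[OF continuous_on_subset[OF vol_density_continuous[OF d] image_mono[OF RV]]
            borel_chart_image[OF d RB RV]])
    show "(\<lambda>y. ennreal (\<bar>det (matrix (T' y))\<bar> * vol_density V d (?T y)) * indicator (c ` B) y) \<in> borel_measurable borel"
      by (rule ennreal_indicator_borel_measurable[OF continuous_on_subset[OF cont image_mono[OF B(2)]] cB])
  qed
  also have "\<dots> = (\<integral>\<^sup>+ y. ennreal (vol_density U c y) * indicator (c ` B) y \<partial>lborel)"
    by (rule nn_integral_cong) (use B(2) dens' in \<open>auto split: split_indicator\<close>)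
  also have "\<dots> = emeasure \<mu> B" by (rule emeasure_chart[OF c B(1) BU, symmetric])
  finally show ?thesis .
qed

lemma finite_subcover_G:
  assumes "\<And>x. \<exists>N. open N \<and> x \<in> N \<and> P N"
  obtains F where "finite F" "\<Union>F = (UNIV :: 'g set)" "\<And>N. N \<in> F \<Longrightarrow> open N \<and> P N"
proof -
  let ?C = "{N. open N \<and> P N}"
  have "UNIV \<subseteq> \<Union>?C" using assms by blast
  then obtain F where "F \<subseteq> ?C" "finite F" "UNIV \<subseteq> \<Union>F"
    using compactE[OF compact_G, of ?C] by blast
  then show thesis using that[of F] by blast
qed

text \<open>Local invariance is spread over a finite subcover by induction: a Borel set is cut into
  its part inside the newly added open set and the rest, which lies in the union of the
  others.\<close>

lemma emeasure_translate:
  assumes "B \<in> sets borel" shows "emeasure \<mu> ((\<lambda>x. x \<otimes> h) ` B) = emeasure \<mu> B"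
proof -
  let ?P = "\<lambda>N. \<forall>B\<in>sets borel. B \<subseteq> N \<longrightarrow> emeasure \<mu> ((\<lambda>x. x \<otimes> h) ` B) = emeasure \<mu> B"
  have "\<exists>N. open N \<and> x \<in> N \<and> ?P N" for x
  proof -
    obtain U c where c: "(U, c) \<in> atlas G" "x \<in> U" using top_atlas_cover[OF top_atlas_G] .
    obtain V d where d: "(V, d) \<in> atlas G" "x \<otimes> h \<in> V" using top_atlas_cover[OF top_atlas_G] .
    have "open ((\<lambda>x. x \<otimes> h) -` V)"
      by (rule open_vimage[OF top_atlas_chart(1)[OF top_atlas_G d(1)] continuous_on_mult_right])
    then obtain N L where N: "open N" "x \<in> N" "N \<subseteq> L" "compact L" "L \<subseteq> U \<inter> (\<lambda>x. x \<otimes> h) -` V"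
      using compact_neighbourhood[OF c, of "(\<lambda>x. x \<otimes> h) -` V"] d(2) by auto
    have "?P N"
      by (intro ballI impI emeasure_translate_local[OF c(1) d(1) N(4)]) (use N in auto)
    then show ?thesis using N by blast
  qed
  then obtain F where F: "finite F" "\<Union>F = (UNIV :: 'g set)" "\<And>N. N \<in> F \<Longrightarrow> open N \<and> ?P N"
    by (rule finite_subcover_G) blast
  from F(1,3) have "?P (\<Union>F)"
  proof (induction F rule: finite_induct)
    case (insert N F)
    show ?case
    proof (intro ballI impI)
      fix B :: "'g set" assume B: "B \<in> sets borel" "B \<subseteq> \<Union>(insert N F)"
      have N: "open N" "?P N" using insert.prems by auto
      have m: "B \<inter> N \<in> sets borel" "B - N \<in> sets borel" using B N by auto
      have IH: "?P (\<Union>F)" using insert by blast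
      have e: "emeasure \<mu> ((\<lambda>x. x \<otimes> h) ` (B \<inter> N)) = emeasure \<mu> (B \<inter> N)"
        "emeasure \<mu> ((\<lambda>x. x \<otimes> h) ` (B - N)) = emeasure \<mu> (B - N)"
        using mp[OF bspec[OF N(2) m(1)]] mp[OF bspec[OF IH m(2)]] B(2) by auto
      have "(\<lambda>x. x \<otimes> h) ` B = (\<lambda>x. x \<otimes> h) ` (B \<inter> N) \<union> (\<lambda>x. x \<otimes> h) ` (B - N)"
        by blast
      then have "emeasure \<mu> ((\<lambda>x. x \<otimes> h) ` B) = emeasure \<mu> ((\<lambda>x. x \<otimes> h) ` (B \<inter> N) \<union> (\<lambda>x. x \<otimes> h) ` (B - N))"
        by (rule arg_cong)
      also have "\<dots> = emeasure \<mu> ((\<lambda>x. x \<otimes> h) ` (B \<inter> N)) + emeasure \<mu> ((\<lambda>x. x \<otimes> h) ` (B - N))"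
        by (rule plus_emeasure[symmetric]) (use m borel_mult_right in auto)
      also have "\<dots> = emeasure \<mu> (B \<inter> N) + emeasure \<mu> (B - N)" by (simp only: e)
      also have "\<dots> = emeasure \<mu> ((B \<inter> N) \<union> (B - N))"
        by (rule plus_emeasure) (use m in auto)
      also have "(B \<inter> N) \<union> (B - N) = B" by blast
      finally show "emeasure \<mu> ((\<lambda>x. x \<otimes> h) ` B) = emeasure \<mu> B" .
    qed
  qed auto
  then show ?thesis using F(2) assms by blast
qed

text \<open>The density is bounded on compact neighbourhoods inside charts, and finitely many of
  these cover the group.\<close>

sublocale finite_measure \<mu>
proof
  have "\<exists>N. open N \<and> x \<in> N \<and> emeasure \<mu> N < \<infinity>" for x
  proof -
    obtain U c where c: "(U, c) \<in> atlas G" "x \<in> U" using top_atlas_cover[OF top_atlas_G] .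
    note C = top_atlas_chart[OF top_atlas_G c(1)]
    obtain N L where N: "open N" "x \<in> N" "N \<subseteq> L" "compact L" "L \<subseteq> U \<inter> UNIV"
      using compact_neighbourhood[OF c, of UNIV] by auto
    have LU: "L \<subseteq> U" using N(5) by simp
    have cc: "compact (c ` L)" by (rule compact_continuous_image[OF continuous_on_subset[OF C(3) LU] N(4)])
    obtain M where M: "\<And>y. y \<in> c ` L \<Longrightarrow> norm (vol_density U c y) \<le> M"
      using compact_imp_bounded[OF compact_continuous_image[OF continuous_on_subset[OF vol_density_continuous[OF c(1)] image_mono[OF LU]] cc]]
      by (force simp: bounded_iff)
    have "emeasure \<mu> N \<le> emeasure \<mu> L" by (rule emeasure_mono) (use N borel_compact in auto)
    also have "\<dots> = (\<integral>\<^sup>+ y. ennreal (vol_density U c y) * indicator (c ` L) y \<partial>lborel)"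
      by (rule emeasure_chart[OF c(1) borel_compact[OF N(4)] LU])
    also have "\<dots> \<le> (\<integral>\<^sup>+ y. ennreal M * indicator (c ` L) y \<partial>lborel)"
    proof (rule nn_integral_mono)
      fix y
      have "vol_density U c y \<le> M" if "y \<in> c ` L" using abs_le_D1[of "vol_density U c y" M] M[OF that] by simp
      then show "ennreal (vol_density U c y) * indicator (c ` L) y \<le> ennreal M * indicator (c ` L) y"
        by (cases "y \<in> c ` L") (simp_all add: ennreal_leI)
    qed
    also have "\<dots> = ennreal M * emeasure lborel (c ` L)"
      by (rule nn_integral_cmult_indicator) (use cc borel_compact in auto)
    also have "\<dots> < \<infinity>"
      using emeasure_compact_finite[OF cc] by (simp add: ennreal_mult_less_top)
    finally show ?thesis using N by blast
  qed
  then obtain F where F: "finite F" "\<Union>F = (UNIV :: 'g set)" "\<And>N. N \<in> F \<Longrightarrow> open N \<and> emeasure \<mu> N < \<infinity>"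
    by (rule finite_subcover_G) blast
  have "emeasure \<mu> (\<Union>N\<in>F. N) \<le> (\<Sum>N\<in>F. emeasure \<mu> N)"
    by (rule emeasure_subadditive_finite) (use F in auto)
  also have "\<dots> < \<infinity>" using F by (simp add: ennreal_sum_less_top)
  finally show "emeasure \<mu> (space \<mu>) \<noteq> \<infinity>" using F(2) by simp
qed

text \<open>Because the density is strictly positive, a null open set would have a Lebesgue-null
  open image in a chart. Full support is what later turns a vanishing integral of a square into a
  vanishing function.\<close>

lemma emeasure_open_pos:
  assumes "open N" "x \<in> N" shows "emeasure \<mu> N > 0"
proof -
  obtain U c where c: "(U, c) \<in> atlas G" "x \<in> U" using top_atlas_cover[OF top_atlas_G] .
  note C = top_atlas_chart[OF top_atlas_G c(1)]
  have o: "open (c ` (U \<inter> N))" by (rule open_chart_image[OF top_atlas_G c(1) assms(1)])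
  have UN: "U \<inter> N \<in> sets borel" using C(1) assms(1) by auto
  have "emeasure \<mu> (U \<inter> N) \<noteq> 0"
  proof
    assume "emeasure \<mu> (U \<inter> N) = 0"
    then have "(\<integral>\<^sup>+ y. ennreal (vol_density U c y) * indicator (c ` (U \<inter> N)) y \<partial>lborel) = 0"
      using emeasure_chart[OF c(1) UN] by simp
    moreover have "(\<lambda>y. ennreal (vol_density U c y) * indicator (c ` (U \<inter> N)) y) \<in> borel_measurable borel"
      by (rule ennreal_indicator_borel_measurable[OF continuous_on_subset[OF vol_density_continuous[OF c(1)]]]) (use o in auto)
    ultimately have "AE y in lborel. ennreal (vol_density U c y) * indicator (c ` (U \<inter> N)) y = 0"
      by (subst (asm) nn_integral_0_iff_AE) auto
    then have "AE y in lborel. y \<notin> c ` (U \<inter> N)"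
    proof (rule AE_mp, intro AE_I2 impI notI)
      fix y assume z: "ennreal (vol_density U c y) * indicator (c ` (U \<inter> N)) y = 0" and y: "y \<in> c ` (U \<inter> N)"
      then obtain g where "g \<in> U" "y = c g" by auto
      then show False using z y vol_density_pos[OF c(1), of g] by (simp add: ennreal_eq_0_iff)
    qed
    then have "emeasure lborel (c ` (U \<inter> N)) = 0"
      using o by (subst (asm) AE_iff_measurable[where N = "c ` (U \<inter> N)"]) auto
    moreover have "c x \<in> c ` (U \<inter> N)" using c assms by auto
    moreover have "c ` (U \<inter> N) \<in> null_sets lebesgue"
      by (rule null_sets_completionI) (use o \<open>emeasure lborel _ = 0\<close> in auto)
    ultimately show False using open_not_negligible[OF o] by (auto simp: negligible_iff_null_sets)
  qed
  moreover have "emeasure \<mu> (U \<inter> N) \<le> emeasure \<mu> N"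
    by (rule emeasure_mono) (use assms in auto)
  ultimately show ?thesis by (metis le_zero_eq not_gr_zero)
qed

section \<open>Integration over the group: parameter derivatives and divergences\<close>

lemma integrable_continuous:
  fixes f :: "'g \<Rightarrow> real"
  assumes "continuous_on UNIV f" shows "integrable \<mu> f"
proof -
  obtain M where M: "\<And>x. norm (f x) \<le> M"
    using compact_imp_bounded[OF compact_continuous_image[OF assms compact_G]] by (force simp: bounded_iff)
  show ?thesis
  proof (rule integrable_const_bound[of _ M])
    show "f \<in> borel_measurable \<mu>"
      using borel_measurable_continuous_onI[OF assms] measurable_cong_sets[OF sets_volume refl] by blast
  qed (use M in simp)
qed

lemma integral_translate:
  fixes f :: "'g \<Rightarrow> real"
  assumes "continuous_on UNIV f"
  shows "(\<integral>x. f (x \<otimes> h) \<partial>\<mu>) = (\<integral>x. f x \<partial>\<mu>)"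
proof -
  have m: "(\<lambda>x. x \<otimes> h) \<in> measurable \<mu> \<mu>"
    using borel_measurable_continuous_onI[OF continuous_on_mult_right[of UNIV h]] measurable_cong_sets[OF sets_volume sets_volume] by blast
  have fm: "f \<in> borel_measurable \<mu>"
    using borel_measurable_continuous_onI[OF assms] measurable_cong_sets[OF sets_volume refl] by blast
  have "distr \<mu> \<mu> (\<lambda>x. x \<otimes> h) = \<mu>"
  proof (rule measure_eqI)
    fix A assume "A \<in> sets (distr \<mu> \<mu> (\<lambda>x. x \<otimes> h))"
    then have A: "A \<in> sets borel" by simp
    have pre: "(\<lambda>x. x \<otimes> h) -` A = (\<lambda>x. x \<otimes> inv h) ` A" using mult_right_image[of "inv h" A] by simp
    show "emeasure (distr \<mu> \<mu> (\<lambda>x. x \<otimes> h)) A = emeasure \<mu> A"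
      using A by (subst emeasure_distr[OF m]) (simp_all add: pre emeasure_translate)
  qed simp
  then show ?thesis using integral_distr[OF m fm] by simp
qed

text \<open>The parameter derivative is bounded by some \<open>M\<close> on the compact product of a
  closed interval with the group. By the mean value inequality \<open>M\<close> dominates all
  difference quotients, and dominated convergence applies.\<close>

lemma integral_pder:
  fixes F :: "'z::euclidean_space \<Rightarrow> 'g \<Rightarrow> real"
  assumes F: "smooth_par W F" and z: "z \<in> W"
  shows "((\<lambda>t. \<integral>g. F (z + t *\<^sub>R v) g \<partial>\<mu>) has_real_derivative (\<integral>g. pder v F z g \<partial>\<mu>)) (at 0)"
proof -
  have W: "open W" by (rule smooth_par_open[OF F])
  have "open ((\<lambda>t::real. z + t *\<^sub>R v) -` W)"
    by (rule open_vimage[OF W]) (intro continuous_intros)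
  moreover have "0 \<in> (\<lambda>t::real. z + t *\<^sub>R v) -` W" using z by simp
  ultimately obtain \<delta> where \<delta>: "\<delta> > 0" "cball 0 \<delta> \<subseteq> (\<lambda>t::real. z + t *\<^sub>R v) -` W"
    unfolding open_contains_cball by blast
  have inW: "z + t *\<^sub>R v \<in> W" if "\<bar>t\<bar> \<le> \<delta>" for t using \<delta> that by (auto simp: subset_iff)
  have "continuous_on (cball 0 \<delta> \<times> UNIV) (\<lambda>y. pder v F (z + fst y *\<^sub>R v) (snd y))"
  proof -
    have "continuous_on (cball 0 \<delta> \<times> UNIV) (\<lambda>y. (\<lambda>(z, g). pder v F z g) (z + fst y *\<^sub>R v, snd y))"
      by (rule continuous_on_compose2[OF smooth_par_continuous[OF smooth_par_pder[OF F]]])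
        (use inW in \<open>auto intro!: continuous_intros\<close>)
    then show ?thesis by simp
  qed
  from compact_imp_bounded[OF compact_continuous_image[OF this compact_Times[OF compact_cball compact_G]]]
  obtain M where M: "\<And>t g. \<bar>t\<bar> \<le> \<delta> \<Longrightarrow> \<bar>pder v F (z + t *\<^sub>R v) g\<bar> \<le> M"
    by (force simp: bounded_iff)
  have der: "((\<lambda>t. F (z + t *\<^sub>R v) g) has_real_derivative pder v F (z + t *\<^sub>R v) g) (at t)" if "\<bar>t\<bar> \<le> \<delta>" for t g
    using pder_has_vector_derivative_at[OF F inW[OF that]] by (simp add: has_real_derivative_iff_has_vector_derivative)
  have int: "integrable \<mu> (F (z + t *\<^sub>R v))" if "\<bar>t\<bar> \<le> \<delta>" for t
    by (rule integrable_continuous[OF smooth_fun_imp_continuous[OF smooth_par_fun[OF F inW[OF that]]]])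
  let ?S = "{-\<delta><..<\<delta>}"
  let ?E = "\<lambda>t. \<integral>g. F (z + t *\<^sub>R v) g \<partial>\<mu>"
  have "((\<lambda>t. (?E t - ?E 0) / (t - 0)) \<longlongrightarrow> (\<integral>g. pder v F z g \<partial>\<mu>)) (at 0 within ?S)"
    unfolding tendsto_at_iff_sequentially
  proof (intro allI impI)
    fix X :: "nat \<Rightarrow> real" assume X: "\<forall>i. X i \<in> ?S - {0}" "X \<longlonglongrightarrow> 0"
    have Xd: "\<bar>X i\<bar> \<le> \<delta>" "X i \<noteq> 0" for i
    proof -
      have "- \<delta> < X i" "X i < \<delta>" "X i \<noteq> 0" using X(1) by auto
      then show "\<bar>X i\<bar> \<le> \<delta>" "X i \<noteq> 0" by linarith+
    qed
    let ?q = "\<lambda>i g. (F (z + X i *\<^sub>R v) g - F z g) / X i"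
    have "(\<lambda>i. \<integral>g. ?q i g \<partial>\<mu>) \<longlonglongrightarrow> (\<integral>g. pder v F z g \<partial>\<mu>)"
    proof (rule integral_dominated_convergence[where w = "\<lambda>_. M"])
      show "pder v F z \<in> borel_measurable \<mu>"
        using integrable_continuous[OF smooth_fun_imp_continuous[OF smooth_par_fun[OF smooth_par_pder[OF F] z]]]
        by (rule borel_measurable_integrable)
      show "?q i \<in> borel_measurable \<mu>" for i
        using borel_measurable_integrable[OF int[OF Xd(1)]] borel_measurable_integrable[OF int[of 0]] \<delta>(1)
        by (simp add: borel_measurable_diff borel_measurable_divide)
      have "(\<lambda>i. ?q i g) \<longlonglongrightarrow> pder v F z g" for g
      proof -
        have "((\<lambda>t. (F (z + t *\<^sub>R v) g - F z g) / t) \<longlongrightarrow> pder v F z g) (at 0)"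
          using der[of 0 g] \<delta>(1) by (simp add: has_field_derivative_iff)
        then show ?thesis
          unfolding tendsto_at_iff_sequentially comp_def using X Xd by blast
      qed
      then show "AE g in \<mu>. (\<lambda>i. ?q i g) \<longlonglongrightarrow> pder v F z g" by simp
      have "norm (?q i g) \<le> M" for i g
      proof -
        have "norm (F (z + X i *\<^sub>R v) g - F (z + 0 *\<^sub>R v) g) \<le> M * norm (X i - 0)"
        proof (rule field_differentiable_bound[of "{-\<delta>..\<delta>}" "\<lambda>t. F (z + t *\<^sub>R v) g" "\<lambda>t. pder v F (z + t *\<^sub>R v) g"])
          fix t assume "t \<in> {-\<delta>..\<delta>}"
          then have t: "\<bar>t\<bar> \<le> \<delta>" by (simp add: abs_le_iff)
          show "((\<lambda>t. F (z + t *\<^sub>R v) g) has_real_derivative pder v F (z + t *\<^sub>R v) g) (at t within {-\<delta>..\<delta>})"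
            by (rule has_field_derivative_at_within[OF der[OF t]])
          show "norm (pder v F (z + t *\<^sub>R v) g) \<le> M" using M[OF t] by simp
        next
          show "X i \<in> {-\<delta>..\<delta>}" using Xd(1)[of i] by (simp add: abs_le_iff)
          show "0 \<in> {-\<delta>..\<delta>}" using \<delta>(1) by simp
        qed simp
        then show ?thesis using Xd[of i] by (simp add: field_simps)
      qed
      then show "AE g in \<mu>. norm (?q i g) \<le> M" for i by simp
    qed simp
    moreover have "(\<lambda>i. \<integral>g. ?q i g \<partial>\<mu>) = (\<lambda>t. (?E t - ?E 0) / (t - 0)) \<circ> X"
      unfolding comp_def
    proof
      fix i show "(\<integral>g. ?q i g \<partial>\<mu>) = (?E (X i) - ?E 0) / (X i - 0)"
        using int[OF Xd(1), of i] int[of 0] \<delta>(1) by simp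
    qed
    ultimately show "((\<lambda>t. (?E t - ?E 0) / (t - 0)) \<circ> X) \<longlonglongrightarrow> (\<integral>g. pder v F z g \<partial>\<mu>)"
      by (simp only:)
  qed
  moreover have "at 0 within ?S = at 0" by (rule at_within_open) (use \<delta> in auto)
  ultimately show ?thesis by (simp add: has_field_derivative_iff)
qed

text \<open>The divergence theorem in the form needed for integration by parts: by translation
  invariance the integral of f (g exp(tX)) over g is constant in t, and its derivative at t = 0 is
  the left-hand side.\<close>

lemma integral_lder:
  fixes f :: "'g \<Rightarrow> real"
  assumes f: "smooth_fun G f" shows "(\<integral>g. lder G X f g \<partial>\<mu>) = 0"
proof -
  let ?F = "\<lambda>t g. f (g \<otimes> lie_exp G (t *\<^sub>R X))"
  have F: "smooth_par (UNIV :: real set) ?F"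
  proof (rule smooth_parI)
    fix U c assume c: "(U, c) \<in> atlas G"
    have "open ((UNIV :: real set) \<times> c ` U)" by (rule open_Times[OF open_UNIV top_atlas_chart(2)[OF top_atlas_G c]])
    then show "smooth_on (UNIV \<times> c ` U) (\<lambda>y. f (inv_into U c (snd y) \<otimes> lie_exp G (fst y *\<^sub>R X)))"
      by (intro smooth_fun_plot[OF f] plot_mult plot_compose[OF plot_chart[OF c]] plot_exp smooth_on_snd smooth_on_id
         smooth_on_linear_compose[OF bounded_linear_scaleR_left] smooth_on_fst) auto
  qed simp
  have "((\<lambda>t. \<integral>g. ?F (0 + t *\<^sub>R 1) g \<partial>\<mu>) has_real_derivative (\<integral>g. pder 1 ?F 0 g \<partial>\<mu>)) (at 0)"
    by (rule integral_pder[OF F]) simp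
  moreover have "(\<integral>g. ?F (0 + t *\<^sub>R 1) g \<partial>\<mu>) = (\<integral>g. f g \<partial>\<mu>)" for t
    by (simp add: integral_translate[OF smooth_fun_imp_continuous[OF f]])
  ultimately have "((\<lambda>t. \<integral>g. f g \<partial>\<mu>) has_real_derivative (\<integral>g. pder 1 ?F 0 g \<partial>\<mu>)) (at (0::real))" by simp
  then have "(\<integral>g. pder 1 ?F 0 g \<partial>\<mu>) = 0" using DERIV_unique[OF _ DERIV_const] by blast
  then show ?thesis by (simp add: pder_def lder_def)
qed

lemma integral_zero_imp_zero:
  fixes f :: "'g \<Rightarrow> real"
  assumes cont: "continuous_on UNIV f" and pos: "\<And>x. f x \<ge> 0" and int: "(\<integral>x. f x \<partial>\<mu>) = 0"
  shows "f x = 0"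
proof (rule ccontr)
  assume "f x \<noteq> 0"
  then have x: "x \<in> f -` {0<..}" using pos[of x] by simp
  have o: "open (f -` {0<..})" by (rule open_vimage[OF open_greaterThan cont])
  have "AE x in \<mu>. 0 \<le> f x" using pos by (intro AE_I2)
  from iffD1[OF integral_nonneg_eq_0_iff_AE[OF integrable_continuous[OF cont] this] int]
  have "AE x in \<mu>. x \<notin> f -` {0<..}" by (rule AE_mp) (rule AE_I2, simp)
  then have "emeasure \<mu> (f -` {0<..}) = 0"
    using o by (subst (asm) AE_iff_measurable[where N = "f -` {0<..}"]) auto
  then show False using emeasure_open_pos[OF o x] by simp
qed

end

section \<open>The homogeneous space and the adjoint orbit of J\<close>

lemma orthogonal_projection_exists:
  fixes S :: "'a::euclidean_space set"
  assumes "subspace S"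
  obtains f where "linear f" "\<And>x. f x \<in> S" "\<And>x. x - f x \<in> orthogonal_comp S"
proof -
  obtain B where B: "B \<subseteq> S" "pairwise orthogonal B" "\<And>x. x \<in> B \<Longrightarrow> norm x = 1" "independent B" "span B = S"
    using orthonormal_basis_subspace[OF assms] by metis
  have fin: "finite B" using independent_imp_finite[OF B(4)] .
  define f where "f x = (\<Sum>b\<in>B. (x \<bullet> b) *\<^sub>R b)" for x
  show thesis
  proof (rule that)
    show "linear f"
      by (rule linearI) (simp_all add: f_def inner_add_left scaleR_add_left sum.distrib scaleR_sum_right)
    show "f x \<in> S" for x
      unfolding f_def using B(1) by (intro subspace_sum[OF assms] subspace_scale[OF assms]) auto
    show "x - f x \<in> orthogonal_comp S" for x
    proof -
      have "(x - f x) \<bullet> c = 0" if "c \<in> B" for c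
      proof -
        have "f x \<bullet> c = (\<Sum>b\<in>B. (x \<bullet> b) * (b \<bullet> c))" by (simp add: f_def inner_sum_left)
        also have "\<dots> = (\<Sum>b\<in>B. if b = c then x \<bullet> c else 0)"
        proof (rule sum.cong[OF refl])
          fix b assume "b \<in> B"
          show "(x \<bullet> b) * (b \<bullet> c) = (if b = c then x \<bullet> c else 0)"
          proof (cases "b = c")
            case True
            then show ?thesis using B(3)[OF that] by (simp add: norm_eq_1)
          next
            case False
            then have "orthogonal b c" using B(2) \<open>b \<in> B\<close> that by (simp add: pairwise_def)
            then show ?thesis using False by (simp add: orthogonal_def)
          qed
        qed
        also have "\<dots> = x \<bullet> c" using fin that by simp
        finally show ?thesis by (simp add: inner_diff_left)
      qed
      then have "orthogonal (x - f x) y" if "y \<in> span B" for y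
        using that by (intro orthogonal_to_span[OF that]) (simp add: orthogonal_def)
      then show ?thesis by (simp add: orthogonal_comp_def B(5) orthogonal_commute)
    qed
  qed
qed

lemma mem_orthogonal_comp: "x \<in> orthogonal_comp S \<longleftrightarrow> (\<forall>y\<in>S. x \<bullet> y = 0)"
  by (auto simp: orthogonal_comp_def orthogonal_def inner_commute)

text \<open>A subspace is its own double orthogonal complement, and the derivative stays orthogonal
  to every vector to which the curve is orthogonal.\<close>

lemma derivative_in_subspace:
  fixes f :: "real \<Rightarrow> 'a::euclidean_space"
  assumes S: "subspace S" and f: "(f has_vector_derivative D) (at 0)" "\<And>t. f t \<in> S"
  shows "D \<in> S"
proof -
  have "D \<bullet> y = 0" if "y \<in> orthogonal_comp S" for y
  proof -
    have "((\<lambda>t. f t \<bullet> y) has_vector_derivative D \<bullet> y) (at 0)"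
      by (rule bounded_linear.has_vector_derivative[OF bounded_linear_inner_left f(1)])
    moreover have "f t \<bullet> y = 0" for t using that f(2)[of t] by (metis inner_commute mem_orthogonal_comp)
    ultimately show ?thesis using vector_derivative_unique_at[OF _ has_vector_derivative_const] by simp
  qed
  then have "D \<in> orthogonal_comp (orthogonal_comp S)" by (simp add: mem_orthogonal_comp)
  then show ?thesis by (simp add: orthogonal_comp_self[OF S])
qed

context lie_group
begin

lemma smooth_fun_glue:
  assumes "open A" "open B" "A \<union> B = UNIV" "smooth_fun G f" "smooth_fun G h"
    and "\<And>x. x \<in> A \<Longrightarrow> F x = f x" "\<And>x. x \<in> B \<Longrightarrow> F x = h x"
  shows "smooth_fun G F"
proof (rule smooth_funI)
  fix U c assume c: "(U, c) \<in> atlas G"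
  note C = top_atlas_chart[OF top_atlas_G c]
  have s: "smooth_on (c ` (U \<inter> W)) (\<lambda>y. F (inv_into U c y))"
    if "open W" "smooth_fun G q" "\<And>x. x \<in> W \<Longrightarrow> F x = q x" for W q
  proof -
    have "smooth_on (c ` (U \<inter> W)) (\<lambda>y. q (inv_into U c y))"
      by (rule smooth_on_subset[OF smooth_fun_plot[OF that(2) plot_chart[OF c]]]) auto
    then show ?thesis
      by (subst smooth_on_cong[OF open_chart_image[OF top_atlas_G c that(1)], of _ "\<lambda>y. q (inv_into U c y)"])
        (auto simp: C(6) that(3))
  qed
  show "smooth_on (c ` U) (\<lambda>y. F (inv_into U c y))"
  proof (rule smooth_on_local[OF C(2)])
    fix y assume "y \<in> c ` U"
    then have "y \<in> c ` (U \<inter> A) \<or> y \<in> c ` (U \<inter> B)" using assms(3) by blast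
    then show "\<exists>O'. open O' \<and> y \<in> O' \<and> O' \<subseteq> c ` U \<and> smooth_on O' (\<lambda>y. F (inv_into U c y))"
      using s[OF assms(1,4,6)] s[OF assms(2,5,7)] open_chart_image[OF top_atlas_G c assms(1)]
        open_chart_image[OF top_atlas_G c assms(2)] by blast
  qed
qed

lemma lie_subD: "X \<in> lie_sub G K \<Longrightarrow> lie_exp G (t *\<^sub>R X) \<in> K"
  by (simp add: lie_sub_def)

end

text \<open>For a closed subgroup \<open>subspace_k\<close> is a theorem; here it is an assumption,
  discharged in the end from the given basis of \<kk>.\<close>

locale hermitian_pair = riemannian_lie_group G \<mu>
  for G :: "('g::{t2_space, second_countable_topology}, 'a::euclidean_space, real^'m) lie_data"
    (structure) and \<mu> :: "'g measure" +
  fixes K :: "'g set" and J :: 'a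
  assumes simple: "lie_simple G" and K_subgroup: "subgroup K G" and K_compact: "compact K"
    and symmetric: "symmetric_pair G K" and irreducible: "isotropy_irreducible G K"
    and hermitian: "hermitian_element G K J" and subspace_k: "subspace (lie_sub G K)"
begin

abbreviation (input) kk :: "'a set" where "kk \<equiv> lie_sub G K"
abbreviation (input) pp :: "'a set" where "pp \<equiv> lie_compl G K"

section \<open>The decomposition into \<kk> and \<pp> and the action of J\<close>

lemma subspace_p: "subspace pp"
  by (rule subspace_orthogonal_comp)

lemma inner_kp: "X \<in> kk \<Longrightarrow> v \<in> pp \<Longrightarrow> X \<bullet> v = 0" "X \<in> kk \<Longrightarrow> v \<in> pp \<Longrightarrow> v \<bullet> X = 0"
  by (auto simp: mem_orthogonal_comp inner_commute)

lemma decompose: obtains a b where "X = a + b" "a \<in> kk" "b \<in> pp"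
proof -
  obtain f where "\<And>x. f x \<in> kk" "\<And>x. x - f x \<in> pp"
    using orthogonal_projection_exists[OF subspace_k] by metis
  then show thesis using that[of "f X" "X - f X"] by simp
qed

lemma K_mult: "x \<in> K \<Longrightarrow> y \<in> K \<Longrightarrow> x \<otimes> y \<in> K"
  and K_inv: "x \<in> K \<Longrightarrow> inv x \<in> K" and K_one: "\<one> \<in> K"
  using K_subgroup by (auto simp: subgroup.m_closed subgroup.m_inv_closed subgroup.one_closed)

lemma Ad_k: "h \<in> K \<Longrightarrow> X \<in> kk \<Longrightarrow> Ad G h X \<in> kk"
  by (auto simp: lie_sub_def exp_Ad intro!: K_mult K_inv)

lemma Ad_p: "h \<in> K \<Longrightarrow> v \<in> pp \<Longrightarrow> Ad G h v \<in> pp"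
proof -
  assume h: "h \<in> K" and v: "v \<in> pp"
  have "Ad G h v \<bullet> X = 0" if "X \<in> kk" for X
  proof -
    have "Ad G h v \<bullet> Ad G h (Ad G (inv h) X) = v \<bullet> Ad G (inv h) X" by (rule Ad_inner)
    then show ?thesis using inner_kp(2)[OF Ad_k[OF K_inv[OF h] that] v] by simp
  qed
  then show ?thesis by (simp add: mem_orthogonal_comp)
qed

lemma bracket_kk: "X \<in> kk \<Longrightarrow> Y \<in> kk \<Longrightarrow> bracket G X Y \<in> kk"
proof -
  assume X: "X \<in> kk" and Y: "Y \<in> kk"
  have "((\<lambda>t. Ad G (\<one> \<otimes> lie_exp G (t *\<^sub>R X)) Y) has_vector_derivative Ad G \<one> (bracket G X Y)) (at 0)"
    using lder_has_vector_derivative[OF smooth_fun_Ad[of Y], of \<one> X] unfolding lder_Ad .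
  then have "((\<lambda>t. Ad G (lie_exp G (t *\<^sub>R X)) Y) has_vector_derivative bracket G X Y) (at 0)" by simp
  then show ?thesis by (rule derivative_in_subspace[OF subspace_k]) (rule Ad_k[OF lie_subD[OF X] Y])
qed

lemma bracket_kp: "X \<in> kk \<Longrightarrow> v \<in> pp \<Longrightarrow> bracket G X v \<in> pp"
  unfolding mem_orthogonal_comp by (auto simp: inner_bracket bracket_kk)

lemma bracket_pk: "v \<in> pp \<Longrightarrow> X \<in> kk \<Longrightarrow> bracket G v X \<in> pp"
  using bracket_kp[of X v] bracket_anticomm[of v X] subspace_neg[OF subspace_p] by simp

text \<open>The differential s of the involution \<sigma> is an isometric automorphism with s^2 = 1,
  and its fixed space is exactly \<kk>: K is fixed by \<sigma>, and conversely the one-parameter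
  subgroup of a fixed vector is connected, so it stays in the identity component of the fixed group,
  which K contains. For u in \<pp> the vector u + s u is fixed and orthogonal to \<kk>, hence 0. So
  s = -1 on \<pp>, and s fixes brackets of two vectors of \<pp>.\<close>

lemma bracket_pp: "v \<in> pp \<Longrightarrow> w \<in> pp \<Longrightarrow> bracket G v w \<in> kk"
proof -
  assume v: "v \<in> pp" and w: "w \<in> pp"
  obtain \<sigma> where \<sigma>: "\<sigma> \<in> hom G G" "smooth_map_on (atlas G) (atlas G) UNIV \<sigma>" "\<sigma> \<circ> \<sigma> = id"
    "K \<subseteq> {g. \<sigma> g = g}" "connected_component_set {g. \<sigma> g = g} \<one> \<subseteq> K"
    using symmetric by (auto simp: symmetric_pair_def)
  have hom: "lie_hom \<sigma>" using \<sigma>(1,2) by (auto simp: lie_hom_def hom_def)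
  let ?s = "lie_diff \<sigma>"
  have lin: "linear ?s" by (rule linear_lie_diff[OF hom])
  have inv: "?s (?s X) = X" for X
  proof -
    have "lie_exp G (t *\<^sub>R X) = lie_exp G (t *\<^sub>R ?s (?s X))" for t
      using fun_cong[OF \<sigma>(3)] by (simp add: lie_diff_exp[OF hom])
    then show ?thesis by (rule exp_line_inject[symmetric])
  qed
  have bij: "bij ?s" by (rule o_bij[of ?s]) (simp_all add: fun_eq_iff inv)
  have fix_k: "?s X = X" if "X \<in> kk" for X
  proof (rule lie_diff_unique)
    fix t
    have "lie_exp G (t *\<^sub>R X) \<in> {g. \<sigma> g = g}" using \<sigma>(4) lie_subD[OF that] by blast
    then show "lie_exp G (t *\<^sub>R X) = \<sigma> (lie_exp G (t *\<^sub>R X))" by simp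
  qed
  have k_fix: "X \<in> kk" if "?s X = X" for X
  proof -
    let ?L = "range (\<lambda>t::real. lie_exp G (t *\<^sub>R X))"
    have fixed: "\<sigma> (lie_exp G (t *\<^sub>R X)) = lie_exp G (t *\<^sub>R X)" for t
      using lie_diff_exp[OF hom, of t X] that by simp
    have "continuous_on UNIV (\<lambda>t::real. lie_exp G (t *\<^sub>R X))"
      using plot_continuous_on[OF plot_exp_line[of \<one> X]] by simp
    then have "connected ?L" by (rule connected_continuous_image) simp
    moreover have "\<one> \<in> ?L" by (rule range_eqI[of _ _ 0]) simp
    moreover have "?L \<subseteq> {g. \<sigma> g = g}" using fixed by auto
    ultimately have "?L \<subseteq> connected_component_set {g. \<sigma> g = g} \<one>"
      by (intro connected_component_maximal)
    then have "?L \<subseteq> K" using \<sigma>(5) by (rule subset_trans)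
    then show ?thesis by (auto simp: lie_sub_def)
  qed
  have iso: "?s X \<bullet> ?s Y = X \<bullet> Y" for X Y
    by (rule inner_automorphism[of ?s, OF lin bij lie_diff_bracket[OF hom]])
  have neg: "?s u = - u" if u: "u \<in> pp" for u
  proof -
    have "u + ?s u \<in> kk" by (rule k_fix) (simp add: linear_add[OF lin] inv)
    moreover have "(u + ?s u) \<bullet> X = 0" if "X \<in> kk" for X
      using iso[of u X] inner_kp(2)[OF that u] by (simp add: inner_add_left fix_k[OF that])
    ultimately have "(u + ?s u) \<bullet> (u + ?s u) = 0" by blast
    then show ?thesis by (simp add: eq_neg_iff_add_eq_0 add.commute)
  qed
  have "?s (bracket G v w) = bracket G v w"
    by (simp add: lie_diff_bracket[OF hom] neg v w bracket_simps)
  then show ?thesis by (rule k_fix)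
qed

lemma J_k: "J \<in> kk" and J_central: "X \<in> kk \<Longrightarrow> bracket G J X = 0" "X \<in> kk \<Longrightarrow> bracket G X J = 0"
  and J_square: "v \<in> pp \<Longrightarrow> bracket G J (bracket G J v) = - v"
  using hermitian bracket_anticomm[of X J] by (auto simp: hermitian_element_def)

lemma J_p: "v \<in> pp \<Longrightarrow> bracket G J v \<in> pp"
  by (rule bracket_kp[OF J_k])

lemma J_bracket_p: "bracket G J X \<in> pp"
proof -
  obtain a b where "X = a + b" "a \<in> kk" "b \<in> pp" by (rule decompose)
  then show ?thesis by (simp add: bracket_simps J_central J_p)
qed

lemma inner_J: "v \<in> pp \<Longrightarrow> bracket G J v \<bullet> bracket G J w = v \<bullet> w"
  by (simp add: inner_bracket[of J w] inner_commute[of _ "bracket G J w"] J_square inner_commute[of w])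

lemma p_nonzero: "pp \<noteq> {0}"
  using irreducible by (simp add: isotropy_irreducible_def)

text \<open>\<open>Ad\<^sub>k J - J\<close> lies in the ideal of those elements of \<open>\<kk>\<close> that centralise \<open>\<pp>\<close>.\<close>

lemma Ad_J:
  assumes h: "h \<in> K" shows "Ad G h J = J"
proof -
  define I where "I = {W \<in> kk. \<forall>v\<in>pp. bracket G W v = 0}"
  have "subspace I"
    unfolding subspace_def I_def
    by (auto simp: bracket_simps subspace_0[OF subspace_k] subspace_add[OF subspace_k] subspace_scale[OF subspace_k])
  moreover have "bracket G X W \<in> I" if W: "W \<in> I" for X W
  proof -
    obtain a b where ab: "X = a + b" "a \<in> kk" "b \<in> pp" by (rule decompose)
    have Wk: "W \<in> kk" and Wp: "\<And>v. v \<in> pp \<Longrightarrow> bracket G W v = 0" using W by (auto simp: I_def)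
    have "bracket G b W = 0" using Wp[OF ab(3)] bracket_anticomm[of b W] by simp
    then have e: "bracket G X W = bracket G a W" by (simp add: ab bracket_simps)
    have "bracket G (bracket G a W) v = 0" if "v \<in> pp" for v
      using jacobi[of a W v] Wp[OF that] Wp[OF bracket_kp[OF ab(2) that]] by (simp add: bracket_simps)
    then show ?thesis by (simp add: I_def e bracket_kk[OF ab(2) Wk])
  qed
  moreover have "I \<noteq> UNIV"
  proof
    assume "I = UNIV"
    then have "kk = UNIV" by (auto simp: I_def)
    then show False using p_nonzero by simp
  qed
  ultimately have I: "I = {0}" using simple by (auto simp: lie_simple_def)
  have "bracket G (Ad G h J) v = bracket G J v" if "v \<in> pp" for v
  proof -
    have u: "Ad G (inv h) v \<in> pp" by (rule Ad_p[OF K_inv[OF h] that])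
    have "bracket G (Ad G h J) (Ad G h (Ad G (inv h) v)) = Ad G h (bracket G J (Ad G (inv h) v))"
      by (rule Ad_bracket[symmetric])
    also have "\<dots> = bracket G J (Ad G h (Ad G (inv h) v))"
      using hermitian h u by (simp add: hermitian_element_def)
    finally show ?thesis by simp
  qed
  then have "Ad G h J - J \<in> I"
    by (simp add: I_def bracket_simps subspace_diff[OF subspace_k] Ad_k[OF h J_k] J_k)
  then show ?thesis using I by simp
qed

section \<open>The orbit map and functions on the quotient\<close>

definition orbit :: "'g \<Rightarrow> 'a" where
  "orbit g = Ad G g J"

lemma orbit_smooth: "smooth_fun G orbit"
  unfolding orbit_def by (rule smooth_fun_Ad)

lemma orbit_K: "h \<in> K \<Longrightarrow> orbit (g \<otimes> h) = orbit g"
  by (simp add: orbit_def Ad_mult Ad_J)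

lemma lder_orbit: "lder G X orbit g = Ad G g (bracket G X J)"
  unfolding orbit_def by (rule lder_Ad)

lemma proj_mult: "h \<in> K \<Longrightarrow> proj G K (g \<otimes> h) = proj G K g"
  unfolding proj_def using coset_join3[OF in_carrier K_subgroup, of h]
  by (simp add: lcos_m_assoc[OF subgroup.subset[OF K_subgroup], symmetric])

lemma proj_eqD: "proj G K x = proj G K y \<Longrightarrow> \<exists>h\<in>K. x = y \<otimes> h"
proof -
  assume "proj G K x = proj G K y"
  moreover have "x \<in> proj G K x" using K_one by (force simp: proj_def l_coset_def)
  ultimately show ?thesis by (auto simp: proj_def l_coset_def)
qed

text \<open>The same choice of representative as inside \<open>kahler_form\<close>, so that this
  form unfolds to an expression in \<open>rep\<close>.\<close>

definition rep :: "'g set \<Rightarrow> 'g" where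
  "rep S = (SOME g. proj G K g = S)"

lemma proj_rep: "S \<in> range (proj G K) \<Longrightarrow> proj G K (rep S) = S"
  unfolding rep_def by (rule someI_ex) auto

lemma rep_invariant:
  assumes "\<And>g h. h \<in> K \<Longrightarrow> F (g \<otimes> h) = F g"
  shows "F (rep (proj G K g)) = F g"
proof -
  obtain h where "h \<in> K" "rep (proj G K g) = g \<otimes> h"
    using proj_eqD[OF proj_rep[of "proj G K g"]] by auto
  then show ?thesis by (simp add: assms)
qed

lemma quot_smooth_lift:
  fixes F :: "'g \<Rightarrow> real"
  assumes "smooth_fun G F" "\<And>g h. h \<in> K \<Longrightarrow> F (g \<otimes> h) = F g"
  shows "(\<lambda>S. F (rep S)) \<in> quot_smooth G K"
  using assms(1) by (simp add: quot_smooth_def comp_def rep_invariant[of F, OF assms(2)])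

text \<open>Let f be the orthogonal projection onto \<kk>. The map X -> exp(X - f X) exp(f X) has at
  0 the same invertible differential as exp, so the open mapping theorem at a single point makes it
  cover a neighbourhood of the identity. The norm bound survives because the projection X - f X to
  \<pp> does not increase norms.\<close>

lemma slice_neighbourhood:
  assumes \<rho>: "\<rho> > 0"
  obtains N where "open N" "\<one> \<in> N"
    "\<And>x. x \<in> N \<Longrightarrow> \<exists>v h. v \<in> pp \<and> norm v < \<rho> \<and> h \<in> K \<and> x = lie_exp G v \<otimes> h"
proof -
  obtain f where f: "linear f" "\<And>x. f x \<in> kk" "\<And>x. x - f x \<in> pp"
    using orthogonal_projection_exists[OF subspace_k] by metis
  have lf: "bounded_linear f" using f(1) linear_conv_bounded_linear by blast
  have norm_le: "norm (X - f X) \<le> norm X" for X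
  proof -
    have "(norm X)\<^sup>2 = (norm (f X))\<^sup>2 + (norm (X - f X))\<^sup>2"
      using norm_add_Pythagorean[of "f X" "X - f X"] inner_kp(1)[OF f(2,3)] by (simp add: orthogonal_def)
    then show ?thesis by (metis le_add_same_cancel2 norm_ge_zero power2_le_imp_le zero_le_power2)
  qed
  obtain U c D where c: "(U, c) \<in> atlas G" "\<one> \<in> U" and D: "((\<lambda>X. c (lie_exp G X)) has_derivative D) (at 0)" "bij D"
    "linear D" "linear (inv_into UNIV D)" by (rule identity_chart)
  note C = top_atlas_chart[OF top_atlas_G c(1)]
  let ?m = "\<lambda>X. lie_exp G (X - f X) \<otimes> lie_exp G (f X)"
  have p: "plot UNIV ?m"
    by (intro plot_mult plot_exp smooth_on_diff smooth_on_id smooth_on_linear[OF lf]) auto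
  define S where "S = ?m -` U"
  have S: "open S" unfolding S_def by (rule open_vimage[OF C(1) plot_continuous_on[OF p]])
  have f0: "f 0 = 0" by (rule linear_0[OF f(1)])
  have 0: "0 \<in> S" using c(2) by (simp add: S_def f0)
  let ?F = "\<lambda>X. c (?m X)"
  have F: "smooth_on S ?F" by (rule plot_chart_compose[OF c(1) plot_subset[OF p S]]) (auto simp: S_def)
  have F': "(?F has_derivative D) (at 0)"
  proof -
    have "frechet_derivative ?F (at 0) X = D X" for X
    proof -
      \<comment> \<open>Independent times for the two factors, so that the derivative along the
        diagonal is \<open>D (X - f X) + D (f X)\<close>, which is \<open>D X\<close>.\<close>
      let ?H = "\<lambda>y. c (lie_exp G (fst y *\<^sub>R (X - f X)) \<otimes> lie_exp G (snd y *\<^sub>R f X))"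
      let ?q = "\<lambda>y::real \<times> real. lie_exp G (fst y *\<^sub>R (X - f X)) \<otimes> lie_exp G (snd y *\<^sub>R f X)"
      have pq: "plot UNIV ?q"
        by (intro plot_mult plot_exp smooth_on_linear_compose[OF bounded_linear_scaleR_left] smooth_on_fst smooth_on_snd smooth_on_id) auto
      have Q: "open (?q -` U)" by (rule open_vimage[OF C(1) plot_continuous_on[OF pq]])
      have H: "smooth_on (?q -` U) ?H"
        by (rule plot_chart_compose[OF c(1) plot_subset[OF pq Q]]) auto
      have d: "((\<lambda>t. c (lie_exp G (t *\<^sub>R Z))) has_vector_derivative D Z) (at 0)" for Z
      proof -
        have "((\<lambda>t. t *\<^sub>R Z) has_derivative (\<lambda>t. t *\<^sub>R Z)) (at 0)" by (auto intro!: derivative_eq_intros)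
        then have "((\<lambda>t. c (lie_exp G (t *\<^sub>R Z))) has_derivative (\<lambda>t. D (t *\<^sub>R Z))) (at 0)"
          by (rule has_derivative_compose) (simp add: D)
        then show ?thesis by (simp add: has_vector_derivative_def linear_scale[OF D(3)])
      qed
      have "((\<lambda>h. ?H (h, h)) has_vector_derivative D (X - f X) + D (f X)) (at 0)"
        by (rule has_vector_derivative_diagonal[OF H]) (use c(2) d[of "X - f X"] d[of "f X"] in simp_all)
      moreover have "D (X - f X) + D (f X) = D X" by (simp add: linear_add[OF D(3), symmetric])
      moreover have "((\<lambda>t. ?F (0 + t *\<^sub>R X)) has_vector_derivative frechet_derivative ?F (at (0 + 0 *\<^sub>R X)) X) (at 0)"
        by (rule smooth_on_has_vector_derivative_line[OF F]) (use 0 in simp)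
      ultimately show ?thesis
        by (simp add: linear_scale[OF f(1)] scaleR_diff_right vector_derivative_unique_at)
    qed
    then have "frechet_derivative ?F (at 0) = D" by (rule ext)
    then show ?thesis using smooth_on_has_derivative[OF F 0] by simp
  qed
  define T where "T = S \<inter> ball 0 \<rho>"
  have T: "open T" "0 \<in> T" "T \<subseteq> S" using S 0 \<rho> by (auto simp: T_def)
  have "?F 0 \<in> interior (?F ` T)"
  proof (rule sussmann_open_mapping[OF S smooth_on_imp_continuous_on[OF F] 0 F'])
    show "bounded_linear (inv_into UNIV D)" using D(4) linear_conv_bounded_linear by blast
    show "D \<circ> inv_into UNIV D = id" using D(2) by (simp add: fun_eq_iff bij_is_surj surj_f_inv_f)
    show "0 \<in> interior T" using T by (simp add: interior_open)
  qed (rule T(3))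
  then have one: "c \<one> \<in> interior (?F ` T)" by (simp add: f0)
  show thesis
  proof (rule that)
    show "open (U \<inter> c -` interior (?F ` T))" by (rule continuous_open_preimage[OF C(3,1)]) simp
    show "\<one> \<in> U \<inter> c -` interior (?F ` T)" using c(2) one by simp
    fix x assume x: "x \<in> U \<inter> c -` interior (?F ` T)"
    then obtain X where X: "X \<in> T" "c x = ?F X" using interior_subset by blast
    have "x = ?m X" by (rule inj_onD[OF C(5) X(2)]) (use x X in \<open>auto simp: T_def S_def\<close>)
    moreover have "lie_exp G (f X) \<in> K" using lie_subD[OF f(2), of 1 X] by simp
    moreover have "norm (X - f X) < \<rho>" using norm_le[of X] X(1) by (simp add: T_def)
    ultimately show "\<exists>v h. v \<in> pp \<and> norm v < \<rho> \<and> h \<in> K \<and> x = lie_exp G v \<otimes> h" using f(3) by blast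
  qed
qed

lemma orbit_exp_derivative: "((\<lambda>v. orbit (lie_exp G v)) has_derivative (\<lambda>v. bracket G v J)) (at 0)"
proof -
  have sm: "smooth_on UNIV (\<lambda>v. orbit (lie_exp G v))"
    by (intro smooth_fun_plot[OF orbit_smooth] plot_exp) auto
  have "frechet_derivative (\<lambda>v. orbit (lie_exp G v)) (at 0) X = bracket G X J" for X
  proof -
    have "((\<lambda>t. orbit (lie_exp G (0 + t *\<^sub>R X))) has_vector_derivative frechet_derivative (\<lambda>v. orbit (lie_exp G v)) (at (0 + 0 *\<^sub>R X)) X) (at 0)"
      by (rule smooth_on_has_vector_derivative_line[OF sm]) simp
    moreover have "((\<lambda>t. orbit (\<one> \<otimes> lie_exp G (t *\<^sub>R X))) has_vector_derivative Ad G \<one> (bracket G X J)) (at 0)"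
      using lder_has_vector_derivative[OF orbit_smooth, of \<one> X] unfolding lder_orbit .
    ultimately show ?thesis by (simp add: vector_derivative_unique_at)
  qed
  then have "frechet_derivative (\<lambda>v. orbit (lie_exp G v)) (at 0) = (\<lambda>v. bracket G v J)" by (rule ext)
  then show ?thesis using smooth_on_has_derivative[OF sm, of 0] by simp
qed

lemma norm_bracket_J: "v \<in> pp \<Longrightarrow> norm (bracket G v J) = norm v"
  using inner_J[of v v] bracket_anticomm[of v J] by (simp add: norm_eq_sqrt_inner)

lemma orbit_expansion:
  assumes "e > 0"
  obtains d where "d > 0" "\<And>v. norm v < d \<Longrightarrow> norm (orbit (lie_exp G v) - J - bracket G v J) \<le> e * norm v"
proof -
  have "\<forall>e>0. \<exists>d>0. \<forall>y. norm (y - 0) < d \<longrightarrow>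
      norm (orbit (lie_exp G y) - orbit (lie_exp G 0) - bracket G (y - 0) J) \<le> e * norm (y - 0)"
    using orbit_exp_derivative unfolding has_derivative_at_alt by blast
  moreover have "orbit (lie_exp G 0) = J" by (simp add: orbit_def)
  ultimately show thesis using that assms by (metis diff_zero)
qed

text \<open>Smallness of \<open>orbit x - J\<close> is not known to force \<open>x\<close> near K,
  since the stabiliser of J might be larger. The cutoff of this distance is therefore kept only on
  the K-saturated slice neighbourhood \<open>NK\<close> and set to 0 elsewhere. The result is smooth
  because it vanishes on \<open>NK\<close> outside the closed set \<open>L\<close>. The factor 2
  comes from the expansion with error 1/2: v -> [v, J] is isometric on \<pp>, so at least half of
  the norm remains.\<close>

lemma quotient_bump:
  obtains b :: "'g \<Rightarrow> real" and \<rho> where "smooth_fun G b" "\<And>g h. h \<in> K \<Longrightarrow> b (g \<otimes> h) = b g" "b \<one> > 0"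
    "\<And>x. b x > 0 \<Longrightarrow> \<exists>v h. v \<in> pp \<and> norm v < \<rho> \<and> h \<in> K \<and> x = lie_exp G v \<otimes> h"
    "\<And>v. v \<in> pp \<Longrightarrow> norm v < \<rho> \<Longrightarrow> norm v \<le> 2 * norm (orbit (lie_exp G v) - J)" "\<rho> > 0"
proof -
  obtain \<rho> where \<rho>: "\<rho> > 0" "\<And>v. norm v < \<rho> \<Longrightarrow> norm (orbit (lie_exp G v) - J - bracket G v J) \<le> (1/2) * norm v"
    using orbit_expansion[of "1/2"] by auto
  have est: "norm v \<le> 2 * norm (orbit (lie_exp G v) - J)" if "v \<in> pp" "norm v < \<rho>" for v
  proof -
    have "norm v = norm (bracket G v J)" using norm_bracket_J[OF that(1)] by simp
    also have "\<dots> \<le> norm (orbit (lie_exp G v) - J) + norm (orbit (lie_exp G v) - J - bracket G v J)"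
      using norm_triangle_ineq4[of "orbit (lie_exp G v) - J" "orbit (lie_exp G v) - J - bracket G v J"] by simp
    finally show ?thesis using \<rho>(2)[OF that(2)] by simp
  qed
  obtain N where N: "open N" "\<one> \<in> N"
    "\<And>x. x \<in> N \<Longrightarrow> \<exists>v h. v \<in> pp \<and> norm v < \<rho> \<and> h \<in> K \<and> x = lie_exp G v \<otimes> h"
    using slice_neighbourhood[OF \<rho>(1)] by metis
  have pe: "plot UNIV (lie_exp G)" using plot_exp[OF smooth_on_id[of UNIV] open_UNIV] by simp
  have "open (lie_exp G -` N)" by (rule open_vimage[OF N(1) plot_continuous_on[OF pe]])
  moreover have "0 \<in> lie_exp G -` N" using N(2) by simp
  ultimately obtain r where r: "r > 0" "cball 0 r \<subseteq> lie_exp G -` N"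
    unfolding open_contains_cball by blast
  define NK where "NK = (\<Union>h\<in>K. (\<lambda>x. x \<otimes> h) ` N)"
  have oNK: "open NK" unfolding NK_def mult_right_image
    by (intro open_UN ballI open_vimage[OF N(1) continuous_on_mult_right])
  have NK_inv: "x \<otimes> h \<in> NK \<longleftrightarrow> x \<in> NK" if h: "h \<in> K" for x h
  proof
    show "x \<otimes> h \<in> NK" if "x \<in> NK"
    proof -
      from that obtain k y where "k \<in> K" "y \<in> N" "x = y \<otimes> k" by (auto simp: NK_def)
      then show ?thesis using K_mult[OF _ h] by (force simp: NK_def m_assoc)
    qed
    show "x \<in> NK" if "x \<otimes> h \<in> NK"
    proof -
      from that obtain k y where ky: "k \<in> K" "y \<in> N" "x \<otimes> h = y \<otimes> k" by (auto simp: NK_def)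
      have "x = (x \<otimes> h) \<otimes> inv h" by (simp add: m_assoc)
      also have "\<dots> = y \<otimes> (k \<otimes> inv h)" unfolding ky(3) by (simp add: m_assoc)
      finally show ?thesis using ky(1,2) K_mult[OF ky(1) K_inv[OF h]] by (auto simp: NK_def)
    qed
  qed
  have NKD: "\<exists>v h. v \<in> pp \<and> norm v < \<rho> \<and> h \<in> K \<and> x = lie_exp G v \<otimes> h" if "x \<in> NK" for x
  proof -
    from that obtain k y where ky: "k \<in> K" "y \<in> N" "x = y \<otimes> k" by (auto simp: NK_def)
    obtain v h where v: "v \<in> pp" "norm v < \<rho>" "h \<in> K" "y = lie_exp G v \<otimes> h" using N(3)[OF ky(2)] by blast
    have "x = lie_exp G v \<otimes> (h \<otimes> k)" by (simp add: ky(3) v(4) m_assoc)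
    then show ?thesis using v K_mult[OF v(3) ky(1)] by blast
  qed
  define L where "L = (\<lambda>(v, h). lie_exp G v \<otimes> h) ` ((cball 0 r \<inter> pp) \<times> K)"
  have "compact L" unfolding L_def
  proof (rule compact_continuous_image)
    have "continuous_on UNIV (\<lambda>(x, y). x \<otimes> y)" using mult_smooth by (simp add: smooth_map_on_def)
    then have c: "continuous_on ((cball 0 r \<inter> pp) \<times> K) (\<lambda>y. (\<lambda>(x, y). x \<otimes> y) (lie_exp G (fst y), snd y))"
      by (rule continuous_on_compose2)
        (auto intro!: continuous_on_Pair continuous_on_compose2[OF plot_continuous_on[OF pe] continuous_on_fst] continuous_on_snd continuous_on_id)
    then show "continuous_on ((cball 0 r \<inter> pp) \<times> K) (\<lambda>(v, h). lie_exp G v \<otimes> h)" by (simp add: case_prod_beta)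
    show "compact ((cball 0 r \<inter> pp) \<times> K)"
      by (intro compact_Times compact_Int_closed compact_cball closed_subspace subspace_p K_compact)
  qed
  then have L: "closed L" by (rule compact_imp_closed)
  have LNK: "L \<subseteq> NK" using r(2) by (force simp: L_def NK_def)
  \<comment> \<open>On \<open>NK\<close> outside \<open>L\<close> the slice coordinate has norm
    above \<open>r\<close>, so by \<open>est\<close> the orbit point has distance above
    \<open>r/2\<close> from J; this fixes the radius of the cutoff.\<close>
  let ?b = "\<lambda>x. flat 1 ((r/2)\<^sup>2 - (norm (orbit x - J))\<^sup>2)"
  define b where "b x = (if x \<in> NK then ?b x else 0)" for x
  have bsm: "smooth_fun G ?b"
  proof (rule smooth_funI)
    fix U c assume c: "(U, c) \<in> atlas G"
    show "smooth_on (c ` U) (\<lambda>y. ?b (inv_into U c y))"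
      by (rule smooth_on_compose[OF smooth_on_flat_ball[of UNIV] smooth_fun_plot[OF orbit_smooth plot_chart[OF c]]]) simp
  qed
  have far: "?b x = 0" if "x \<in> NK" "x \<notin> L" for x
  proof (rule flat_ball_zero)
    obtain v h where v: "v \<in> pp" "norm v < \<rho>" "h \<in> K" "x = lie_exp G v \<otimes> h" using NKD[OF \<open>x \<in> NK\<close>] by blast
    have "norm v > r"
    proof (rule ccontr)
      assume "\<not> norm v > r"
      then have "x \<in> L" using v by (force simp: L_def)
      then show False using \<open>x \<notin> L\<close> by simp
    qed
    then have "norm (orbit (lie_exp G v) - J) > r / 2" using est[OF v(1,2)] by simp
    then show "orbit x \<notin> cball J (r / 2)" by (simp add: v(4) orbit_K[OF v(3)] dist_norm norm_minus_commute)
  qed (use r in simp)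
  show thesis
  proof (rule that)
    show "smooth_fun G b"
      by (rule smooth_fun_glue[OF oNK open_Compl[OF L] _ bsm smooth_fun_const[of 0]])
        (use LNK far in \<open>auto simp: b_def\<close>)
    show "b (g \<otimes> h) = b g" if "h \<in> K" for g h
      by (simp add: b_def NK_inv[OF that] orbit_K[OF that])
    show "b \<one> > 0"
    proof -
      have "\<one> \<in> (\<lambda>x. x \<otimes> \<one>) ` N" by (rule image_eqI[OF _ N(2)]) simp
      then have "\<one> \<in> NK" using K_one unfolding NK_def by blast
      then show ?thesis using r(1) by (simp add: b_def orbit_def flat_one_pos)
    qed
    show "\<exists>v h. v \<in> pp \<and> norm v < \<rho> \<and> h \<in> K \<and> x = lie_exp G v \<otimes> h" if "b x > 0" for x
      by (rule NKD) (use that in \<open>simp add: b_def split: if_splits\<close>)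
  qed (use est \<rho>(1) in auto)
qed

end

section \<open>Tangent vectors of the quotient seen on the orbit\<close>

context hermitian_pair
begin

definition orbitq :: "'g set \<Rightarrow> 'a" where
  "orbitq S = orbit (rep S)"

lemma orbitq_proj [simp]: "orbitq (proj G K g) = orbit g"
  unfolding orbitq_def by (rule rep_invariant) (rule orbit_K)

lemma orbitq_component: "(\<lambda>S. orbitq S \<bullet> b) \<in> quot_smooth G K"
  unfolding orbitq_def
  by (rule quot_smooth_lift[OF smooth_fun_linear[OF bounded_linear_inner_left orbit_smooth]]) (simp add: orbit_K)

lemma quot_smoothD: "f \<in> quot_smooth G K \<Longrightarrow> smooth_fun G (f \<circ> proj G K)"
  by (simp add: quot_smooth_def)

lemma J_bracket_J: "v \<in> pp \<Longrightarrow> bracket G J (bracket G v J) = v"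
  by (subst bracket_anticomm[of v J]) (simp add: bracket_simps J_square)

text \<open>The components of \<open>orbitq\<close> already separate tangent vectors: they determine
  Ad_g [v, J], hence [v, J], and ad J returns v. This gives uniqueness in the description of
  \<open>frame_coord\<close>.\<close>

lemma frame_unique:
  assumes "v \<in> pp" "w \<in> pp" "\<And>f. f \<in> quot_smooth G K \<Longrightarrow> lder G v (f \<circ> proj G K) g = lder G w (f \<circ> proj G K) g"
  shows "v = w"
proof -
  have l: "lder G u ((\<lambda>S. orbitq S \<bullet> b) \<circ> proj G K) g = Ad G g (bracket G u J) \<bullet> b" for u b
    using lder_linear[OF bounded_linear_inner_left orbit_smooth, of u b g] by (simp add: comp_def lder_orbit)
  have "Ad G g (bracket G v J) = Ad G g (bracket G w J)"
  proof (rule euclidean_eqI)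
    fix b :: 'a
    show "Ad G g (bracket G v J) \<bullet> b = Ad G g (bracket G w J) \<bullet> b"
      using assms(3)[OF orbitq_component[of b]] unfolding l .
  qed
  then have "bracket G v J = bracket G w J" by (rule injD[OF bij_is_inj[OF bij_Ad]])
  then have "bracket G J (bracket G v J) = bracket G J (bracket G w J)" by (rule arg_cong)
  then show ?thesis by (simp only: J_bracket_J[OF assms(1)] J_bracket_J[OF assms(2)])
qed

lemma frame_coord_eq:
  assumes "v \<in> pp" "\<And>f. f \<in> quot_smooth G K \<Longrightarrow> D f = lder G v (f \<circ> proj G K) g"
  shows "frame_coord G K g D = v"
  unfolding frame_coord_def
proof (rule the_equality)
  fix w assume w: "w \<in> pp \<and> (\<forall>f\<in>quot_smooth G K. D f = lder G w (f \<circ> proj G K) g)"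
  show "w = v"
  proof (rule frame_unique[OF _ assms(1)])
    show "w \<in> pp" using w by blast
    fix f assume f: "f \<in> quot_smooth G K"
    show "lder G w (f \<circ> proj G K) g = lder G v (f \<circ> proj G K) g"
      using w f by (simp only: assms(2)[OF f, symmetric] bspec[OF conjunct2[OF w] f])
  qed
qed (intro conjI ballI assms)

text \<open>Tangent vectors of \<open>G/K\<close> that come from curves are represented in \<open>\<pp>\<close>. Near its base point
  such a curve is \<open>t \<mapsto> g exp(V(t))\<cdot>o\<close> with \<open>V\<close> in \<open>\<pp>\<close>, and \<open>V\<close> inherits differentiability at
  \<open>0\<close> from the curve \<open>Ad(exp V(t))J\<close>.\<close>

lemma curve_frame:
  assumes \<eta>0: "\<eta> 0 = proj G K g"
    and T: "open T" "0 \<in> T" "\<And>t::real. t \<in> T \<Longrightarrow> \<eta> t \<in> range (proj G K)"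
    and diff: "\<And>f. f \<in> quot_smooth G K \<Longrightarrow> \<exists>D. ((\<lambda>t. f (\<eta> t)) has_real_derivative D) (at 0)"
  obtains v where "v \<in> pp"
    "\<And>f. f \<in> quot_smooth G K \<Longrightarrow> ((\<lambda>t. f (\<eta> t)) has_real_derivative lder G v (f \<circ> proj G K) g) (at 0)"
proof (rule quotient_bump)
  fix b :: "'g \<Rightarrow> real" and \<rho>
  assume b: "smooth_fun G b" "\<And>g h. h \<in> K \<Longrightarrow> b (g \<otimes> h) = b g" "b \<one> > 0"
    "\<And>x. b x > 0 \<Longrightarrow> \<exists>v h. v \<in> pp \<and> norm v < \<rho> \<and> h \<in> K \<and> x = lie_exp G v \<otimes> h"
    "\<And>v. v \<in> pp \<Longrightarrow> norm v < \<rho> \<Longrightarrow> norm v \<le> 2 * norm (orbit (lie_exp G v) - J)" "\<rho> > 0"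
  let ?B = "\<lambda>S. b (inv g \<otimes> rep S)"
  have bK: "b (inv g \<otimes> (x \<otimes> h)) = b (inv g \<otimes> x)" if "h \<in> K" for x h
  proof -
    have "inv g \<otimes> (x \<otimes> h) = inv g \<otimes> x \<otimes> h" by (simp add: m_assoc)
    then show ?thesis using b(2)[OF that, of "inv g \<otimes> x"] by (rule ssubst)
  qed
  \<comment> \<open>The translated bump is itself a smooth function on the quotient, so it is
    continuous along \<eta> and stays positive for small t. This confines the curve to the slice
    around the coset of \<open>g\<close>.\<close>
  have B: "?B \<in> quot_smooth G K"
    by (rule quot_smooth_lift[of "\<lambda>x. b (inv g \<otimes> x)", OF smooth_fun_left[OF b(1)] bK])
  have B0: "?B (\<eta> 0) > 0"
    using rep_invariant[of "\<lambda>x. b (inv g \<otimes> x)" g, OF bK] b(3) by (simp add: \<eta>0)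
  obtain D where "((\<lambda>t. ?B (\<eta> t)) has_real_derivative D) (at 0)" using diff[OF B] by blast
  then have "isCont (\<lambda>t. ?B (\<eta> t)) 0" by (rule DERIV_isCont)
  then obtain \<delta> where \<delta>: "\<delta> > 0" "\<And>t. dist t 0 < \<delta> \<Longrightarrow> dist (?B (\<eta> t)) (?B (\<eta> 0)) < ?B (\<eta> 0)"
    using B0 unfolding continuous_at_eps_delta by blast
  define T1 where "T1 = T \<inter> ball 0 \<delta>"
  have T1: "open T1" "0 \<in> T1" using T \<delta>(1) by (auto simp: T1_def)
  have Bpos: "?B (\<eta> t) > 0" if "t \<in> T1" for t
    using \<delta>(2)[of t] that by (auto simp: T1_def dist_real_def dist_commute)
  define P where "P t v \<longleftrightarrow> v \<in> pp \<and> norm v < \<rho> \<and> (\<exists>h\<in>K. inv g \<otimes> rep (\<eta> t) = lie_exp G v \<otimes> h)" for t v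
  \<comment> \<open>A choice made separately for each t, with no regularity in t built in; the bound
    \<open>Vq\<close> in terms of the orbit curve is what controls it near 0.\<close>
  define V where "V t = (SOME v. P t v)" for t
  have PV: "P t (V t)" if "t \<in> T1" for t
    unfolding V_def by (rule someI_ex) (use b(4)[OF Bpos[OF that]] in \<open>auto simp: P_def\<close>)
  have Vp: "V t \<in> pp" "norm (V t) < \<rho>" if "t \<in> T1" for t using PV[OF that] by (auto simp: P_def)
  obtain h where h: "\<And>t. t \<in> T1 \<Longrightarrow> h t \<in> K" "\<And>t. t \<in> T1 \<Longrightarrow> inv g \<otimes> rep (\<eta> t) = lie_exp G (V t) \<otimes> h t"
    using PV unfolding P_def by metis
  have rep_eq: "rep (\<eta> t) = (g \<otimes> lie_exp G (V t)) \<otimes> h t" if "t \<in> T1" for t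
  proof -
    have "rep (\<eta> t) = g \<otimes> (inv g \<otimes> rep (\<eta> t))" by (simp add: m_assoc[symmetric])
    then show ?thesis unfolding h(2)[OF that] by (simp add: m_assoc)
  qed
  have \<eta>_eq: "\<eta> t = proj G K (g \<otimes> lie_exp G (V t))" if "t \<in> T1" for t
  proof -
    have "\<eta> t = proj G K (rep (\<eta> t))" using proj_rep T(3) that by (simp add: T1_def)
    then show ?thesis using rep_eq[OF that] proj_mult[OF h(1)[OF that]] by simp
  qed
  define q where "q S = orbit (inv g \<otimes> rep S) - J" for S
  have q_eq: "q (\<eta> t) = orbit (lie_exp G (V t)) - J" if "t \<in> T1" for t
    unfolding q_def h(2)[OF that] by (simp add: orbit_K[OF h(1)[OF that]])
  have q0: "q (\<eta> 0) = 0"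
    using rep_invariant[of "\<lambda>x. orbit (inv g \<otimes> x)" g] orbit_K by (simp add: q_def \<eta>0 m_assoc[symmetric] orbit_def)
  have "\<exists>w. ((\<lambda>t. q (\<eta> t)) has_vector_derivative w) (at 0)"
  proof -
    have "\<exists>D. ((\<lambda>t. q (\<eta> t) \<bullet> i) has_real_derivative D) (at 0)" for i
    proof (rule diff)
      have "smooth_fun G (\<lambda>x. (orbit (inv g \<otimes> x) - J) \<bullet> i)"
        by (intro smooth_fun_linear[OF bounded_linear_inner_left] smooth_fun_diff smooth_fun_left[OF orbit_smooth] smooth_fun_const)
      then show "(\<lambda>S. q S \<bullet> i) \<in> quot_smooth G K"
        unfolding q_def by (rule quot_smooth_lift) (simp add: m_assoc[symmetric] orbit_K)
    qed
    then obtain D where D: "\<And>i. ((\<lambda>t. q (\<eta> t) \<bullet> i) has_real_derivative D i) (at 0)" by metis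
    have "((\<lambda>t. q (\<eta> t)) has_derivative (\<lambda>h. h *\<^sub>R (\<Sum>i\<in>Basis. D i *\<^sub>R i))) (at 0)"
      unfolding has_derivative_componentwise_within[of "\<lambda>t. q (\<eta> t)"]
    proof
      fix i :: 'a assume i: "i \<in> Basis"
      have "((\<lambda>t. q (\<eta> t) \<bullet> i) has_derivative (\<lambda>h. h * D i)) (at 0)"
        using D[of i] by (simp add: has_field_derivative_def mult.commute[of _ "D i"])
      moreover have "(\<Sum>i\<in>Basis. D i *\<^sub>R i) \<bullet> i = D i"
        using i by (simp add: inner_sum_left_Basis)
      ultimately show "((\<lambda>t. q (\<eta> t) \<bullet> i) has_derivative (\<lambda>h. (h *\<^sub>R (\<Sum>i\<in>Basis. D i *\<^sub>R i)) \<bullet> i)) (at 0)" by simp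
    qed
    then show ?thesis unfolding has_vector_derivative_def by blast
  qed
  then obtain w where w: "((\<lambda>t. q (\<eta> t)) has_vector_derivative w) (at 0)" by blast
  have Vq: "norm (V t) \<le> 2 * norm (q (\<eta> t))" if "t \<in> T1" for t
    using b(5)[OF Vp[OF that]] q_eq[OF that] by simp
  have V0: "V 0 = 0" using Vq[OF T1(2)] q0 by simp
  define R where "R v = bracket G v J - (orbit (lie_exp G v) - J)" for v
  have R0: "R 0 = 0" by (simp add: R_def orbit_def bracket_simps)
  \<comment> \<open>\<open>R\<close> is o(v) by the expansion of the orbit map, and
    \<open>V t\<close> is O(t) by \<open>Vq\<close> because \<open>q (\<eta> t)\<close> is
    differentiable and vanishes at 0. Near 0 the norm of \<open>V t\<close> is at most 2 (|w| + 1)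
    |t|, which explains the constants.\<close>
  have "((\<lambda>t. R (V t)) has_derivative (\<lambda>h. 0)) (at 0)"
    unfolding has_derivative_at_alt
  proof (intro conjI allI impI)
    fix e :: real assume e: "e > 0"
    let ?c = "norm w + 1"
    have c: "?c > 0" by (simp add: add_nonneg_pos)
    obtain d1 where d1: "d1 > 0" "\<And>v. norm v < d1 \<Longrightarrow> norm (orbit (lie_exp G v) - J - bracket G v J) \<le> (e / (2 * ?c)) * norm v"
      using orbit_expansion[of "e / (2 * ?c)"] e c by auto
    have "\<forall>e>0. \<exists>d>0. \<forall>y. norm (y - 0) < d \<longrightarrow> norm (q (\<eta> y) - q (\<eta> 0) - (y - 0) *\<^sub>R w) \<le> e * norm (y - 0)"
      using w unfolding has_vector_derivative_def has_derivative_at_alt by blast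
    from this[rule_format, of 1] obtain d2 where d2: "d2 > 0" "\<And>y. norm y < d2 \<Longrightarrow> norm (q (\<eta> y) - y *\<^sub>R w) \<le> norm y"
      using q0 by auto
    obtain d3 where d3: "d3 > 0" "ball 0 d3 \<subseteq> T1" using T1 open_contains_ball by metis
    define d where "d = min (d1 / (2 * ?c)) (min d2 d3)"
    have dpos: "d > 0" using d1 d2 d3 c by (simp add: d_def)
    have "norm (R (V y)) \<le> e * norm y" if y: "norm y < d" for y
    proof -
      have yT: "y \<in> T1" using y d3 by (auto simp: d_def subset_iff dist_norm)
      have "norm (q (\<eta> y)) \<le> norm (q (\<eta> y) - y *\<^sub>R w) + norm (y *\<^sub>R w)"
        using norm_triangle_ineq[of "q (\<eta> y) - y *\<^sub>R w" "y *\<^sub>R w"] by simp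
      also have "\<dots> \<le> norm y + norm y * norm w" using d2(2)[of y] y by (simp add: d_def)
      finally have "norm (V y) \<le> 2 * (norm y * ?c)" using Vq[OF yT] by (simp add: algebra_simps)
      then have Vy: "norm (V y) \<le> 2 * ?c * norm y" by (simp add: algebra_simps)
      also have "\<dots> < 2 * ?c * (d1 / (2 * ?c))"
        using y c by (intro mult_strict_left_mono) (auto simp: d_def)
      also have "\<dots> = d1" using c by simp
      finally have "norm (R (V y)) \<le> (e / (2 * ?c)) * norm (V y)"
        using d1(2)[of "V y"] unfolding R_def by (metis norm_minus_commute)
      also have "\<dots> \<le> (e / (2 * ?c)) * (2 * ?c * norm y)"
        using Vy e c by (intro mult_left_mono) auto
      also have "\<dots> = e * norm y" using c by simp
      finally show ?thesis .
    qed
    then show "\<exists>d>0. \<forall>y. norm (y - 0) < d \<longrightarrow> norm (R (V y) - R (V 0) - 0) \<le> e * norm (y - 0)"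
      using dpos by (auto simp: V0 R0)
  qed simp
  then have RV: "((\<lambda>t. R (V t)) has_vector_derivative 0) (at 0)" by (simp add: has_vector_derivative_def)
  have lJ: "bounded_linear (bracket G J)" using linear_bracket linear_conv_bounded_linear by blast
  let ?v = "bracket G J w"
  have "((\<lambda>t. bracket G J (q (\<eta> t)) + bracket G J (R (V t))) has_vector_derivative bracket G J w + bracket G J 0) (at 0)"
    by (intro has_vector_derivative_add bounded_linear.has_vector_derivative[OF lJ] w RV)
  then have s: "((\<lambda>t. bracket G J (q (\<eta> t)) + bracket G J (R (V t))) has_vector_derivative ?v) (at 0)"
    by (simp add: bracket_simps)
  \<comment> \<open>The definition of \<open>R\<close> gives q + R = [V, J] along the curve.
    Applying ad J solves this for \<open>V\<close>, so \<open>V\<close> inherits its derivative at 0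
    from the two terms on the left.\<close>
  have V': "(V has_vector_derivative ?v) (at 0)"
  proof (rule has_vector_derivative_transform_within_open[OF s T1])
    fix t assume t: "t \<in> T1"
    have "q (\<eta> t) + R (V t) = bracket G (V t) J" by (simp add: q_eq[OF t] R_def)
    then have "bracket G J (q (\<eta> t)) + bracket G J (R (V t)) = bracket G J (bracket G (V t) J)"
      by (simp add: bracket_simps(1)[symmetric])
    then show "bracket G J (q (\<eta> t)) + bracket G J (R (V t)) = V t" by (simp add: J_bracket_J[OF Vp(1)[OF t]])
  qed
  show thesis
  proof (rule that)
    show "?v \<in> pp" by (rule J_bracket_p)
    fix f assume f: "f \<in> quot_smooth G K"
    let ?F = "f \<circ> proj G K"
    let ?\<Psi> = "\<lambda>v. ?F (g \<otimes> lie_exp G v)"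
    have sm: "smooth_on UNIV ?\<Psi>"
      by (intro smooth_fun_plot[OF quot_smoothD[OF f]] plot_mult plot_const plot_exp) auto
    let ?D = "frechet_derivative ?\<Psi> (at 0)"
    have D: "(?\<Psi> has_derivative ?D) (at 0)" by (rule smooth_on_has_derivative[OF sm]) simp
    have "lder G ?v ?F g = ?D ?v"
      using vector_derivative_at[OF smooth_on_has_vector_derivative_line[OF sm, of 0 0 ?v]] by (simp add: lder_def)
    moreover have "((\<lambda>t. ?\<Psi> (V t)) has_vector_derivative ?D ?v) (at 0)"
    proof -
      have "((\<lambda>t. ?\<Psi> (V t)) has_derivative (\<lambda>h. ?D (h *\<^sub>R ?v))) (at 0)"
        by (rule has_derivative_compose[OF V'[unfolded has_vector_derivative_def]]) (simp only: V0 D)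
      then show ?thesis by (simp only: has_vector_derivative_def linear_scale[OF has_derivative_linear[OF D]])
    qed
    ultimately have "((\<lambda>t. ?\<Psi> (V t)) has_vector_derivative lder G ?v ?F g) (at 0)" by simp
    then have "((\<lambda>t. f (\<eta> t)) has_vector_derivative lder G ?v ?F g) (at 0)"
      by (rule has_vector_derivative_transform_within_open[OF _ T1]) (simp add: \<eta>_eq)
    then show "((\<lambda>t. f (\<eta> t)) has_real_derivative lder G ?v ?F g) (at 0)"
      by (simp add: has_real_derivative_iff_has_vector_derivative)
  qed
qed

lemma orbitq_curve_derivative:
  assumes v: "\<And>f. f \<in> quot_smooth G K \<Longrightarrow> ((\<lambda>t. f (\<eta> t)) has_real_derivative lder G v (f \<circ> proj G K) g) (at 0)"
  shows "((\<lambda>t. orbitq (\<eta> t)) has_vector_derivative Ad G g (bracket G v J)) (at 0)"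
  unfolding has_vector_derivative_def has_derivative_componentwise_within[of "\<lambda>t. orbitq (\<eta> t)"]
proof
  fix i :: 'a assume "i \<in> Basis"
  have "lder G v ((\<lambda>S. orbitq S \<bullet> i) \<circ> proj G K) g = Ad G g (bracket G v J) \<bullet> i"
    using lder_linear[OF bounded_linear_inner_left orbit_smooth, of v i g] by (simp add: comp_def lder_orbit)
  then have "((\<lambda>t. orbitq (\<eta> t) \<bullet> i) has_real_derivative Ad G g (bracket G v J) \<bullet> i) (at 0)"
    using v[OF orbitq_component[of i]] by simp
  then show "((\<lambda>t. orbitq (\<eta> t) \<bullet> i) has_derivative (\<lambda>h. (h *\<^sub>R Ad G g (bracket G v J)) \<bullet> i)) (at 0)"
    by (simp add: has_field_derivative_def mult.commute[of _ "Ad G g (bracket G v J) \<bullet> i"])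
qed

text \<open>The Kaehler form is the Kirillov-Kostant-Souriau form of the adjoint orbit: Ad cancels
  by invariance, and ad J turns [v, J] back into v.\<close>

lemma kahler_orbit:
  assumes "v \<in> pp" "w \<in> pp"
  shows "Ad G g J \<bullet> bracket G (Ad G g (bracket G v J)) (Ad G g (bracket G w J)) = kahler G J v w"
proof -
  have "Ad G g J \<bullet> bracket G (Ad G g (bracket G v J)) (Ad G g (bracket G w J)) =
      bracket G (bracket G v J) (bracket G w J) \<bullet> J"
    by (simp add: Ad_bracket[symmetric] inner_commute)
  also have "\<dots> = - (bracket G w J \<bullet> bracket G (bracket G v J) J)" by (rule inner_bracket)
  also have "\<dots> = bracket G w J \<bullet> v"
    using bracket_anticomm[of "bracket G v J" J] by (simp add: J_bracket_J[OF assms(1)])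
  also have "\<dots> = - (v \<bullet> bracket G J w)" using bracket_anticomm[of w J] by (simp add: inner_commute)
  also have "\<dots> = kahler G J v w" by (simp add: kahler_def inner_bracket)
  finally show ?thesis .
qed

lemma tangent_triple_product:
  assumes "v1 \<in> pp" "v2 \<in> pp" "v3 \<in> pp"
  shows "Ad G g (bracket G v1 J) \<bullet> bracket G (Ad G g (bracket G v2 J)) (Ad G g (bracket G v3 J)) = 0"
proof -
  have p: "bracket G v J \<in> pp" if "v \<in> pp" for v by (rule bracket_pk[OF that J_k])
  have "bracket G v1 J \<bullet> bracket G (bracket G v2 J) (bracket G v3 J) = 0"
    by (rule inner_kp(2)[OF bracket_pp[OF p[OF assms(2)] p[OF assms(3)]] p[OF assms(1)]])
  then show ?thesis by (simp add: Ad_bracket[symmetric])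
qed

definition quot_map :: "('g \<Rightarrow> 'g set) \<Rightarrow> bool" where
  "quot_map \<psi> \<longleftrightarrow> range \<psi> \<subseteq> range (proj G K) \<and> (\<forall>f\<in>quot_smooth G K. smooth_fun G (\<lambda>x. f (\<psi> x)))"

text \<open>\<open>curve_frame\<close> is applied to t -> \<psi> (x exp(tX)) at the representative
  chosen by \<open>rep\<close>. One and the same \<open>v\<close> then describes the derivative of
  the orbit map and the value of \<open>frame_coord\<close> entering the Kaehler form.\<close>

lemma quot_map_differential:
  assumes \<psi>: "quot_map \<psi>"
  obtains v where "v \<in> pp" "lder G X (\<lambda>x. orbitq (\<psi> x)) x = Ad G (rep (\<psi> x)) (bracket G v J)"
    "frame_coord G K (rep (\<psi> x)) (differential G \<psi> x X) = v"
proof -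
  let ?\<eta> = "\<lambda>t::real. \<psi> (x \<otimes> lie_exp G (t *\<^sub>R X))" and ?g = "rep (\<psi> x)"
  have der: "((\<lambda>t. f (?\<eta> t)) has_real_derivative lder G X (f \<circ> \<psi>) x) (at 0)" if "f \<in> quot_smooth G K" for f
    using lder_has_vector_derivative[of "f \<circ> \<psi>" x X] \<psi> that
    by (simp add: quot_map_def has_real_derivative_iff_has_vector_derivative comp_def)
  obtain v where v: "v \<in> pp"
    "\<And>f. f \<in> quot_smooth G K \<Longrightarrow> ((\<lambda>t. f (?\<eta> t)) has_real_derivative lder G v (f \<circ> proj G K) ?g) (at 0)"
  proof (rule curve_frame[of ?\<eta> ?g UNIV])
    show "?\<eta> 0 = proj G K ?g" using proj_rep \<psi> by (auto simp: quot_map_def image_subset_iff)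
  qed (use \<psi> der in \<open>auto simp: quot_map_def\<close>)
  show thesis
  proof (rule that[OF v(1)])
    show "lder G X (\<lambda>x. orbitq (\<psi> x)) x = Ad G ?g (bracket G v J)"
      using vector_derivative_at[OF orbitq_curve_derivative[OF v(2)]] by (simp add: lder_def)
    show "frame_coord G K ?g (differential G \<psi> x X) = v"
      by (rule frame_coord_eq[OF v(1)]) (metis DERIV_unique der v(2) differential_def)
  qed
qed

lemma pullback_kahler_orbitq:
  assumes \<psi>: "quot_map \<psi>"
  shows "pullback_kahler G K J \<psi> x X Y =
    orbitq (\<psi> x) \<bullet> bracket G (lder G X (\<lambda>x. orbitq (\<psi> x)) x) (lder G Y (\<lambda>x. orbitq (\<psi> x)) x)"
proof -
  obtain v where v: "v \<in> pp" "lder G X (\<lambda>x. orbitq (\<psi> x)) x = Ad G (rep (\<psi> x)) (bracket G v J)"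
    "frame_coord G K (rep (\<psi> x)) (differential G \<psi> x X) = v" by (rule quot_map_differential[OF \<psi>])
  obtain w where w: "w \<in> pp" "lder G Y (\<lambda>x. orbitq (\<psi> x)) x = Ad G (rep (\<psi> x)) (bracket G w J)"
    "frame_coord G K (rep (\<psi> x)) (differential G \<psi> x Y) = w" by (rule quot_map_differential[OF \<psi>])
  have e: "orbitq (\<psi> x) = Ad G (rep (\<psi> x)) J" by (simp add: orbitq_def orbit_def)
  show ?thesis
    unfolding v(2) w(2) e kahler_orbit[OF v(1) w(1)]
    by (simp add: pullback_kahler_def kahler_form_def rep_def[symmetric] v(3) w(3))
qed

end

section \<open>The second variation formula\<close>

locale framed_pair = hermitian_pair G \<mu> K J
  for G :: "('g::{t2_space, second_countable_topology}, 'a::euclidean_space, real^'m) lie_data"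
    (structure) and \<mu> :: "'g measure" and K :: "'g set" and J :: 'a +
  fixes e :: "nat \<Rightarrow> 'a" and m n :: nat and lam :: real
  assumes m_dim: "m = DIM('a)"
    and orthonormal: "\<forall>i\<in>{1..m}. \<forall>j\<in>{1..m}. e i \<bullet> e j = (if i = j then 1 else 0)"
    and span_k: "span (e ` {1..m-n}) = lie_sub G K"
    and span_p: "span (e ` {m-n+1..m}) = lie_compl G K"
    and casimir: "\<forall>X. - (\<Sum>k=1..m. bracket G (e k) (bracket G (e k) X)) = lam *\<^sub>R X"
begin

declare One_nat_def [simp del]

section \<open>Sums over the adapted frame\<close>

lemma frame_expansion: "(\<Sum>k=1..m. (X \<bullet> e k) *\<^sub>R e k) = X"
proof -
  let ?S = "e ` {1..m}"
  have inj: "inj_on e {1..m}"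
  proof (rule inj_onI)
    fix i j assume ij: "i \<in> {1..m}" "j \<in> {1..m}" "e i = e j"
    have "e i \<bullet> e j = 1" using orthonormal ij by auto
    then show "i = j" using orthonormal ij(1,2) by (metis zero_neq_one)
  qed
  have "pairwise orthogonal ?S"
    using orthonormal by (auto simp: pairwise_def orthogonal_def)
  moreover have "0 \<notin> ?S"
  proof
    assume "0 \<in> ?S"
    then obtain i where "i \<in> {1..m}" "e i = 0" by auto
    then show False using orthonormal by force
  qed
  ultimately have "independent ?S" by (rule pairwise_orthogonal_independent)
  moreover have "card ?S = DIM('a)" using card_image[OF inj] m_dim by simp
  ultimately have span: "span ?S = UNIV"
    using card_ge_dim_independent[of ?S UNIV] by (simp add: top.extremum_unique)
  let ?y = "X - (\<Sum>k=1..m. (X \<bullet> e k) *\<^sub>R e k)"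
  have "?y \<bullet> e j = 0" if j: "j \<in> {1..m}" for j
  proof -
    have "(\<Sum>k=1..m. (X \<bullet> e k) *\<^sub>R e k) \<bullet> e j = (\<Sum>k=1..m. if k = j then X \<bullet> e j else 0)"
      unfolding inner_sum_left by (rule sum.cong) (use orthonormal j in auto)
    also have "\<dots> = X \<bullet> e j" using j by simp
    finally show ?thesis by (simp add: inner_diff_left)
  qed
  then have "orthogonal ?y x" if "x \<in> span ?S" for x
    using that by (intro orthogonal_to_span[OF that]) (auto simp: orthogonal_def)
  then have "orthogonal ?y ?y" using span by blast
  then show ?thesis by (simp add: orthogonal_self)
qed

lemma frame_linear:
  assumes "linear f" shows "(\<Sum>k=1..m. (X \<bullet> e k) *\<^sub>R f (e k)) = f X"
proof -
  have "f X = f (\<Sum>k=1..m. (X \<bullet> e k) *\<^sub>R e k)" by (simp only: frame_expansion)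
  then show ?thesis by (simp add: linear_sum[OF assms] linear_scale[OF assms])
qed

text \<open>Both sums are the squared norm of the vector that represents \<open>L\<close>. It moves
  the energy from the standard basis used in \<open>form_norm_sq\<close> to the adapted
  frame.\<close>

lemma frame_norm_sq:
  fixes L :: "'a \<Rightarrow> real"
  assumes "linear L" shows "(\<Sum>b\<in>Basis. (L b)\<^sup>2) = (\<Sum>k=1..m. (L (e k))\<^sup>2)"
proof -
  define v where "v = (\<Sum>b\<in>Basis. L b *\<^sub>R b)"
  have L: "L x = v \<bullet> x" for x
  proof -
    have "L x = L (\<Sum>b\<in>Basis. (x \<bullet> b) *\<^sub>R b)" by (simp only: euclidean_representation)
    also have "\<dots> = v \<bullet> x"
      by (simp add: linear_sum[OF assms] linear_scale[OF assms] v_def inner_sum_left mult.commute inner_commute[of x])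
    finally show ?thesis .
  qed
  have "(\<Sum>b\<in>Basis. (L b)\<^sup>2) = v \<bullet> v"
    unfolding L by (simp add: euclidean_inner[of v v] power2_eq_square)
  also have "\<dots> = (\<Sum>k=1..m. (v \<bullet> e k) *\<^sub>R e k) \<bullet> v" by (simp only: frame_expansion)
  also have "\<dots> = (\<Sum>k=1..m. (L (e k))\<^sup>2)"
    unfolding inner_sum_left L by (rule sum.cong) (simp_all add: power2_eq_square inner_commute)
  finally show ?thesis .
qed

lemma e_k: "a \<in> {1..m-n} \<Longrightarrow> e a \<in> kk" and e_p: "r \<in> {m-n+1..m} \<Longrightarrow> e r \<in> pp"
  using span_base[of "e a" "e ` {1..m-n}"] span_base[of "e r" "e ` {m-n+1..m}"]
  unfolding span_k span_p by auto

lemma sum_split: "(\<Sum>k=1..m. f k) = (\<Sum>a=1..m-n. f a) + (\<Sum>r=m-n+1..m. f r)"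
  for f :: "nat \<Rightarrow> 'b::ab_group_add"
  using sum.ub_add_nat[of 1 "m - n" f "m - (m - n)"] by (cases "m - n = 0") simp_all

lemma casimir': "(\<Sum>k=1..m. bracket G (e k) (bracket G (e k) X)) = - (lam *\<^sub>R X)"
  using casimir by (metis add.inverse_inverse)

lemma sum_p:
  assumes "X \<in> pp" "linear f" shows "(\<Sum>r=m-n+1..m. (X \<bullet> e r) *\<^sub>R f (e r)) = f X"
proof -
  have "(\<Sum>a=1..m-n. (X \<bullet> e a) *\<^sub>R f (e a)) = 0"
    by (rule sum.neutral) (use inner_kp(2)[OF e_k assms(1)] in simp)
  then show ?thesis using frame_linear[OF assms(2), of X] unfolding sum_split[of "\<lambda>k. (X \<bullet> e k) *\<^sub>R f (e k)"] by simp
qed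

lemma sum_k:
  assumes "X \<in> kk" "linear f" shows "(\<Sum>a=1..m-n. (X \<bullet> e a) *\<^sub>R f (e a)) = f X"
proof -
  have "(\<Sum>r=m-n+1..m. (X \<bullet> e r) *\<^sub>R f (e r)) = 0"
    by (rule sum.neutral) (use inner_kp(1)[OF assms(1) e_p] in simp)
  then show ?thesis using frame_linear[OF assms(2), of X] unfolding sum_split[of "\<lambda>k. (X \<bullet> e k) *\<^sub>R f (e k)"] by simp
qed

text \<open>The exterior derivative of the one-form <w, -> evaluated on two left-invariant fields,
  with the convention d\<alpha>(X, Y) = X \<alpha>(Y) - Y \<alpha>(X) - \<alpha>([X, Y]).\<close>

definition curl :: "('g \<Rightarrow> 'a) \<Rightarrow> 'a \<Rightarrow> 'a \<Rightarrow> 'g \<Rightarrow> real" where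
  "curl w X Y g = lder G X w g \<bullet> Y - lder G Y w g \<bullet> X - w g \<bullet> bracket G X Y"

lemma curl_antisym: "curl w Y X g = - curl w X Y g"
  using bracket_anticomm[of Y X] by (simp add: curl_def)

lemma smooth_fun_inner_const: "smooth_fun G f \<Longrightarrow> smooth_fun G (\<lambda>g. f g \<bullet> c)"
  by (rule smooth_fun_linear[OF bounded_linear_inner_left])

lemma curl_smooth: "smooth_fun G w \<Longrightarrow> smooth_fun G (curl w X Y)"
  unfolding curl_def by (intro smooth_fun_diff smooth_fun_inner_const smooth_fun_lder)

lemma bounded_linear_J: "bounded_linear (bracket G J)"
  using linear_bracket linear_conv_bounded_linear by blast

text \<open>The formal adjoint of \<open>curl\<close> applied to \<open>curl u\<close>.\<close>

definition cocurl :: "('g \<Rightarrow> 'a) \<Rightarrow> 'g \<Rightarrow> 'a" where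
  "cocurl u g = - (\<Sum>k=1..m. \<Sum>l=1..m. lder G (e k) (curl u (e k) (e l)) g *\<^sub>R e l)
     - (1/2) *\<^sub>R (\<Sum>k=1..m. \<Sum>l=1..m. curl u (e k) (e l) g *\<^sub>R bracket G (e k) (e l))"

text \<open>The pointwise form of integration by parts: the first sum on the right is a divergence
  and integrates to 0 by \<open>integral_lder\<close>. Antisymmetry of \<open>curl u\<close> merges
  the two derivative terms of \<open>curl v\<close> into twice one of them, which absorbs the factor
  1/2; the bracket term keeps it, as in \<open>cocurl\<close>.\<close>

lemma curl_integration_by_parts:
  assumes u: "smooth_fun G u" and v: "smooth_fun G v"
  shows "(1/2) * (\<Sum>k=1..m. \<Sum>l=1..m. curl v (e k) (e l) g * curl u (e k) (e l) g) =
    (\<Sum>k=1..m. lder G (e k) (\<lambda>g. \<Sum>l=1..m. (v g \<bullet> e l) * curl u (e k) (e l) g) g) + v g \<bullet> cocurl u g"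
proof -
  let ?F = "\<lambda>k l. curl u (e k) (e l)"
  have lp: "lder G (e k) (\<lambda>g. (v g \<bullet> e l) * ?F k l g) g = (v g \<bullet> e l) * lder G (e k) (?F k l) g + (lder G (e k) v g \<bullet> e l) * ?F k l g" for k l
    using lder_bilinear[OF bounded_bilinear_mult smooth_fun_inner_const[OF v] curl_smooth[OF u], of "e k" "e l" "e k" "e l" g]
      lder_linear[OF bounded_linear_inner_left v, of "e k" "e l" g] by simp
  have "lder G (e k) (\<lambda>g. \<Sum>l=1..m. (v g \<bullet> e l) * ?F k l g) g =
      (\<Sum>l=1..m. (v g \<bullet> e l) * lder G (e k) (?F k l) g + (lder G (e k) v g \<bullet> e l) * ?F k l g)" for k
    by (subst lder_sum) (simp_all add: lp smooth_fun_bilinear[OF bounded_bilinear_mult smooth_fun_inner_const[OF v] curl_smooth[OF u]])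
  then have d: "(\<Sum>k=1..m. lder G (e k) (\<lambda>g. \<Sum>l=1..m. (v g \<bullet> e l) * ?F k l g) g) =
     (\<Sum>k=1..m. \<Sum>l=1..m. (v g \<bullet> e l) * lder G (e k) (?F k l) g) + (\<Sum>k=1..m. \<Sum>l=1..m. (lder G (e k) v g \<bullet> e l) * ?F k l g)"
    by (simp add: sum.distrib)
  have sw: "(\<Sum>k=1..m. \<Sum>l=1..m. (lder G (e l) v g \<bullet> e k) * ?F k l g) = - (\<Sum>k=1..m. \<Sum>l=1..m. (lder G (e k) v g \<bullet> e l) * ?F k l g)"
  proof -
    have "(\<Sum>k=1..m. \<Sum>l=1..m. (lder G (e l) v g \<bullet> e k) * ?F k l g) = (\<Sum>k=1..m. \<Sum>l=1..m. - ((lder G (e l) v g \<bullet> e k) * ?F l k g))"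
      by (intro sum.cong refl, subst curl_antisym) simp
    also have "\<dots> = - (\<Sum>k=1..m. \<Sum>l=1..m. (lder G (e l) v g \<bullet> e k) * ?F l k g)"
      by (simp only: sum_negf)
    also have "(\<Sum>k=1..m. \<Sum>l=1..m. (lder G (e l) v g \<bullet> e k) * ?F l k g) = (\<Sum>k=1..m. \<Sum>l=1..m. (lder G (e k) v g \<bullet> e l) * ?F k l g)"
      by (rule sum.swap)
    finally show ?thesis .
  qed
  have "(\<Sum>k=1..m. \<Sum>l=1..m. curl v (e k) (e l) g * ?F k l g) =
     (\<Sum>k=1..m. \<Sum>l=1..m. (lder G (e k) v g \<bullet> e l) * ?F k l g) - (\<Sum>k=1..m. \<Sum>l=1..m. (lder G (e l) v g \<bullet> e k) * ?F k l g)
      - (\<Sum>k=1..m. \<Sum>l=1..m. (v g \<bullet> bracket G (e k) (e l)) * ?F k l g)"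
    by (simp add: curl_def[of v] left_diff_distrib sum_subtractf)
  moreover have "v g \<bullet> cocurl u g = - (\<Sum>k=1..m. \<Sum>l=1..m. (v g \<bullet> e l) * lder G (e k) (?F k l) g)
      - (1/2) * (\<Sum>k=1..m. \<Sum>l=1..m. (v g \<bullet> bracket G (e k) (e l)) * ?F k l g)"
    by (simp add: cocurl_def inner_diff_right inner_sum_right mult.commute)
  ultimately show ?thesis using d sw by simp
qed

text \<open>The coefficient 2 of the bracket sum has two equal sources: the bracket term inside the
  differentiated \<open>curl\<close>, and the derivative terms contracted with [e_k, e_l].
  Contracting <u, [e_k, e_l]> with [e_k, e_l] gives the Casimir operator applied to u, hence lam u,
  and the factor 1/2 in \<open>cocurl\<close> leaves lam/2.\<close>

lemma cocurl_eq:
  assumes u: "smooth_fun G u"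
  shows "cocurl u g = - (\<Sum>k=1..m. lder G (e k) (lder G (e k) u) g)
    + (\<Sum>k=1..m. \<Sum>l=1..m. (lder G (e k) (lder G (e l) u) g \<bullet> e k) *\<^sub>R e l)
    - 2 *\<^sub>R (\<Sum>k=1..m. bracket G (e k) (lder G (e k) u g)) + (lam / 2) *\<^sub>R u g"
proof -
  let ?A = "\<lambda>k l. lder G (e k) (lder G (e l) u) g" and ?B = "\<lambda>k. lder G (e k) u g" and ?U = "u g"
  note sm = smooth_fun_lder[OF u]
  have dF: "lder G (e k) (curl u (e k) (e l)) g = ?A k k \<bullet> e l - ?A k l \<bullet> e k - ?B k \<bullet> bracket G (e k) (e l)" for k l
    unfolding curl_def
    by (simp add: lder_diff lder_linear[OF bounded_linear_inner_left] smooth_fun_diff smooth_fun_inner_const sm u)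
  have br: "(\<Sum>l=1..m. (w \<bullet> bracket G (e k) (e l)) *\<^sub>R f (e l)) = - f (bracket G (e k) w)" if "linear f" for w k f
  proof -
    have "(\<Sum>l=1..m. (bracket G (e k) w \<bullet> e l) *\<^sub>R f (e l)) = f (bracket G (e k) w)" by (rule frame_linear[OF that])
    then have "- (\<Sum>l=1..m. (w \<bullet> bracket G (e k) (e l)) *\<^sub>R f (e l)) = f (bracket G (e k) w)"
      by (simp add: inner_bracket sum_negf)
    then show ?thesis by (metis add.inverse_inverse)
  qed
  have id: "linear (\<lambda>x::'a. x)" by (simp add: linear_iff)
  have a: "(\<Sum>k=1..m. \<Sum>l=1..m. lder G (e k) (curl u (e k) (e l)) g *\<^sub>R e l) =
     (\<Sum>k=1..m. ?A k k) - (\<Sum>k=1..m. \<Sum>l=1..m. (?A k l \<bullet> e k) *\<^sub>R e l) + (\<Sum>k=1..m. bracket G (e k) (?B k))"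
    by (simp add: dF scaleR_diff_left sum_subtractf frame_expansion br[OF id] sum_negf sum.distrib)
  have b: "(\<Sum>k=1..m. \<Sum>l=1..m. curl u (e k) (e l) g *\<^sub>R bracket G (e k) (e l)) =
      2 *\<^sub>R (\<Sum>k=1..m. bracket G (e k) (?B k)) - lam *\<^sub>R ?U"
  proof -
    have "(\<Sum>k=1..m. \<Sum>l=1..m. (?B k \<bullet> e l) *\<^sub>R bracket G (e k) (e l)) = (\<Sum>k=1..m. bracket G (e k) (?B k))"
      by (simp add: frame_linear[OF linear_bracket])
    moreover have "(\<Sum>k=1..m. \<Sum>l=1..m. (?B l \<bullet> e k) *\<^sub>R bracket G (e k) (e l)) = - (\<Sum>l=1..m. bracket G (e l) (?B l))"
    proof -
      have "(\<Sum>k=1..m. \<Sum>l=1..m. (?B l \<bullet> e k) *\<^sub>R bracket G (e k) (e l)) = (\<Sum>l=1..m. bracket G (?B l) (e l))"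
        by (subst sum.swap) (simp add: frame_linear[OF linear_bracket_left])
      also have "\<dots> = (\<Sum>l=1..m. - bracket G (e l) (?B l))"
        by (rule sum.cong[OF refl]) (rule bracket_anticomm)
      finally show ?thesis by (simp add: sum_negf)
    qed
    moreover have "(\<Sum>k=1..m. \<Sum>l=1..m. (?U \<bullet> bracket G (e k) (e l)) *\<^sub>R bracket G (e k) (e l)) = lam *\<^sub>R ?U"
      using casimir'[of ?U] by (simp add: br[OF linear_bracket] sum_negf)
    ultimately show ?thesis
      by (simp add: curl_def scaleR_diff_left sum_subtractf scaleR_2)
  qed
  show ?thesis
    unfolding cocurl_def a b by (simp add: scaleR_diff_right scaleR_2 algebra_simps flip: scaleR_add_left)
qed

section \<open>From the adjoint of the curl to the stated formula\<close>

lemma sections_smooth: "Y \<in> sections G K \<Longrightarrow> smooth_fun G Y" and sections_p: "Y \<in> sections G K \<Longrightarrow> Y g \<in> pp"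
  by (auto simp: sections_def)

lemma lder_section: "Y \<in> sections G K \<Longrightarrow> lder G X Y \<in> sections G K"
proof -
  assume Y: "Y \<in> sections G K"
  have "lder G X Y g \<in> pp" for g
    by (rule derivative_in_subspace[OF subspace_p lder_has_vector_derivative[OF sections_smooth[OF Y]]]) (rule sections_p[OF Y])
  then show ?thesis using smooth_fun_lder[OF sections_smooth[OF Y]] by (auto simp: sections_def)
qed

definition second_variation_formula :: "('g \<Rightarrow> 'a) \<Rightarrow> 'g \<Rightarrow> 'a" where
  "second_variation_formula Y = (\<lambda>g.
    - bracket G J
        (- (lam / 2) *\<^sub>R lder G J Y g
         - bracket G J (\<Sum>k=1..m. lder G (e k) (lder G (e k) Y) g)
         + (3/2) *\<^sub>R bracket G J (\<Sum>a=1..m-n. bracket G (lder G (e a) Y g) (e a))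
         + (\<Sum>r=m-n+1..m. \<Sum>s=m-n+1..m.
              kahler G J (lder G (e r) (lder G (e s) Y) g
                          - (1/2) *\<^sub>R lder G (bracket G (e r) (e s)) Y g) (e r) *\<^sub>R e s)))"

text \<open>The right-hand side is what the variational computation produces. The outer ad J
  annihilates \<kk>, which cuts the frame sums down to the ranges of the formula. The term lam/2
  [J, Y] in \<open>cocurl\<close> becomes +lam/2 Y and cancels -lam/2 Y, so that only the derivative
  along J keeps the eigenvalue.\<close>

lemma second_variation_formula_cocurl:
  assumes Y: "Y \<in> sections G K"
  shows "second_variation_formula Y g =
    - bracket G J (cocurl (\<lambda>g. bracket G J (Y g)) g) - (lam / 2) *\<^sub>R (Y g - bracket G J (lder G J Y g))"
proof -
  let ?b = "bracket G"
  let ?u = "\<lambda>g. ?b J (Y g)"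
  note Ys = sections_smooth[OF Y]
  note lY = sections_p[OF lder_section[OF Y]] and sY = sections_smooth[OF lder_section[OF Y]]
  note llY = sections_p[OF lder_section[OF lder_section[OF Y]]]
  have u: "smooth_fun G ?u" by (rule smooth_fun_linear[OF bounded_linear_J Ys])
  have lu: "lder G X ?u = (\<lambda>g. ?b J (lder G X Y g))" for X
    using lder_linear[OF bounded_linear_J Ys] by (simp add: fun_eq_iff)
  have llu: "lder G X (lder G Z ?u) g = ?b J (lder G X (lder G Z Y) g)" for X Z
    unfolding lu using lder_linear[OF bounded_linear_J sY] by simp
  let ?A = "\<lambda>k l. ?b J (lder G (e k) (lder G (e l) Y) g)"
  let ?S1 = "\<Sum>k=1..m. lder G (e k) (lder G (e k) Y) g"
  let ?S2 = "\<Sum>a=1..m-n. ?b (lder G (e a) Y g) (e a)"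
  let ?SA = "\<Sum>r=m-n+1..m. \<Sum>s=m-n+1..m. (?A r s \<bullet> e r) *\<^sub>R e s"
  have c1: "(\<Sum>k=1..m. lder G (e k) (lder G (e k) ?u) g) = ?b J ?S1"
    by (simp add: llu linear_sum[OF linear_bracket])
  \<comment> \<open>Indices in \<kk> drop out for two reasons: ad J kills \<open>e l\<close>, and
    \<open>e k\<close> is orthogonal to the image of ad J, which lies in \<pp>.\<close>
  have c2: "?b J (\<Sum>k=1..m. \<Sum>l=1..m. (lder G (e k) (lder G (e l) ?u) g \<bullet> e k) *\<^sub>R e l) = ?b J ?SA"
  proof -
    have "(\<Sum>l=1..m. (?A k l \<bullet> e k) *\<^sub>R ?b J (e l)) = (\<Sum>l=m-n+1..m. (?A k l \<bullet> e k) *\<^sub>R ?b J (e l))" for k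
      unfolding sum_split[of "\<lambda>l. (?A k l \<bullet> e k) *\<^sub>R ?b J (e l)"] by (simp add: J_central(1)[OF e_k])
    moreover have "(\<Sum>k=1..m. \<Sum>l=m-n+1..m. (?A k l \<bullet> e k) *\<^sub>R ?b J (e l)) =
      (\<Sum>k=m-n+1..m. \<Sum>l=m-n+1..m. (?A k l \<bullet> e k) *\<^sub>R ?b J (e l))"
      unfolding sum_split[of "\<lambda>k. \<Sum>l=m-n+1..m. (?A k l \<bullet> e k) *\<^sub>R ?b J (e l)"]
      by (simp add: inner_kp(2)[OF e_k J_bracket_p])
    ultimately show ?thesis
      by (simp add: llu linear_sum[OF linear_bracket] linear_scale[OF linear_bracket])
  qed
  have Ja: "?b (?b J w) (e a) = ?b J (?b w (e a))" if "a \<in> {1..m-n}" for w a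
    using jacobi[of J w "e a"] J_central(1)[OF e_k[OF that]] by (simp add: bracket_simps)
  \<comment> \<open>Directions in \<pp> contribute nothing, since the bracket of two vectors of
    \<pp> lies in \<kk> and is killed by J. For directions in \<kk>, ad J commutes with the bracket
    because J is central.\<close>
  have c3: "?b J (\<Sum>k=1..m. ?b (e k) (lder G (e k) ?u g)) = - ?b J (?b J ?S2)"
  proof -
    have p: "?b J (?b (e r) (?b J (lder G (e r) Y g))) = 0" if "r \<in> {m-n+1..m}" for r
      by (rule J_central(1)[OF bracket_pp[OF e_p[OF that] J_bracket_p]])
    have "?b (e a) (?b J (lder G (e a) Y g)) = - ?b J (?b (lder G (e a) Y g) (e a))" if "a \<in> {1..m-n}" for a
      using Ja[OF that, of "lder G (e a) Y g"] bracket_anticomm[of "e a" "?b J (lder G (e a) Y g)"] by simp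
    then have "(\<Sum>a=1..m-n. ?b J (?b (e a) (?b J (lder G (e a) Y g)))) = - (?b J (?b J ?S2))"
      by (simp add: bracket_simps linear_sum[OF linear_bracket] sum_negf)
    moreover have "(\<Sum>r=m-n+1..m. ?b J (?b (e r) (?b J (lder G (e r) Y g)))) = 0"
      by (rule sum.neutral) (use p in blast)
    ultimately show ?thesis
      unfolding lu linear_sum[OF linear_bracket, of J]
        sum_split[of "\<lambda>k. ?b J (?b (e k) (?b J (lder G (e k) Y g)))"] by simp
  qed
  \<comment> \<open>[e_r, e_s] lies in \<kk>, so the derivative along it expands over e_1, ...,
    e_(m-n). Summing over r and moving the bracket across the inner product turns the double sum
    over \<pp> into the sum \<open>?S2\<close> over \<kk>.\<close>
  have c4: "(\<Sum>r=m-n+1..m. \<Sum>s=m-n+1..m. (?b J (lder G (?b (e r) (e s)) Y g) \<bullet> e r) *\<^sub>R e s) = - ?b J ?S2"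
  proof -
    let ?w = "\<lambda>a. ?b J (lder G (e a) Y g)"
    have lin: "linear (\<lambda>X. ?b J (lder G X Y g))"
      using linear_compose[OF lder_linear_in[OF Ys] linear_bracket] by (simp add: comp_def)
    have "?b J (lder G (?b (e r) (e s)) Y g) = (\<Sum>a=1..m-n. (?b (e r) (e s) \<bullet> e a) *\<^sub>R ?w a)"
      if "r \<in> {m-n+1..m}" "s \<in> {m-n+1..m}" for r s
      by (rule sum_k[OF bracket_pp[OF e_p[OF that(1)] e_p[OF that(2)]] lin, symmetric])
    then have "(\<Sum>r=m-n+1..m. \<Sum>s=m-n+1..m. (?b J (lder G (?b (e r) (e s)) Y g) \<bullet> e r) *\<^sub>R e s) =
      (\<Sum>r=m-n+1..m. \<Sum>s=m-n+1..m. \<Sum>a=1..m-n. ((?b (e r) (e s) \<bullet> e a) * (?w a \<bullet> e r)) *\<^sub>R e s)"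
      by (intro sum.cong refl) (simp add: inner_sum_left scaleR_sum_left)
    also have "\<dots> = (\<Sum>s=m-n+1..m. \<Sum>a=1..m-n. \<Sum>r=m-n+1..m. ((?b (e r) (e s) \<bullet> e a) * (?w a \<bullet> e r)) *\<^sub>R e s)"
      by (subst sum.swap, rule sum.cong[OF refl], rule sum.swap)
    also have "\<dots> = (\<Sum>s=m-n+1..m. \<Sum>a=1..m-n. - (?b (?w a) (e a) \<bullet> e s) *\<^sub>R e s)"
    proof (intro sum.cong refl)
      fix s a assume "a \<in> {1..m-n}"
      have "(\<Sum>r=m-n+1..m. (?w a \<bullet> e r) *\<^sub>R ?b (e r) (e s)) = ?b (?w a) (e s)"
        by (rule sum_p[OF J_bracket_p linear_bracket_left])
      from arg_cong[OF this, of "\<lambda>x. x \<bullet> e a"]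
      have "(\<Sum>r=m-n+1..m. (?w a \<bullet> e r) * (?b (e r) (e s) \<bullet> e a)) = ?b (?w a) (e s) \<bullet> e a"
        by (simp only: inner_sum_left inner_scaleR_left)
      also have "\<dots> = - (?b (?w a) (e a) \<bullet> e s)"
        using inner_bracket[of "?w a" "e s" "e a"] by (simp only: inner_commute[of "e s"])
      finally show "(\<Sum>r=m-n+1..m. ((?b (e r) (e s) \<bullet> e a) * (?w a \<bullet> e r)) *\<^sub>R e s) = - (?b (?w a) (e a) \<bullet> e s) *\<^sub>R e s"
        by (simp add: scaleR_sum_left[symmetric] mult.commute)
    qed
    also have "\<dots> = (\<Sum>a=1..m-n. - (\<Sum>s=m-n+1..m. (?b (?w a) (e a) \<bullet> e s) *\<^sub>R e s))"
      by (subst sum.swap) (simp add: sum_negf)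
    also have "\<dots> = (\<Sum>a=1..m-n. - ?b J (?b (lder G (e a) Y g) (e a)))"
    proof (rule sum.cong[OF refl])
      fix a assume a: "a \<in> {1..m-n}"
      have "(\<Sum>s=m-n+1..m. (?b (?w a) (e a) \<bullet> e s) *\<^sub>R e s) = ?b (?w a) (e a)"
        by (rule sum_p[OF bracket_pk[OF J_bracket_p e_k[OF a]]]) (simp add: linear_iff)
      then show "- (\<Sum>s=m-n+1..m. (?b (?w a) (e a) \<bullet> e s) *\<^sub>R e s) = - ?b J (?b (lder G (e a) Y g) (e a))"
        by (simp add: Ja[OF a])
    qed
    also have "\<dots> = - ?b J ?S2" by (simp add: sum_negf linear_sum[OF linear_bracket])
    finally show ?thesis .
  qed
  have c5: "(\<Sum>r=m-n+1..m. \<Sum>s=m-n+1..m. kahler G J (lder G (e r) (lder G (e s) Y) g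
                          - (1/2) *\<^sub>R lder G (bracket G (e r) (e s)) Y g) (e r) *\<^sub>R e s) = ?SA + (1/2) *\<^sub>R ?b J ?S2"
  proof -
    have "(\<Sum>r=m-n+1..m. \<Sum>s=m-n+1..m. kahler G J (lder G (e r) (lder G (e s) Y) g
                          - (1/2) *\<^sub>R lder G (bracket G (e r) (e s)) Y g) (e r) *\<^sub>R e s) =
      ?SA - (1/2) *\<^sub>R (\<Sum>r=m-n+1..m. \<Sum>s=m-n+1..m. (?b J (lder G (?b (e r) (e s)) Y g) \<bullet> e r) *\<^sub>R e s)"
      by (simp add: kahler_def bracket_simps inner_diff_left scaleR_diff_left sum_subtractf scaleR_sum_right)
    then show ?thesis unfolding c4 by simp
  qed
  have JJ: "?b J (?b J (Y g)) = - Y g" by (rule J_square[OF sections_p[OF Y]])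
  have M: "?b J (cocurl ?u g) = - ?b J (?b J ?S1) + ?b J ?SA + 2 *\<^sub>R ?b J (?b J ?S2) - (lam / 2) *\<^sub>R Y g"
    unfolding cocurl_eq[OF u] c1 by (simp add: bracket_simps c2 c3 JJ)
  have T: "second_variation_formula Y g = (lam / 2) *\<^sub>R ?b J (lder G J Y g) + ?b J (?b J ?S1)
     - (3/2) *\<^sub>R ?b J (?b J ?S2) - ?b J ?SA - (1/2) *\<^sub>R ?b J (?b J ?S2)"
    unfolding second_variation_formula_def c5 by (simp add: bracket_simps algebra_simps)
  \<comment> \<open>The visible 3/2 and the 1/2 extracted in \<open>c5\<close> from the derivatives
    along [e_r, e_s] add up to the 2 of \<open>cocurl_eq\<close>.\<close>
  have "(3/2) *\<^sub>R ?b J (?b J ?S2) + (1/2) *\<^sub>R ?b J (?b J ?S2) = 2 *\<^sub>R ?b J (?b J ?S2)"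
    by (simp add: scaleR_add_left[symmetric])
  then show ?thesis unfolding T M by (simp add: algebra_simps)
qed

lemma second_variation_formula_section:
  assumes Y: "Y \<in> sections G K" shows "second_variation_formula Y \<in> sections G K"
proof -
  note Ys = sections_smooth[OF Y]
  have "smooth_fun G (second_variation_formula Y)"
    unfolding second_variation_formula_def kahler_def
    by (intro smooth_fun_linear[OF bounded_linear_minus[OF bounded_linear_ident]] smooth_fun_linear[OF bounded_linear_J]
       smooth_fun_add smooth_fun_diff smooth_fun_sum smooth_fun_linear[OF bounded_linear_scaleR_right]
       smooth_fun_bilinear[OF bounded_bilinear_bracket _ smooth_fun_const] smooth_fun_linear[OF bounded_linear_scaleR_left]
       smooth_fun_inner_const smooth_fun_lder Ys)
  moreover have "second_variation_formula Y g \<in> pp" for g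
    unfolding second_variation_formula_def by (rule subspace_neg[OF subspace_p J_bracket_p])
  ultimately show ?thesis by (auto simp: sections_def)
qed

end

section \<open>The Hessian of the energy\<close>

locale framed_variation = framed_pair G \<mu> K J e m n lam
  for G :: "('g::{t2_space, second_countable_topology}, 'a::euclidean_space, real^'m) lie_data"
    (structure) and \<mu> :: "'g measure" and K :: "'g set" and J :: 'a
    and e :: "nat \<Rightarrow> 'a" and m n :: nat and lam :: real +
  fixes \<epsilon> :: real and \<psi> :: "real \<Rightarrow> real \<Rightarrow> 'g \<Rightarrow> 'g set"
  assumes variation: "variation G K \<epsilon> \<psi>"
begin

declare One_nat_def [simp del]

abbreviation (input) W :: "(real \<times> real) set" where "W \<equiv> {-\<epsilon><..<\<epsilon>} \<times> {-\<epsilon><..<\<epsilon>}"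
abbreviation (input) \<Psi> :: "real \<times> real \<Rightarrow> 'g \<Rightarrow> 'g set" where "\<Psi> z \<equiv> \<psi> (fst z) (snd z)"

definition u :: "real \<times> real \<Rightarrow> 'g \<Rightarrow> 'a" where "u z g = orbitq (\<Psi> z g)"

lemma eps: "\<epsilon> > 0" and W_open: "open W" and zero_W: "(0, 0) \<in> W"
  using variation by (auto simp: variation_def open_Times)

lemma \<Psi>_smooth: "f \<in> quot_smooth G K \<Longrightarrow> smooth_par W (\<lambda>z g. f (\<Psi> z g))"
  using variation W_open by (simp add: variation_def smooth_par_def case_prod_unfold)

lemma \<Psi>_range: "z \<in> W \<Longrightarrow> \<Psi> z g \<in> range (proj G K)"
  using variation by (force simp: variation_def)

lemma u_smooth: "smooth_par W u"
  by (rule smooth_par_componentwise[OF W_open]) (use \<Psi>_smooth[OF orbitq_component] in \<open>simp add: u_def\<close>)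

lemma u_zero: "u (0, 0) = orbit"
  using variation by (simp add: variation_def u_def fun_eq_iff)

lemma \<Psi>_quot_map: "z \<in> W \<Longrightarrow> quot_map (\<Psi> z)"
  unfolding quot_map_def using smooth_par_fun[OF \<Psi>_smooth] \<Psi>_range by blast

text \<open>\<open>curve_frame\<close> applied in the parameter direction. An arbitrary
  representative \<open>h\<close> is allowed: \<open>rep\<close> is the one used for
  \<open>tangent\<close>, and at the projection h = g yields the variation field.\<close>

lemma pder_u:
  assumes z: "z \<in> W" and h: "\<Psi> z g = proj G K h"
  obtains v where "v \<in> pp" "pder d u z g = Ad G h (bracket G v J)"
    "frame_coord G K h (\<lambda>f. deriv (\<lambda>t. f (\<Psi> (z + t *\<^sub>R d) g)) 0) = v"
proof -
  let ?\<eta> = "\<lambda>t::real. \<Psi> (z + t *\<^sub>R d) g"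
  have der: "((\<lambda>t. f (?\<eta> t)) has_real_derivative pder d (\<lambda>z g. f (\<Psi> z g)) z g) (at 0)" if "f \<in> quot_smooth G K" for f
    using pder_has_vector_derivative[OF \<Psi>_smooth[OF that] z, of d g]
    by (simp add: has_real_derivative_iff_has_vector_derivative)
  let ?T = "(\<lambda>t::real. z + t *\<^sub>R d) -` W"
  have T: "open ?T" by (intro open_vimage W_open continuous_intros)
  obtain v where v: "v \<in> pp"
    "\<And>f. f \<in> quot_smooth G K \<Longrightarrow> ((\<lambda>t. f (?\<eta> t)) has_real_derivative lder G v (f \<circ> proj G K) h) (at 0)"
  proof (rule curve_frame[of ?\<eta> h ?T])
    show "?\<eta> 0 = proj G K h" by (simp add: h)
    show "0 \<in> ?T" using z by simp
    show "?\<eta> t \<in> range (proj G K)" if "t \<in> ?T" for t by (rule \<Psi>_range) (use that in simp)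
    show "\<exists>D. ((\<lambda>t. f (?\<eta> t)) has_real_derivative D) (at 0)" if "f \<in> quot_smooth G K" for f
      using der[OF that] by blast
    show "open ?T" by (rule T)
  qed blast
  show thesis
  proof (rule that[OF v(1)])
    show "pder d u z g = Ad G h (bracket G v J)"
      using vector_derivative_at[OF orbitq_curve_derivative[OF v(2)]] by (simp add: pder_def u_def)
    show "frame_coord G K h (\<lambda>f. deriv (\<lambda>t. f (?\<eta> t)) 0) = v"
      by (rule frame_coord_eq[OF v(1)]) (rule DERIV_imp_deriv[OF v(2)])
  qed
qed

text \<open>One representative of the coset is fixed, so that any three tangent vectors are
  translates by the same adjoint map, as \<open>tangent_triple_product\<close> requires.\<close>

definition tangent :: "real \<times> real \<Rightarrow> 'g \<Rightarrow> 'a \<Rightarrow> bool" where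
  "tangent z g w \<longleftrightarrow> (\<exists>v\<in>pp. w = Ad G (rep (\<Psi> z g)) (bracket G v J))"

lemma tangent_pder: "z \<in> W \<Longrightarrow> tangent z g (pder d u z g)"
  unfolding tangent_def by (rule pder_u[of z g "rep (\<Psi> z g)" d]) (auto simp: proj_rep[OF \<Psi>_range])

lemma tangent_lder: "z \<in> W \<Longrightarrow> tangent z g (lder G X (u z) g)"
  unfolding tangent_def u_def by (rule quot_map_differential[OF \<Psi>_quot_map]) auto

lemma tangent_triple: "tangent z g a \<Longrightarrow> tangent z g b \<Longrightarrow> tangent z g c \<Longrightarrow> a \<bullet> bracket G b c = 0"
  unfolding tangent_def by (elim bexE) (simp only: tangent_triple_product)

section \<open>The pulled back form and the energy along a variation\<close>

definition omega :: "'a \<Rightarrow> 'a \<Rightarrow> real \<times> real \<Rightarrow> 'g \<Rightarrow> real" where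
  "omega X Y z g = u z g \<bullet> bracket G (lder G X (u z) g) (lder G Y (u z) g)"

definition potential :: "real \<times> real \<Rightarrow> 'a \<Rightarrow> real \<times> real \<Rightarrow> 'g \<Rightarrow> real" where
  "potential d X z g = u z g \<bullet> bracket G (pder d u z g) (lder G X (u z) g)"

lemma omega_smooth: "smooth_par W (omega X Y)"
  unfolding omega_def
  by (intro smooth_par_inner smooth_par_bilinear[OF bounded_bilinear_bracket] smooth_par_lder u_smooth)

lemma potential_smooth: "smooth_par W (potential d X)"
  unfolding potential_def
  by (intro smooth_par_inner smooth_par_bilinear[OF bounded_bilinear_bracket] smooth_par_lder smooth_par_pder u_smooth)

text \<open>The pulled back Kaehler form is closed on the product of the parameter domain with \<open>G\<close>: the
  terms not cancelling formally are triple products of tangent vectors.\<close>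

lemma omega_closed:
  assumes z: "z \<in> W"
  shows "pder d (omega X Y) z g = lder G X (potential d Y z) g - lder G Y (potential d X z) g - potential d (bracket G X Y) z g"
proof -
  note B = bounded_bilinear_bracket and I = bounded_bilinear_inner
  note sl = smooth_par_lder[OF u_smooth] and sp = smooth_par_pder[OF u_smooth]
  note fu = smooth_par_fun[OF u_smooth z] and fl = smooth_par_fun[OF smooth_par_lder[OF u_smooth] z]
    and fp = smooth_par_fun[OF smooth_par_pder[OF u_smooth] z]
  let ?u = "u z g" and ?p = "pder d u z g" and ?a = "lder G X (u z) g" and ?b = "lder G Y (u z) g"
  let ?xp = "lder G X (pder d u z) g" and ?yp = "lder G Y (pder d u z) g"
  have T: "w1 \<bullet> bracket G w2 w3 = 0" if "tangent z g w1" "tangent z g w2" "tangent z g w3" for w1 w2 w3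
    by (rule tangent_triple[OF that])
  have 1: "pder d (omega X Y) z g = ?u \<bullet> bracket G ?a ?yp + ?u \<bullet> bracket G ?xp ?b"
    unfolding omega_def
    by (simp add: pder_bilinear[OF I u_smooth smooth_par_bilinear[OF B sl sl] z] pder_bilinear[OF B sl sl z]
        pder_lder[OF u_smooth z] T tangent_pder[OF z] tangent_lder[OF z] inner_add_right)
  have L: "lder G V (potential d Z z) g = ?u \<bullet> bracket G ?p (lder G V (lder G Z (u z)) g) +
      ?u \<bullet> bracket G (lder G V (pder d u z) g) (lder G Z (u z) g)" for V Z
    unfolding potential_def
    by (simp add: lder_bilinear[OF I fu smooth_fun_bilinear[OF B fp fl]] lder_bilinear[OF B fp fl]
        T tangent_pder[OF z] tangent_lder[OF z] inner_add_right)
  have "potential d (bracket G X Y) z g = ?u \<bullet> bracket G ?p (lder G X (lder G Y (u z)) g) - ?u \<bullet> bracket G ?p (lder G Y (lder G X (u z)) g)"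
    unfolding potential_def by (simp add: lder_bracket[OF fu] bracket_simps inner_diff_right)
  moreover have "bracket G ?yp ?a = - bracket G ?a ?yp" by (rule bracket_anticomm)
  ultimately show ?thesis unfolding 1 L by simp
qed

text \<open>The factor 1/4 is the 1/2 of the energy times the 1/2 of the norm on two-forms.\<close>

definition energy_integrand :: "real \<times> real \<Rightarrow> 'g \<Rightarrow> real" where
  "energy_integrand z g = (1/4) * (\<Sum>k=1..m. \<Sum>l=1..m. omega (e k) (e l) z g * omega (e k) (e l) z g)"

lemma energy_integral:
  assumes z: "z \<in> W" shows "energy G \<mu> K J (\<Psi> z) = (\<integral>g. energy_integrand z g \<partial>\<mu>)"
proof -
  note fu = smooth_par_fun[OF u_smooth z]
  have "form_norm_sq (pullback_kahler G K J (\<Psi> z) g) = 2 * energy_integrand z g" for g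
  proof -
    have p: "pullback_kahler G K J (\<Psi> z) g X Y = omega X Y z g" for X Y
      using pullback_kahler_orbitq[OF \<Psi>_quot_map[OF z], of g X Y] by (simp add: omega_def u_def[abs_def])
    have l1: "linear (\<lambda>X. omega X Y z g)" for Y
      using lder_linear_in[OF fu, of g] unfolding omega_def
      by (simp add: linear_iff bracket_simps inner_add_right)
    have l2: "linear (\<lambda>Y. omega X Y z g)" for X
      using lder_linear_in[OF fu, of g] unfolding omega_def
      by (simp add: linear_iff bracket_simps inner_add_right)
    have "(\<Sum>X\<in>Basis. \<Sum>Y\<in>Basis. (omega X Y z g)\<^sup>2) = (\<Sum>X\<in>Basis. \<Sum>l=1..m. (omega X (e l) z g)\<^sup>2)"
      by (simp only: frame_norm_sq[OF l2])
    also have "\<dots> = (\<Sum>l=1..m. \<Sum>X\<in>Basis. (omega X (e l) z g)\<^sup>2)" by (rule sum.swap)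
    also have "\<dots> = (\<Sum>l=1..m. \<Sum>k=1..m. (omega (e k) (e l) z g)\<^sup>2)" by (simp only: frame_norm_sq[OF l1])
    also have "\<dots> = (\<Sum>k=1..m. \<Sum>l=1..m. (omega (e k) (e l) z g)\<^sup>2)" by (rule sum.swap)
    finally show ?thesis by (simp add: form_norm_sq_def p energy_integrand_def power2_eq_square)
  qed
  then show ?thesis by (simp add: energy_def)
qed

lemma energy_integrand_smooth: "smooth_par W energy_integrand"
  unfolding energy_integrand_def
  by (intro smooth_par_mult smooth_par_sum smooth_par_constant omega_smooth W_open)

lemma pder_energy_integrand:
  assumes "z \<in> W"
  shows "pder d energy_integrand z g = (1/2) * (\<Sum>k=1..m. \<Sum>l=1..m. omega (e k) (e l) z g * pder d (omega (e k) (e l)) z g)"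
proof -
  note sq = smooth_par_mult[OF omega_smooth omega_smooth]
  have s: "smooth_par W (\<lambda>z g. \<Sum>l=1..m. omega (e k) (e l) z g * omega (e k) (e l) z g)" for k
    by (intro smooth_par_sum sq W_open)
  have ss: "smooth_par W (\<lambda>z g. \<Sum>k=1..m. \<Sum>l=1..m. omega (e k) (e l) z g * omega (e k) (e l) z g)"
    by (intro smooth_par_sum s W_open)
  have "pder d energy_integrand z g = (1/4) * (\<Sum>k=1..m. \<Sum>l=1..m. pder d (\<lambda>z g. omega (e k) (e l) z g * omega (e k) (e l) z g) z g)"
    unfolding energy_integrand_def
    by (simp only: pder_linear[OF bounded_linear_mult_right ss assms] pder_sum[OF s assms] pder_sum[OF sq assms])
  also have "\<dots> = (1/4) * (\<Sum>k=1..m. \<Sum>l=1..m. 2 * (omega (e k) (e l) z g * pder d (omega (e k) (e l)) z g))"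
    by (simp add: pder_bilinear[OF bounded_bilinear_mult omega_smooth omega_smooth assms] mult.commute)
  finally show ?thesis by (simp add: sum_distrib_left[symmetric])
qed

lemma pder_pder_energy_integrandity:
  assumes z: "z \<in> W"
  shows "pder c (pder d energy_integrand) z g = (1/2) * (\<Sum>k=1..m. \<Sum>l=1..m.
     omega (e k) (e l) z g * pder c (pder d (omega (e k) (e l))) z g + pder c (omega (e k) (e l)) z g * pder d (omega (e k) (e l)) z g)"
proof -
  note sp = smooth_par_pder[OF omega_smooth] and sq = smooth_par_mult[OF omega_smooth smooth_par_pder[OF omega_smooth]]
  have s: "smooth_par W (\<lambda>z g. \<Sum>l=1..m. omega (e k) (e l) z g * pder d (omega (e k) (e l)) z g)" for k
    by (intro smooth_par_sum sq W_open)
  have ss: "smooth_par W (\<lambda>z g. \<Sum>k=1..m. \<Sum>l=1..m. omega (e k) (e l) z g * pder d (omega (e k) (e l)) z g)"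
    by (intro smooth_par_sum s W_open)
  have "pder c (pder d energy_integrand) z g = pder c (\<lambda>z g. (1/2) * (\<Sum>k=1..m. \<Sum>l=1..m. omega (e k) (e l) z g * pder d (omega (e k) (e l)) z g)) z g"
    by (rule pder_cong[OF W_open z pder_energy_integrand])
  also have "\<dots> = (1/2) * (\<Sum>k=1..m. \<Sum>l=1..m. pder c (\<lambda>z g. omega (e k) (e l) z g * pder d (omega (e k) (e l)) z g) z g)"
    by (simp only: pder_linear[OF bounded_linear_mult_right ss z] pder_sum[OF s z] pder_sum[OF sq z])
  finally show ?thesis by (simp only: pder_bilinear[OF bounded_bilinear_mult omega_smooth sp z])
qed

lemma pder_pder_omega:
  assumes z: "z \<in> W"
  shows "pder c (pder d (omega X Y)) z g =
    lder G X (pder c (potential d Y) z) g - lder G Y (pder c (potential d X) z) g - pder c (potential d (bracket G X Y)) z g"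
proof -
  note sl = smooth_par_lder[OF potential_smooth]
  have "pder c (pder d (omega X Y)) z g =
      pder c (\<lambda>z g. lder G X (potential d Y z) g - lder G Y (potential d X z) g - potential d (bracket G X Y) z g) z g"
    by (rule pder_cong[OF W_open z omega_closed])
  also have "\<dots> = pder c (\<lambda>z. lder G X (potential d Y z)) z g - pder c (\<lambda>z. lder G Y (potential d X z)) z g - pder c (potential d (bracket G X Y)) z g"
    by (simp add: pder_diff[OF smooth_par_diff[OF sl sl] potential_smooth z] pder_diff[OF sl sl z])
  finally show ?thesis by (simp only: pder_lder[OF potential_smooth z])
qed

text \<open>Differentiation passes under the integral twice. The inner derivative has to be
  identified for all s near 0, since the outer one sees a neighbourhood.\<close>

lemma second_derivative_energy:
  "deriv (\<lambda>s. deriv (\<lambda>t. energy G \<mu> K J (\<psi> s t)) 0) 0 = (\<integral>g. pder (1, 0) (pder (0, 1) energy_integrand) (0, 0) g \<partial>\<mu>)"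
proof -
  have ev: "\<forall>\<^sub>F t in nhds 0. t \<in> {-\<epsilon><..<\<epsilon>}"
    by (rule eventually_nhds_in_open) (use eps in auto)
  have 1: "deriv (\<lambda>t. energy G \<mu> K J (\<psi> s t)) 0 = (\<integral>g. pder (0, 1) energy_integrand (s, 0) g \<partial>\<mu>)" if s: "s \<in> {-\<epsilon><..<\<epsilon>}" for s
  proof -
    have "deriv (\<lambda>t. energy G \<mu> K J (\<psi> s t)) 0 = deriv (\<lambda>t. \<integral>g. energy_integrand (s, t) g \<partial>\<mu>) 0"
      by (rule deriv_cong_ev[OF eventually_mono[OF ev] refl]) (use energy_integral[of "(s, _)"] s in simp)
    also have "\<dots> = (\<integral>g. pder (0, 1) energy_integrand (s, 0) g \<partial>\<mu>)"
      using DERIV_imp_deriv[OF integral_pder[OF energy_integrand_smooth, of "(s, 0)" "(0, 1)"]] s eps by simp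
    finally show ?thesis .
  qed
  have "deriv (\<lambda>s. deriv (\<lambda>t. energy G \<mu> K J (\<psi> s t)) 0) 0 = deriv (\<lambda>s. \<integral>g. pder (0, 1) energy_integrand (s, 0) g \<partial>\<mu>) 0"
    by (rule deriv_cong_ev[OF eventually_mono[OF ev] refl]) (rule 1)
  also have "\<dots> = (\<integral>g. pder (1, 0) (pder (0, 1) energy_integrand) (0, 0) g \<partial>\<mu>)"
    using DERIV_imp_deriv[OF integral_pder[OF smooth_par_pder[OF energy_integrand_smooth, of "(0, 1)"] zero_W, of "(1, 0)"]] by simp
  finally show ?thesis .
qed


section \<open>The Hessian at the projection\<close>

definition X :: "'g \<Rightarrow> 'a" where "X = variation_field G K (\<lambda>t. \<psi> 0 t)"
definition Y :: "'g \<Rightarrow> 'a" where "Y = variation_field G K (\<lambda>s. \<psi> s 0)"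

lemma pder_u_zero:
  fixes d :: "real \<times> real"
  defines "V \<equiv> \<lambda>g. variation_field G K (\<lambda>t. \<psi> (t * fst d) (t * snd d)) g"
  shows "V g \<in> pp" "pder d u (0, 0) g = Ad G g (bracket G (V g) J)"
proof -
  have b: "\<Psi> (0, 0) g = proj G K g" using variation by (simp add: variation_def)
  obtain v where v: "v \<in> pp" "pder d u (0, 0) g = Ad G g (bracket G v J)"
    "frame_coord G K g (\<lambda>f. deriv (\<lambda>t. f (\<Psi> ((0, 0) + t *\<^sub>R d) g)) 0) = v"
    by (rule pder_u[OF zero_W b])
  have "V g = v" using v(3) by (simp add: V_def variation_field_def)
  then show "V g \<in> pp" "pder d u (0, 0) g = Ad G g (bracket G (V g) J)" using v(1,2) by simp_all
qed

lemma X_p: "X g \<in> pp" and pder_u_X: "pder (0, 1) u (0, 0) g = Ad G g (bracket G (X g) J)"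
  using pder_u_zero[of "(0, 1)"] by (simp_all add: X_def)

lemma Y_p: "Y g \<in> pp" and pder_u_Y: "pder (1, 0) u (0, 0) g = Ad G g (bracket G (Y g) J)"
  using pder_u_zero[of "(1, 0)"] by (simp_all add: Y_def)

lemma inner_Ad_inv: "Ad G (inv g) w \<bullet> c = w \<bullet> Ad G g c"
  using Ad_inner[of g "Ad G (inv g) w" c] by simp

text \<open>Solving the equation for \<open>V\<close> with ad J exhibits it as a smooth expression.
  The components of Ad of the inverse are traded for Ad itself by orthogonality
  (\<open>inner_Ad_inv\<close>).\<close>

lemma section_from_pder:
  assumes V: "\<And>g. V g \<in> pp" "\<And>g. pder d u (0, 0) g = Ad G g (bracket G (V g) J)"
  shows "V \<in> sections G K"
proof -
  have eq: "V = (\<lambda>g. bracket G J (Ad G (inv g) (pder d u (0, 0) g)))"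
    by (simp add: V(2) J_bracket_J[OF V(1)])
  have "smooth_fun G (\<lambda>g. Ad G (inv g) (pder d u (0, 0) g))"
    by (rule smooth_fun_componentwise, unfold inner_Ad_inv)
      (rule smooth_fun_bilinear[OF bounded_bilinear_inner smooth_par_fun[OF smooth_par_pder[OF u_smooth] zero_W] smooth_fun_Ad])
  then have "smooth_fun G V" by (subst eq) (rule smooth_fun_linear[OF bounded_linear_J])
  then show ?thesis using V(1) by (auto simp: sections_def)
qed

lemma X_section: "X \<in> sections G K"
  by (rule section_from_pder[OF X_p pder_u_X])

lemma Y_section: "Y \<in> sections G K"
  by (rule section_from_pder[OF Y_p pder_u_Y])

lemma J_inner_bracket: "J \<bullet> bracket G A B = bracket G J A \<bullet> B"
proof -
  have "J \<bullet> bracket G A B = - (bracket G B A \<bullet> J)" using bracket_anticomm[of A B] by (simp add: inner_commute)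
  also have "\<dots> = A \<bullet> bracket G B J" by (simp add: inner_bracket)
  also have "\<dots> = - (A \<bullet> bracket G J B)" using bracket_anticomm[of B J] by simp
  finally show ?thesis by (simp add: inner_bracket)
qed

lemma orbit_inner_bracket: "orbit g \<bullet> bracket G (Ad G g A) (Ad G g B) = bracket G J A \<bullet> B"
  by (simp add: orbit_def Ad_bracket[symmetric] J_inner_bracket)

lemma omega_zero: "omega A B (0, 0) g = bracket G J A \<bullet> B"
proof -
  have "omega A B (0, 0) g = bracket G J (bracket G A J) \<bullet> bracket G B J"
    by (simp add: omega_def u_zero lder_orbit orbit_inner_bracket)
  also have "\<dots> = bracket G J (bracket G J A) \<bullet> bracket G J B"
    using bracket_anticomm[of A J] bracket_anticomm[of B J] by (simp add: bracket_simps)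
  also have "\<dots> = - (bracket G J (bracket G J (bracket G J A)) \<bullet> B)"
    by (simp add: inner_bracket[of J "bracket G J (bracket G J A)" B])
  also have "\<dots> = bracket G J A \<bullet> B" by (simp add: J_square[OF J_bracket_p])
  finally show ?thesis .
qed

lemma potential_zero:
  assumes "pder d u (0, 0) g = Ad G g (bracket G v J)" "v \<in> pp"
  shows "potential d B (0, 0) g = bracket G J v \<bullet> B"
proof -
  have "potential d B (0, 0) g = v \<bullet> bracket G B J"
    by (simp add: potential_def u_zero lder_orbit orbit_inner_bracket assms J_bracket_J)
  then show ?thesis using bracket_anticomm[of B J] by (simp add: inner_bracket)
qed

lemma pder_omega_zero:
  assumes V: "V \<in> sections G K" "\<And>g. pder d u (0, 0) g = Ad G g (bracket G (V g) J)"
  shows "pder d (omega A B) (0, 0) g = curl (\<lambda>g. bracket G J (V g)) A B g"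
proof -
  have b: "potential d B (0, 0) = (\<lambda>g. bracket G J (V g) \<bullet> B)" for B
    by (simp add: fun_eq_iff potential_zero[OF V(2) sections_p[OF V(1)]])
  have s: "smooth_fun G (\<lambda>g. bracket G J (V g))" by (rule smooth_fun_linear[OF bounded_linear_J sections_smooth[OF V(1)]])
  show ?thesis
    unfolding omega_closed[OF zero_W] b curl_def by (simp only: lder_linear[OF bounded_linear_inner_left s])
qed

text \<open>Expanding \<open>w\<close> in the frame leaves scalar functions times Ad of fixed
  vectors, to which the Leibniz rule and \<open>lder_Ad\<close> apply.\<close>

lemma lder_Ad_apply:
  assumes w: "smooth_fun G w"
  shows "lder G A (\<lambda>g. Ad G g (w g)) g = Ad G g (bracket G A (w g) + lder G A w g)"
proof -
  have eq: "(\<lambda>g. Ad G g (w g)) = (\<lambda>g. \<Sum>k=1..m. (w g \<bullet> e k) *\<^sub>R Ad G g (e k))"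
    by (simp only: frame_linear[OF linear_Ad])
  have s: "smooth_fun G (\<lambda>g. (w g \<bullet> e k) *\<^sub>R Ad G g (e k))" for k
    by (rule smooth_fun_bilinear[OF bounded_bilinear_scaleR smooth_fun_inner_const[OF w] smooth_fun_Ad])
  have "lder G A (\<lambda>g. (w g \<bullet> e k) *\<^sub>R Ad G g (e k)) g =
      (w g \<bullet> e k) *\<^sub>R Ad G g (bracket G A (e k)) + (lder G A w g \<bullet> e k) *\<^sub>R Ad G g (e k)" for k
    by (simp add: lder_bilinear[OF bounded_bilinear_scaleR smooth_fun_inner_const[OF w] smooth_fun_Ad] lder_Ad
        lder_linear[OF bounded_linear_inner_left w])
  then have "lder G A (\<lambda>g. Ad G g (w g)) g =
      (\<Sum>k=1..m. (w g \<bullet> e k) *\<^sub>R Ad G g (bracket G A (e k))) + (\<Sum>k=1..m. (lder G A w g \<bullet> e k) *\<^sub>R Ad G g (e k))"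
    unfolding eq by (simp add: lder_sum s sum.distrib)
  also have "(\<Sum>k=1..m. (w g \<bullet> e k) *\<^sub>R Ad G g (bracket G A (e k))) = Ad G g (bracket G A (w g))"
    using frame_linear[OF linear_compose[OF linear_bracket linear_Ad], of "w g" g A] by (simp add: comp_def)
  also have "(\<Sum>k=1..m. (lder G A w g \<bullet> e k) *\<^sub>R Ad G g (e k)) = Ad G g (lder G A w g)"
    by (rule frame_linear[OF linear_Ad])
  finally show ?thesis by (simp add: linear_add[OF linear_Ad])
qed

text \<open>The s-derivative of \<beta> at the projection, with \<beta> taken in the direction of t.
  In general it contains the mixed second derivative of the variation.\<close>

definition potential_rate :: "'a \<Rightarrow> 'g \<Rightarrow> real" where
  "potential_rate B g = pder (1, 0) (potential (0, 1) B) (0, 0) g"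

lemma potential_rate_smooth: "smooth_fun G (potential_rate B)"
  unfolding potential_rate_def[abs_def] by (rule smooth_par_fun[OF smooth_par_pder[OF potential_smooth] zero_W])

text \<open>Of the three terms of the product rule, the one that differentiates the outer factor
  \<open>u\<close> is a triple product of tangent vectors and vanishes.\<close>

lemma potential_rate_eq:
  "potential_rate B g = u (0, 0) g \<bullet> bracket G (pder (1, 0) (pder (0, 1) u) (0, 0) g) (lder G B (u (0, 0)) g)
    + u (0, 0) g \<bullet> bracket G (pder (0, 1) u (0, 0) g) (lder G B (pder (1, 0) u (0, 0)) g)"
proof -
  note B = bounded_bilinear_bracket and I = bounded_bilinear_inner
  note sl = smooth_par_lder[OF u_smooth] and sp = smooth_par_pder[OF u_smooth]
  have "pder (1, 0) u (0, 0) g \<bullet> bracket G (pder (0, 1) u (0, 0) g) (lder G B (u (0, 0)) g) = 0"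
    by (rule tangent_triple[OF tangent_pder[OF zero_W] tangent_pder[OF zero_W] tangent_lder[OF zero_W]])
  then show ?thesis
    unfolding potential_rate_def potential_def
    by (simp add: pder_bilinear[OF I u_smooth smooth_par_bilinear[OF B sp sl] zero_W] pder_bilinear[OF B sp sl zero_W]
        pder_lder[OF u_smooth zero_W] inner_add_right)
qed

lemma linear_potential_rate: "linear (\<lambda>B. potential_rate B g)"
  using lder_linear_in[OF smooth_par_fun[OF u_smooth zero_W], of g]
    lder_linear_in[OF smooth_par_fun[OF smooth_par_pder[OF u_smooth] zero_W], of "(1, 0)" g]
  unfolding potential_rate_eq by (simp add: linear_iff bracket_simps inner_add_right algebra_simps)

text \<open>The orbit map is constant along J because [J, J] = 0, so the term with the mixed second
  derivative of the variation disappears. What remains involves only the two variation fields and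
  the derivative of \<open>Y\<close> along J.\<close>

lemma potential_rate_J: "potential_rate J g = X g \<bullet> (Y g - bracket G J (lder G J Y g))"
proof -
  have Y: "smooth_fun G Y" by (rule sections_smooth[OF Y_section])
  have w: "smooth_fun G (\<lambda>g. bracket G (Y g) J)"
    by (rule smooth_fun_bilinear[OF bounded_bilinear_bracket Y smooth_fun_const])
  have lw: "lder G J (\<lambda>g. bracket G (Y g) J) g = bracket G (lder G J Y g) J"
    by (simp add: lder_bilinear[OF bounded_bilinear_bracket Y smooth_fun_const] lder_const bracket_simps)
  have "potential_rate J g = X g \<bullet> (Y g + bracket G (lder G J Y g) J)"
    unfolding potential_rate_eq u_zero pder_u_X pder_u_Y lder_Ad_apply[OF w] lw orbit_inner_bracket
    by (simp add: lder_orbit bracket_self bracket_simps linear_0[OF linear_Ad] J_bracket_J X_p Y_p)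
  then show ?thesis using bracket_anticomm[of "lder G J Y g" J] by simp
qed

text \<open>The rate is linear in its argument, so the contraction with the constant coefficients of
  \<omega> can be carried out inside it; there it is the Casimir operator applied to J.\<close>

lemma frame_omega_potential_rate:
  "(\<Sum>k=1..m. \<Sum>l=1..m. (bracket G J (e k) \<bullet> e l) * potential_rate (bracket G (e k) (e l)) g) = lam * potential_rate J g"
proof -
  have "(\<Sum>l=1..m. (bracket G J (e k) \<bullet> e l) *\<^sub>R potential_rate (bracket G (e k) (e l)) g) = potential_rate (bracket G (e k) (bracket G J (e k))) g" for k
    using frame_linear[OF linear_compose[OF linear_bracket linear_potential_rate], of "bracket G J (e k)" g "e k"] by (simp add: comp_def)
  then have "(\<Sum>k=1..m. \<Sum>l=1..m. (bracket G J (e k) \<bullet> e l) * potential_rate (bracket G (e k) (e l)) g) =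
      potential_rate (\<Sum>k=1..m. bracket G (e k) (bracket G J (e k))) g"
    by (simp add: linear_sum[OF linear_potential_rate])
  also have "(\<Sum>k=1..m. bracket G (e k) (bracket G J (e k))) = lam *\<^sub>R J"
  proof -
    have "bracket G (e k) (bracket G J (e k)) = - bracket G (e k) (bracket G (e k) J)" for k
      using bracket_anticomm[of J "e k"] by (simp add: bracket_simps)
    then show ?thesis by (simp add: sum_negf casimir')
  qed
  finally show ?thesis by (simp add: linear_scale[OF linear_potential_rate])
qed

text \<open>The component along \<open>e k\<close> of the field whose divergence is discarded. The
  first sum arises from integrating the product of the two curls by parts, the second from
  integrating \<omega> against d of the rate.\<close>

definition boundary :: "nat \<Rightarrow> 'g \<Rightarrow> real" where
  "boundary k g = (\<Sum>l=1..m. (bracket G J (X g) \<bullet> e l) * curl (\<lambda>g. bracket G J (Y g)) (e k) (e l) g)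
     + (\<Sum>l=1..m. (bracket G J (e k) \<bullet> e l) * potential_rate (e l) g)"

lemma boundary_smooth: "smooth_fun G (boundary k)"
  unfolding boundary_def
  by (intro smooth_fun_add smooth_fun_sum smooth_fun_bilinear[OF bounded_bilinear_mult] smooth_fun_const potential_rate_smooth
      curl_smooth smooth_fun_inner_const smooth_fun_linear[OF bounded_linear_J] sections_smooth X_section Y_section)

text \<open>The product rule gives \<omega> times its mixed second variation plus the product of its
  two first variations. The former has constant coefficients, so it is a divergence up to the
  Casimir term; the latter is a product of curls of [J, X] and [J, Y], treated by
  \<open>curl_integration_by_parts\<close>.\<close>

lemma hessian_density:
  "pder (1, 0) (pder (0, 1) energy_integrand) (0, 0) g =
    X g \<bullet> second_variation_formula Y g + (\<Sum>k=1..m. lder G (e k) (boundary k) g)"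
proof -
  let ?u = "\<lambda>g. bracket G J (Y g)" and ?v = "\<lambda>g. bracket G J (X g)"
  let ?a = "\<lambda>k l. bracket G J (e k) \<bullet> e l"
  have su: "smooth_fun G ?u" and sv: "smooth_fun G ?v"
    by (intro smooth_fun_linear[OF bounded_linear_J] sections_smooth X_section Y_section)+
  have aa: "?a l k = - ?a k l" for k l
    using inner_bracket[of J "e l" "e k"] by (simp only: inner_commute[of "e l"])
  have lb: "lder G (e k) (boundary k) g =
      lder G (e k) (\<lambda>g. \<Sum>l=1..m. (?v g \<bullet> e l) * curl ?u (e k) (e l) g) g + (\<Sum>l=1..m. ?a k l * lder G (e k) (potential_rate (e l)) g)" for k
  proof -
    have s1: "smooth_fun G (\<lambda>g. \<Sum>l=1..m. (?v g \<bullet> e l) * curl ?u (e k) (e l) g)"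
      by (intro smooth_fun_sum smooth_fun_bilinear[OF bounded_bilinear_mult] curl_smooth smooth_fun_inner_const su sv)
    have s2: "smooth_fun G (\<lambda>g. ?a k l * potential_rate (e l) g)" for l
      by (rule smooth_fun_linear[OF bounded_linear_mult_right potential_rate_smooth])
    have s3: "smooth_fun G (\<lambda>g. \<Sum>l=1..m. ?a k l * potential_rate (e l) g)"
      by (rule smooth_fun_sum[OF s2])
    show ?thesis
      unfolding boundary_def
      by (simp only: lder_add[OF s1 s3] lder_sum[OF s2] lder_linear[OF bounded_linear_mult_right potential_rate_smooth])
  qed
  \<comment> \<open>The coefficients of \<omega> are antisymmetric in k and l, so the two derivative
    terms of d applied to the rate agree after contraction and cancel the factor 1/2.\<close>
  have sw: "(\<Sum>k=1..m. \<Sum>l=1..m. ?a k l * lder G (e l) (potential_rate (e k)) g) = - (\<Sum>k=1..m. \<Sum>l=1..m. ?a k l * lder G (e k) (potential_rate (e l)) g)"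
  proof -
    have "(\<Sum>k=1..m. \<Sum>l=1..m. ?a k l * lder G (e l) (potential_rate (e k)) g) = (\<Sum>l=1..m. \<Sum>k=1..m. - (?a l k * lder G (e l) (potential_rate (e k)) g))"
      by (subst sum.swap) (intro sum.cong refl, subst aa, simp)
    then show ?thesis by (simp only: sum_negf)
  qed
  have "pder (1, 0) (pder (0, 1) energy_integrand) (0, 0) g =
      (1/2) * ((\<Sum>k=1..m. \<Sum>l=1..m. ?a k l * lder G (e k) (potential_rate (e l)) g) - (\<Sum>k=1..m. \<Sum>l=1..m. ?a k l * lder G (e l) (potential_rate (e k)) g)
        - (\<Sum>k=1..m. \<Sum>l=1..m. ?a k l * potential_rate (bracket G (e k) (e l)) g))
      + (1/2) * (\<Sum>k=1..m. \<Sum>l=1..m. curl ?v (e k) (e l) g * curl ?u (e k) (e l) g)"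
    unfolding pder_pder_energy_integrandity[OF zero_W] pder_pder_omega[OF zero_W] omega_zero potential_rate_def[symmetric, abs_def]
      pder_omega_zero[OF X_section pder_u_X] pder_omega_zero[OF Y_section pder_u_Y]
    by (simp add: sum.distrib sum_subtractf right_diff_distrib distrib_left mult.commute[of "curl ?u _ _ g"])
  also have "\<dots> = (\<Sum>k=1..m. \<Sum>l=1..m. ?a k l * lder G (e k) (potential_rate (e l)) g) - (lam / 2) * potential_rate J g
      + (\<Sum>k=1..m. lder G (e k) (\<lambda>g. \<Sum>l=1..m. (?v g \<bullet> e l) * curl ?u (e k) (e l) g) g) + ?v g \<bullet> cocurl ?u g"
    unfolding sw frame_omega_potential_rate curl_integration_by_parts[OF su sv] by simp
  also have "\<dots> = ?v g \<bullet> cocurl ?u g - (lam / 2) * potential_rate J g + (\<Sum>k=1..m. lder G (e k) (boundary k) g)"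
    by (simp add: lb sum.distrib)
  also have "?v g \<bullet> cocurl ?u g - (lam / 2) * potential_rate J g = X g \<bullet> second_variation_formula Y g"
    by (simp add: second_variation_formula_cocurl[OF Y_section] potential_rate_J inner_bracket inner_diff_right)
  finally show ?thesis .
qed

lemma hessian_eq:
  "deriv (\<lambda>s. deriv (\<lambda>t. energy G \<mu> K J (\<psi> s t)) 0) 0 = (\<integral>g. X g \<bullet> second_variation_formula Y g \<partial>\<mu>)"
proof -
  have i1: "integrable \<mu> (\<lambda>g. X g \<bullet> second_variation_formula Y g)"
    by (intro integrable_continuous smooth_fun_imp_continuous smooth_fun_bilinear[OF bounded_bilinear_inner]
        sections_smooth X_section Y_section second_variation_formula_section)
  have i2: "integrable \<mu> (lder G (e k) (boundary k))" for k
    by (intro integrable_continuous smooth_fun_imp_continuous smooth_fun_lder boundary_smooth)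
  have "(\<integral>g. X g \<bullet> second_variation_formula Y g + (\<Sum>k=1..m. lder G (e k) (boundary k) g) \<partial>\<mu>) =
      (\<integral>g. X g \<bullet> second_variation_formula Y g \<partial>\<mu>)"
    by (simp add: Bochner_Integration.integral_add[OF i1 Bochner_Integration.integrable_sum] Bochner_Integration.integral_sum i2 integral_lder[OF boundary_smooth])
  then show ?thesis by (simp only: second_derivative_energy hessian_density)
qed

end

section \<open>Identification of the second variation operator\<close>

context framed_pair
begin

lemma represents_second_variation_formula:
  assumes Y: "Y \<in> sections G K"
  shows "represents_hessian G \<mu> K J Y (second_variation_formula Y)"
  unfolding represents_hessian_def
proof (intro conjI allI impI second_variation_formula_section[OF Y])
  fix \<epsilon> \<psi> assume v: "variation G K \<epsilon> \<psi> \<and> variation_field G K (\<lambda>s. \<psi> s 0) = Y"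
  interpret V: framed_variation G \<mu> K J e m n lam \<epsilon> \<psi>
    by unfold_locales (use v in blast)
  show "deriv (\<lambda>s. deriv (\<lambda>t. energy G \<mu> K J (\<psi> s t)) 0) 0 =
    (\<integral>g. variation_field G K (\<lambda>t. \<psi> 0 t) g \<bullet> second_variation_formula Y g \<partial>\<mu>)"
    using V.hessian_eq v by (simp add: V.X_def V.Y_def)
qed

text \<open>The exponent is linear in (s, t), so along either axis the variation is t -> g
  exp(tV).o, whose frame coordinate at 0 is V. Smoothness holds for all parameters; the radius 1 is
  a free choice.\<close>

lemma exp_variation:
  fixes X Y :: "'g \<Rightarrow> 'a"
  assumes X: "X \<in> sections G K" and Y: "Y \<in> sections G K"
  defines "\<psi> \<equiv> \<lambda>s t g. proj G K (g \<otimes> lie_exp G (s *\<^sub>R Y g + t *\<^sub>R X g))"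
  shows "variation G K 1 \<psi>" "variation_field G K (\<lambda>s. \<psi> s 0) = Y" "variation_field G K (\<lambda>t. \<psi> 0 t) = X"
proof -
  have "smooth_par UNIV (\<lambda>z g. f (\<psi> (fst z) (snd z) g))" if "f \<in> quot_smooth G K" for f
  proof (rule smooth_parI[OF open_UNIV])
    fix U c assume c: "(U, c) \<in> atlas G"
    have o: "open ((UNIV :: (real \<times> real) set) \<times> c ` U)" by (rule open_Times[OF open_UNIV top_atlas_chart(2)[OF top_atlas_G c]])
    have p: "plot (UNIV \<times> c ` U) (\<lambda>y :: (real \<times> real) \<times> (real^'m). inv_into U c (snd y))"
      by (rule plot_compose[OF plot_chart[OF c] smooth_on_snd[OF smooth_on_id] o]) auto
    have "smooth_on (UNIV \<times> c ` U) (\<lambda>y. (f \<circ> proj G K) (inv_into U c (snd y) \<otimes>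
        lie_exp G (fst (fst y) *\<^sub>R Y (inv_into U c (snd y)) + snd (fst y) *\<^sub>R X (inv_into U c (snd y)))))"
      by (intro smooth_fun_plot[OF quot_smoothD[OF that]] plot_mult[OF p] plot_exp smooth_on_add o
          smooth_on_bilinear[OF bounded_bilinear_scaleR] smooth_fun_plot[OF sections_smooth p] X Y
          smooth_on_fst smooth_on_snd smooth_on_id)
    then show "smooth_on (UNIV \<times> c ` U) (\<lambda>y. f (\<psi> (fst (fst y)) (snd (fst y)) (inv_into U c (snd y))))"
      by (simp add: \<psi>_def)
  qed
  then have "smooth_par ({-1<..<1} \<times> {-1<..<1}) (\<lambda>z g. f (\<psi> (fst z) (snd z) g))" if "f \<in> quot_smooth G K" for f
    using smooth_par_subset[of UNIV "\<lambda>z g. f (\<psi> (fst z) (snd z) g)"] that by (simp add: open_Times)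
  then show "variation G K 1 \<psi>"
    by (simp add: variation_def smooth_par_def case_prod_unfold \<psi>_def fun_eq_iff image_subset_iff)
  have "frame_coord G K g (\<lambda>f. deriv (\<lambda>t. f (proj G K (g \<otimes> lie_exp G (t *\<^sub>R V)))) 0) = V" if "V \<in> pp" for V g
  proof (rule frame_coord_eq[OF that])
    fix f assume "f \<in> quot_smooth G K"
    from lder_has_vector_derivative[OF quot_smoothD[OF this], of g V]
    show "deriv (\<lambda>t. f (proj G K (g \<otimes> lie_exp G (t *\<^sub>R V)))) 0 = lder G V (f \<circ> proj G K) g"
      by (simp add: DERIV_imp_deriv has_real_derivative_iff_has_vector_derivative)
  qed
  then show "variation_field G K (\<lambda>s. \<psi> s 0) = Y" "variation_field G K (\<lambda>t. \<psi> 0 t) = X"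
    by (simp_all add: variation_field_def fun_eq_iff \<psi>_def sections_p[OF X] sections_p[OF Y])
qed

text \<open>The difference of the two candidates is itself a section, so some variation has it as
  its t-field together with \<open>Y\<close> as its s-field. Comparing both representations of the
  same second derivative makes the integral of the squared norm of the difference vanish, and the
  volume has full support.\<close>

lemma represents_hessian_unique:
  assumes Y: "Y \<in> sections G K" and 1: "represents_hessian G \<mu> K J Y Z1" and 2: "represents_hessian G \<mu> K J Y Z2"
  shows "Z1 = Z2"
proof -
  have Z: "Z1 \<in> sections G K" "Z2 \<in> sections G K" using 1 2 by (simp_all add: represents_hessian_def)
  let ?X = "\<lambda>g. Z1 g - Z2 g"
  have X: "?X \<in> sections G K"
    using smooth_fun_diff[OF Z[THEN sections_smooth]] subspace_diff[OF subspace_p Z[THEN sections_p]]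
    by (auto simp: sections_def)
  have smc: "continuous_on UNIV (\<lambda>g. ?X g \<bullet> V g)" if "V \<in> sections G K" for V
    by (rule smooth_fun_imp_continuous[OF smooth_fun_bilinear[OF bounded_bilinear_inner sections_smooth[OF X] sections_smooth[OF that]]])
  note v = exp_variation[OF X Y]
  have "(\<integral>g. ?X g \<bullet> Z1 g \<partial>\<mu>) = (\<integral>g. ?X g \<bullet> Z2 g \<partial>\<mu>)"
    using conjunct2[OF 1[unfolded represents_hessian_def], rule_format, OF conjI[OF v(1,2)]]
      conjunct2[OF 2[unfolded represents_hessian_def], rule_format, OF conjI[OF v(1,2)]]
    unfolding v(3) by (rule box_equals[OF _ refl refl, OF trans[OF sym]])
  then have i: "(\<integral>g. ?X g \<bullet> ?X g \<partial>\<mu>) = 0"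
    by (simp add: inner_diff_right[of "?X _"] Bochner_Integration.integral_diff integrable_continuous[OF smc[OF Z(1)]] integrable_continuous[OF smc[OF Z(2)]])
  have "?X g \<bullet> ?X g = 0" for g
    by (rule integral_zero_imp_zero[OF smc[OF X] inner_ge_zero i])
  then show ?thesis by (simp add: fun_eq_iff)
qed

lemma second_variation_eq:
  assumes "Y \<in> sections G K" shows "second_variation G \<mu> K J Y = second_variation_formula Y"
  unfolding second_variation_def
proof (rule the_equality)
  show "represents_hessian G \<mu> K J Y (second_variation_formula Y)" by (rule represents_second_variation_formula[OF assms])
qed (rule represents_hessian_unique[OF assms _ represents_second_variation_formula[OF assms]])

end

theorem proposition5p1:
  fixes G :: "('g::{t2_space, second_countable_topology}, 'a::euclidean_space, real^'m) lie_data"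
    and K :: "'g set" and J :: 'a and \<mu> :: "'g measure"
    and e :: "nat \<Rightarrow> 'a" and m n :: nat and lam :: real and Y :: "'g \<Rightarrow> 'a"
  assumes "lie_group G"
    and "compact (UNIV :: 'g set)" and "connected (UNIV :: 'g set)"
    and "lie_simple G"
    and "killing_metric G"
    and "riemannian_volume G \<mu>"
    and "subgroup K G" and "compact K"
    and "symmetric_pair G K"
    and "isotropy_irreducible G K"
    and "hermitian_element G K J"
    and "m = DIM('a)" and "n = dim (lie_compl G K)"
    and "\<forall>i\<in>{1..m}. \<forall>j\<in>{1..m}. e i \<bullet> e j = (if i = j then 1 else 0)"
    and "span (e ` {1..m-n}) = lie_sub G K"
    and "span (e ` {m-n+1..m}) = lie_compl G K"
    and "\<forall>X. - (\<Sum>k=1..m. bracket G (e k) (bracket G (e k) X)) = lam *\<^sub>R X"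
    and "Y \<in> sections G K"
  shows "second_variation G \<mu> K J Y = (\<lambda>g.
    - bracket G J
        (- (lam / 2) *\<^sub>R lder G J Y g
         - bracket G J (\<Sum>k=1..m. lder G (e k) (lder G (e k) Y) g)
         + (3/2) *\<^sub>R bracket G J (\<Sum>a=1..m-n. bracket G (lder G (e a) Y g) (e a))
         + (\<Sum>r=m-n+1..m. \<Sum>s=m-n+1..m.
              kahler G J (lder G (e r) (lder G (e s) Y) g
                          - (1/2) *\<^sub>R lder G (bracket G (e r) (e s)) Y g) (e r) *\<^sub>R e s)))"
  proof -
  have k: "subspace (lie_sub G K)" using assms(15) subspace_span by metis
  interpret framed_pair G \<mu> K J e m n lam
    unfolding framed_pair_def framed_pair_axioms_def hermitian_pair_def hermitian_pair_axioms_def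
      riemannian_lie_group_def riemannian_lie_group_axioms_def killing_lie_group_def killing_lie_group_axioms_def
    by (intro conjI assms k)
  show ?thesis
    unfolding second_variation_eq[OF assms(18)] second_variation_formula_def by (rule refl)
qed

end
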